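(* Fix constants $c,c'>0$. There is a randomized algorithm which, given an undirected weighted graph $G$ on $n$ vertices whose edge weights all lie in $[n^{-c},n^{c'}]$, a unit vector $b\in\mathsf{Im}(L_G)$, and parameters $\epsilon,\gamma\in(0,1)$, outputs with probability at least $1-\gamma$ an $\epsilon$-additive approximation of the solution $L_G^\dagger b$ of the Laplacian system $L_Gx=b$, and uses $O(\log(n/\epsilon)+\log\log(1/\gamma))$ space (the constant in the $O$ may depend on $c,c'$).
   Context: An undirected weighted graph $G=(V,E)$ on $n$ vertices (loops allowed) has a symmetric weight function $w:V\times V\to\mathbb R$ with $w(i,j)>0$ if $(i,j)\in E$ and $w(i,j)=0$ otherwise. The degree of $i$ is $d_i=\sum_j w(i,j)$. The (normalized) Laplacian $L_G$ is the $n\times n$ symmetric matrix with $L_G[i,i]=1-w(i,i)/d_i$ if $d_i\neq 0$, $L_G[i,j]=-w(i,j)/\sqrt{d_id_j}$ if $(i,j)\in E$ and $i\ne j$, and $0$ otherwise. Writing $L_G=\sum_i\lambda_iu_iu_i^t$ with $\{u_i\}$ an orthonormal eigenbasis, $\mathsf{Im}(L_G)$ is the span of eigenvectors with nonzero eigenvalue and $L_G^\dagger=\sum_{i:\lambda_i\neq0}\lambda_i^{-1}u_iu_i^t$ is the Moore–Penrose pseudo-inverse. An $\epsilon$-additive approximation of a real number $b$ is a real $a$ with $|a-b|\le\epsilon$; an $\epsilon$-additive approximation of a vector means a vector each of whose coordinates is an $\epsilon$-additive approximation of the corresponding coordinate. Computational model: a space-bounded randomized algorithm with read-only access to the input and access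 to random bits; standard arithmetic operations on $O(\log m)$-bit reals (reals of absolute value between $m^{-C}$ and $m^{C'}$ for constants $C,C'$) are assumed to be performed exactly in $O(\log m)$ space. Space counts the work memory (output written to a write-only tape). *)

theory Defs
  imports
    "HOL-Probability.Probability"
    "HOL-Library.Log_Nat"
    "Jordan_Normal_Form.Char_Poly"
    "Jordan_Normal_Form.VS_Connect"
begin

unbundle no vec_syntax
unbundle no inner_syntax
hide_type (open) Finite_Cartesian_Product.vec
hide_const (open) Finite_Cartesian_Product.vec

section \<open>Weighted graphs and their normalized Laplacian\<close>

text \<open>The vertex set is \<open>{..<nverts G}\<close>; the weight function is extended by 0 to all pairs.\<close>

record wgraph =
  nverts :: nat
  edges :: "(nat \<times> nat) set"
  wt :: "nat \<Rightarrow> nat \<Rightarrow> real"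

definition weighted_graph :: "wgraph \<Rightarrow> bool" where
  "weighted_graph G \<longleftrightarrow>
     edges G \<subseteq> {..<nverts G} \<times> {..<nverts G} \<and> sym (edges G) \<and>
     (\<forall>i j. wt G i j = wt G j i) \<and>
     (\<forall>i j. if (i, j) \<in> edges G then wt G i j > 0 else wt G i j = 0)"

definition degree :: "wgraph \<Rightarrow> nat \<Rightarrow> real" where
  "degree G i = (\<Sum>j<nverts G. wt G i j)"

definition laplacian :: "wgraph \<Rightarrow> real mat" where
  "laplacian G = mat (nverts G) (nverts G) (\<lambda>(i, j).
     if i = j then (if degree G i \<noteq> 0 then 1 - wt G i i / degree G i else 0)
     else if (i, j) \<in> edges G then - wt G i j / sqrt (degree G i * degree G j)
     else 0)"

section \<open>Image and pseudo-inverse of a real symmetric matrix\<close>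

definition orthonormal_eigenbasis :: "real mat \<Rightarrow> (nat \<Rightarrow> real) \<Rightarrow> (nat \<Rightarrow> real vec) \<Rightarrow> bool" where
  "orthonormal_eigenbasis A l u \<longleftrightarrow>
     (\<forall>k<dim_row A. eigenvector A (u k) (l k)) \<and>
     (\<forall>k<dim_row A. \<forall>m<dim_row A. u k \<bullet> u m = (if k = m then 1 else 0))"

definition eigen_image :: "real mat \<Rightarrow> real vec set" where
  "eigen_image A = LinearCombinations.module.span class_ring (module_vec TYPE(real) (dim_row A))
     {v. \<exists>k. k \<noteq> 0 \<and> eigenvector A v k}"

text \<open>For symmetric \<open>A\<close> an orthonormal eigenbasis exists, and the matrix below does not depend
  on which one is chosen.\<close>

definition pseudo_inverse :: "real mat \<Rightarrow> real mat" where
  "pseudo_inverse A = (SOME P. \<exists>l u. orthonormal_eigenbasis A l u \<and>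
     P = mat (dim_row A) (dim_row A)
           (\<lambda>(i, j). \<Sum>k | k < dim_row A \<and> l k \<noteq> 0. inverse (l k) * (u k $ i * u k $ j)))"

definition vec_additive_approx :: "real \<Rightarrow> real vec \<Rightarrow> real vec \<Rightarrow> bool" where
  "vec_additive_approx e a b \<longleftrightarrow> dim_vec a = dim_vec b \<and> (\<forall>i<dim_vec b. \<bar>a $ i - b $ i\<bar> \<le> e)"

section \<open>Space-bounded randomized computation\<close>

text \<open>
  The machine is a coin-tossing register machine. A program uses finitely many registers, each
  holding an integer, and the integer operations are exact single steps. Work space is the total
  number of bits held in the registers, so a register of \<open>O(log m)\<close> bits holds an
  \<open>O(log m)\<close>-bit (fixed-point) real. Registers do not hold reals of unlimited precision,
  because a single such register could serve as a memory of unbounded size.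

  The input is read-only and consists of real numbers given by their binary expansions: reading
  \<open>x\<close> at precision \<open>k\<close> yields \<open>\<lfloor>2 ^ k * x\<rfloor>\<close>, where the indices and \<open>k\<close> are taken
  from registers and so count towards the space, as does the result. Output goes to a write-only
  tape: writing the registers \<open>a\<close>, \<open>k\<close> appends the dyadic number \<open>a / 2 ^ k\<close>.
\<close>

record problem =
  graph :: wgraph
  rhs :: "real vec"
  eps :: real
  gam :: real

datatype arith_op = Plus | Minus | Times | Divide | Modulo

fun arith :: "arith_op \<Rightarrow> int \<Rightarrow> int \<Rightarrow> int" where
  "arith Plus x y = x + y"
| "arith Minus x y = x - y"
| "arith Times x y = x * y"
| "arith Divide x y = x div y"
| "arith Modulo x y = x mod y"

text \<open>The first argument of an instruction other than \<open>Write\<close> is the target register.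
  \<open>Cond\<close> and \<open>Loop\<close> test whether the first register is less than the second.\<close>

datatype (regs: 'r) cmd =
    Skip
  | Const 'r int
  | Arith arith_op 'r 'r 'r
  | Coin 'r
  | ReadSize 'r
  | ReadWeight 'r 'r 'r 'r
  | ReadRhs 'r 'r 'r
  | ReadEps 'r 'r
  | ReadGam 'r 'r
  | Write 'r 'r
  | Seq "'r cmd" "'r cmd"
  | Cond 'r 'r "'r cmd" "'r cmd"
  | Loop 'r 'r "'r cmd"

type_synonym program = "nat cmd"
type_synonym store = "nat \<Rightarrow> int"
type_synonym config = "program \<times> store \<times> real list"

definition fixed_point :: "real \<Rightarrow> int \<Rightarrow> int" where
  "fixed_point x k = \<lfloor>2 ^ nat k * x\<rfloor>"

definition rhs_entry :: "problem \<Rightarrow> int \<Rightarrow> real" where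
  "rhs_entry I i = (if nat i < dim_vec (rhs I) then rhs I $ nat i else 0)"

text \<open>In a configuration, the command is the part of the program still to be executed; for a
  given program it ranges over a finite set, so it plays the role of the finite control.\<close>

fun step :: "problem \<Rightarrow> config \<Rightarrow> config pmf" where
  "step I (Skip, s, out) = return_pmf (Skip, s, out)"
| "step I (Const r z, s, out) = return_pmf (Skip, s(r := z), out)"
| "step I (Arith f r p q, s, out) = return_pmf (Skip, s(r := arith f (s p) (s q)), out)"
| "step I (Coin r, s, out) =
     map_pmf (\<lambda>b. (Skip, s(r := of_bool b), out)) (bernoulli_pmf (1 / 2))"
| "step I (ReadSize r, s, out) = return_pmf (Skip, s(r := int (nverts (graph I))), out)"
| "step I (ReadWeight r i j k, s, out) =
     return_pmf (Skip, s(r := fixed_point (wt (graph I) (nat (s i)) (nat (s j))) (s k)), out)"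
| "step I (ReadRhs r i k, s, out) =
     return_pmf (Skip, s(r := fixed_point (rhs_entry I (s i)) (s k)), out)"
| "step I (ReadEps r k, s, out) = return_pmf (Skip, s(r := fixed_point (eps I) (s k)), out)"
| "step I (ReadGam r k, s, out) = return_pmf (Skip, s(r := fixed_point (gam I) (s k)), out)"
| "step I (Write r k, s, out) =
     return_pmf (Skip, s, out @ [of_int (s r) / 2 ^ nat (s k)])"
| "step I (Seq c d, s, out) =
     (if c = Skip then return_pmf (d, s, out)
      else map_pmf (\<lambda>(c', s', out'). (Seq c' d, s', out')) (step I (c, s, out)))"
| "step I (Cond p q c d, s, out) = return_pmf (if s p < s q then c else d, s, out)"
| "step I (Loop p q c, s, out) = return_pmf (Cond p q (Seq c (Loop p q c)) Skip, s, out)"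

definition run :: "program \<Rightarrow> problem \<Rightarrow> nat \<Rightarrow> config pmf" where
  "run P I t = ((\<lambda>D. bind_pmf D (step I)) ^^ t) (return_pmf (P, (\<lambda>_. 0), []))"

text \<open>One bit per register is for the sign.\<close>

definition space :: "program \<Rightarrow> store \<Rightarrow> nat" where
  "space P s = (\<Sum>r\<in>regs P. 1 + floorlog 2 (nat \<bar>s r\<bar>))"

definition uses_space :: "program \<Rightarrow> problem \<Rightarrow> real \<Rightarrow> bool" where
  "uses_space P I B \<longleftrightarrow> (\<forall>t. \<forall>(c, s, out) \<in> set_pmf (run P I t). real (space P s) \<le> B)"

text \<open>The program halts on all coin sequences within some number of steps (equivalently, it halts
  on every coin sequence), and its output satisfies \<open>Q\<close> with probability at least \<open>p\<close>.\<close>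

definition outputs_with_prob :: "program \<Rightarrow> problem \<Rightarrow> real \<Rightarrow> (real vec \<Rightarrow> bool) \<Rightarrow> bool" where
  "outputs_with_prob P I p Q \<longleftrightarrow>
     (\<exists>T. (\<forall>(c, s, out) \<in> set_pmf (run P I T). c = Skip) \<and>
          measure_pmf.prob (run P I T) {(c, s, out). Q (vec_of_list out)} \<ge> p)"

end

theory Submission
  imports Defs "HOL-Library.Discrete_Functions"
begin

text \<open>
  Let \<open>N = 2 ^ e\<close> be a power of two above \<open>n\<close> and \<open>1 / \<epsilon>\<close>. For \<open>b\<close> in the image of \<open>L\<close> the solution is the
  Neumann series \<open>(1 / N) * (\<Sum>t. (1 - L / N) ^ t * b)\<close>, and \<open>1 - L / N\<close> is conjugate, by the square root of
  the degree matrix, to the lazy random walk that proposes a uniform \<open>j < N\<close> and moves from \<open>i\<close> to \<open>j\<close> with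
  probability \<open>w i j / d i\<close>. So coordinate \<open>i\<close> is a sum over \<open>t\<close> of expectations of
  \<open>sqrt (d i / d x) * b x\<close> with \<open>x\<close> the position at time \<open>t\<close> of the walk from \<open>i\<close>. The nonzero
  eigenvalues of \<open>L\<close> are at least \<open>1 / poly N\<close>, so polynomially many terms suffice; rounding all real
  numbers to \<open>O(log N)\<close> bits changes the expectation by a polynomially small amount; and averaging
  \<open>poly N * log (1 / \<gamma>)\<close> independent walks concentrates by Hoeffding's lemma. The walk needs only a constant
  number of registers of \<open>O(log N + log (log (1 / \<gamma>)))\<close> bits.
\<close>

text \<open>Uniform proposals reduce one move to e + k fair coins and an integer comparison, at the
  price of slowing the walk down by the factor N. Dividing by N \<ge> 2 also moves the spectrum of L
  from [0, 2] into [0, 1], so no term of the series oscillates. The obstacle is the kernel of L: its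
  modes have eigenvalue 1 and never decay. They are absent from b, but rounding brings them back,
  and the rounded walk is no longer conjugate to a symmetric matrix. Hence only the exact walk is
  analysed spectrally, to bound the truncation. Rounding is controlled in the maximum norm: both
  walks average, so neither increases this norm, and over T steps the errors grow only polynomially
  in T. The nonzero spectrum is bounded below by a cut argument that covers disconnected graphs,
  loops and isolated vertices alike. Space is a worst-case quantity, so every integer is bounded on
  all coin sequences; and of \<gamma> only g, about log (1 / \<gamma>), is kept.\<close>

section \<open>Orthonormal eigenbases and eigenvalue bounds\<close>

text \<open>The squared lengths of the projections of the n standard basis vectors onto the span of
  the \<open>u p\<close> add up to k < n. So some basis vector, with index j, has a projection
  shorter than 1; its residual \<open>y\<close> satisfies \<open>y j > 0\<close> and can be
  normalised.\<close>

lemma exists_orthogonal_unit: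
  fixes u :: "nat \<Rightarrow> nat \<Rightarrow> real"
  assumes kn: "k < n"
    and on: "\<And>p q. p < k \<Longrightarrow> q < k \<Longrightarrow> (\<Sum>i<n. u p i * u q i) = (if p = q then 1 else 0)"
  obtains x where "\<And>i. i \<ge> n \<Longrightarrow> x i = 0" "(\<Sum>i<n. x i * x i) = 1"
    "\<And>p. p < k \<Longrightarrow> (\<Sum>i<n. u p i * x i) = 0"
proof -
  have "\<exists>j<n. (\<Sum>p<k. u p j * u p j) < 1"
  proof (rule ccontr)
    assume "\<not> ?thesis"
    then have "(\<Sum>j<n. 1) \<le> (\<Sum>j<n. \<Sum>p<k. u p j * u p j)"
      by (intro sum_mono) (metis lessThan_iff not_less)
    also have "\<dots> = (\<Sum>p<k. \<Sum>j<n. u p j * u p j)" by (rule sum.swap)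
    also have "\<dots> = k" using on by simp
    finally show False using kn by simp
  qed
  then obtain j where j: "j < n" "(\<Sum>p<k. u p j * u p j) < 1" by blast
  define y where "y i = (if i < n then (if i = j then 1 else 0) - (\<Sum>p<k. u p j * u p i) else 0)" for i
  have ortho: "(\<Sum>i<n. u q i * y i) = 0" if q: "q < k" for q
  proof -
    have "(\<Sum>i<n. u q i * y i) = (\<Sum>i<n. u q i * (if i = j then 1 else 0)) - (\<Sum>i<n. \<Sum>p<k. u p j * (u q i * u p i))"
      by (simp add: y_def right_diff_distrib sum_subtractf sum_distrib_left mult_ac)
    also have "(\<Sum>i<n. \<Sum>p<k. u p j * (u q i * u p i)) = (\<Sum>p<k. u p j * (\<Sum>i<n. u q i * u p i))"
      by (subst sum.swap) (simp add: sum_distrib_left)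
    also have "\<dots> = (\<Sum>p<k. u p j * (if p = q then 1 else 0))"
      by (rule sum.cong) (use on q in auto)
    also have "\<dots> = u q j" using q by (simp add: if_distrib cong: if_cong)
    also have "(\<Sum>i<n. u q i * (if i = j then 1 else 0)) = u q j"
      using j by (simp add: if_distrib cong: if_cong)
    finally show ?thesis by simp
  qed
  have "y j > 0" using j by (simp add: y_def)
  then have "0 < y j * y j" by simp
  also have "\<dots> \<le> (\<Sum>i<n. y i * y i)" by (rule member_le_sum) (use j in auto)
  finally have r: "(\<Sum>i<n. y i * y i) > 0" .
  define r where "r = sqrt (\<Sum>i<n. y i * y i)"
  have r2: "r * r = (\<Sum>i<n. y i * y i)" "r > 0" using r by (simp_all add: r_def)
  show thesis
  proof (rule that[of "\<lambda>i. y i / r"])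
    show "(\<Sum>i<n. y i / r * (y i / r)) = 1"
      using r r2 by (simp add: sum_divide_distrib[symmetric])
    show "(\<Sum>i<n. u p i * (y i / r)) = 0" if "p < k" for p
      using ortho[OF that] by (simp add: sum_divide_distrib[symmetric])
  qed (simp add: y_def)
qed

text \<open>Replaces differentiation in the first-order condition at a maximiser.\<close>

lemma linear_coeff_zero:
  fixes a b :: real
  assumes "\<And>t. t * b + t * t * a \<le> 0"
  shows "b = 0"
proof (rule ccontr)
  assume b: "b \<noteq> 0"
  \<comment> \<open>At t = s * b the quadratic term is, in modulus, the fraction s * \<bar>a\<bar> <
    1 of the linear term s * b * b, so it cannot cancel it.\<close>
  define s where "s = 1 / (1 + \<bar>a\<bar>)"
  have s: "0 < s" "s * \<bar>a\<bar> < 1" by (auto simp: s_def divide_simps)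
  have "s * b * b + s * b * (s * b) * a \<le> 0" using assms[of "s * b"] .
  then have "s * (b * b) * (1 + s * a) \<le> 0" by (simp add: algebra_simps)
  moreover have "s * a > -1" using s by (smt (verit) mult_minus_right mult_left_mono)
  then have "s * (b * b) * (1 + s * a) > 0" using s b by (intro mult_pos_pos[of "s * (b * b)"] mult_pos_pos[of s]) (auto simp flip: power2_eq_square)
  ultimately show False by simp
qed

text \<open>A maximiser of the Rayleigh quotient on the orthogonal complement of the eigenvectors found so
  far is again an eigenvector.\<close>

lemma extend_eigenvectors:
  fixes a :: "nat \<Rightarrow> nat \<Rightarrow> real"
  assumes sym: "\<And>i j. i < n \<Longrightarrow> j < n \<Longrightarrow> a i j = a j i"
    and kn: "k < n"
    and on: "\<And>p q. p < k \<Longrightarrow> q < k \<Longrightarrow> (\<Sum>i<n. u p i * u q i) = (if p = q then 1 else 0)"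
    and ev: "\<And>p i. p < k \<Longrightarrow> i < n \<Longrightarrow> (\<Sum>j<n. a i j * u p j) = l p * u p i"
  obtains v m where "(\<Sum>i<n. v i * v i) = 1" "\<And>p. p < k \<Longrightarrow> (\<Sum>i<n. u p i * v i) = 0"
    "\<And>i. i < n \<Longrightarrow> (\<Sum>j<n. a i j * v j) = m * v i"
proof -
  define ip where "ip x y = (\<Sum>i<n. x i * y i)" for x y :: "nat \<Rightarrow> real"
  define A where "A x i = (\<Sum>j<n. a i j * x j)" for x i
  have ip_add: "ip (\<lambda>i. x i + y i) z = ip x z + ip y z" "ip z (\<lambda>i. x i + y i) = ip z x + ip z y" for x y z
    by (simp_all add: ip_def algebra_simps sum.distrib)
  have ip_diff: "ip z (\<lambda>i. x i - y i) = ip z x - ip z y" for x y z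
    by (simp add: ip_def algebra_simps sum_subtractf)
  have ip_scale: "ip (\<lambda>i. t * x i) z = t * ip x z" "ip z (\<lambda>i. t * x i) = t * ip z x" for x t z
    by (simp_all add: ip_def sum_distrib_left mult_ac)
  have ip_comm: "ip x y = ip y x" for x y by (simp add: ip_def mult.commute)
  have A_add: "A (\<lambda>i. x i + y i) = (\<lambda>i. A x i + A y i)" for x y
    by (rule ext) (simp add: A_def algebra_simps sum.distrib)
  have A_scale: "A (\<lambda>i. t * x i) = (\<lambda>i. t * A x i)" for x t
    by (rule ext) (simp add: A_def sum_distrib_left mult_ac)
  have selfadj: "ip x (A y) = ip (A x) y" for x y
  proof -
    have "ip x (A y) = (\<Sum>i<n. \<Sum>j<n. x i * (a i j * y j))" by (simp add: ip_def A_def sum_distrib_left)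
    also have "\<dots> = (\<Sum>j<n. \<Sum>i<n. x i * (a i j * y j))" by (rule sum.swap)
    also have "\<dots> = (\<Sum>j<n. \<Sum>i<n. a j i * x i * y j)"
      by (intro sum.cong refl) (use sym in auto)
    also have "\<dots> = ip (A x) y" by (simp add: ip_def A_def sum_distrib_right)
    finally show ?thesis .
  qed
  have evA: "ip (A (u p)) x = l p * ip (u p) x" if "p < k" for p x
    using ev[OF that] by (simp add: ip_def A_def sum_distrib_left mult_ac)
  \<comment> \<open>Coordinates from n on are pinned to 0 and the others confined to [-1, 1]. This
    makes the unit sphere of the orthogonal complement a closed subset of a compact product of
    intervals.\<close>
  define S where "S = {x. (\<forall>i. x i \<in> (if i < n then {-1..1} else {0::real})) \<and> ip x x = 1 \<and> (\<forall>p<k. ip (u p) x = 0)}"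
  obtain x0 where x0: "\<And>i. i \<ge> n \<Longrightarrow> x0 i = 0" "(\<Sum>i<n. x0 i * x0 i) = 1"
    "\<And>p. p < k \<Longrightarrow> (\<Sum>i<n. u p i * x0 i) = 0"
    using exists_orthogonal_unit[OF kn on] by metis
  have coord: "\<bar>x i\<bar> \<le> 1" if "ip x x = 1" "i < n" for x i
  proof -
    have "x i * x i \<le> ip x x" unfolding ip_def by (rule member_le_sum) (use that in auto)
    then have "(x i)\<^sup>2 \<le> 1" using that by (simp add: power2_eq_square)
    then show ?thesis by (simp add: abs_square_le_1)
  qed
  have memS: "x \<in> S" if "\<And>i. i \<ge> n \<Longrightarrow> x i = 0" "ip x x = 1" "\<And>p. p < k \<Longrightarrow> ip (u p) x = 0" for x
  proof -
    have "x i \<in> (if i < n then {-1..1} else {0})" for i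
      using coord[OF that(2), of i] that(1)[of i] by (auto simp: abs_le_iff)
    then show ?thesis using that by (auto simp: S_def)
  qed
  have "S \<noteq> {}" using memS[of x0] x0 by (auto simp: ip_def)
  have cont: "continuous_on UNIV (\<lambda>x. ip (f x) (g x))"
    if "\<And>i. continuous_on UNIV (\<lambda>x. f x i)" "\<And>i. continuous_on UNIV (\<lambda>x. g x i)"
    for f g :: "(nat \<Rightarrow> real) \<Rightarrow> nat \<Rightarrow> real"
    unfolding ip_def by (intro continuous_intros that)
  have contc: "continuous_on UNIV (\<lambda>x. x i)" for i :: nat and X :: "(nat \<Rightarrow> real) set"
    by (rule continuous_on_product_coordinates)
  have contA: "continuous_on UNIV (\<lambda>x. A x i)" for i
    unfolding A_def by (intro continuous_intros contc)
  define X where "X i = (if i < n then {-1..1} else {0::real})" for i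
  have "compact (Pi\<^sub>E UNIV X)" 
  proof -
    have "compact (X i)" for i by (auto simp: X_def)
    then have "compactin (product_topology (\<lambda>_. euclidean) UNIV) (Pi\<^sub>E UNIV X)"
      by (simp add: compactin_PiE del: compactin_euclidean_iff) (simp add: compactin_euclidean_iff)
    then show ?thesis by (simp add: euclidean_product_topology)
  qed
  moreover have "closed {x. ip x x = 1 \<and> (\<forall>p<k. ip (u p) x = 0)}"
    by (intro closed_Collect_conj closed_Collect_eq closed_Collect_all closed_Collect_imp cont continuous_intros contc) auto
  ultimately have "compact (Pi\<^sub>E UNIV X \<inter> {x. ip x x = 1 \<and> (\<forall>p<k. ip (u p) x = 0)})"
    by (rule compact_Int_closed)
  also have "Pi\<^sub>E UNIV X \<inter> {x. ip x x = 1 \<and> (\<forall>p<k. ip (u p) x = 0)} = S"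
    by (auto simp: S_def X_def PiE_def Pi_def)
  finally have "compact S" .
  moreover have "continuous_on S (\<lambda>x. ip x (A x))"
    by (rule continuous_on_subset[OF cont]) (auto intro: contc contA)
  ultimately obtain v where v: "v \<in> S" "\<And>x. x \<in> S \<Longrightarrow> ip x (A x) \<le> ip v (A v)"
    using continuous_attains_sup[OF _ \<open>S \<noteq> {}\<close>] by metis
  define m where "m = ip v (A v)"
  have v1: "ip v v = 1" "\<And>p. p < k \<Longrightarrow> ip (u p) v = 0" using v(1) by (auto simp: S_def)
  have v0: "v i = 0" if "i \<ge> n" for i
  proof -
    have "v i \<in> (if i < n then {-1..1} else {0})" using v(1) unfolding S_def by blast
    then show ?thesis using that by simp
  qed
  \<comment> \<open>Homogeneity extends the maximality of \<open>v\<close> from unit vectors to the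
    whole complement.\<close>
  have ray: "ip x (A x) \<le> m * ip x x" if x: "\<And>i. i \<ge> n \<Longrightarrow> x i = 0" "\<And>p. p < k \<Longrightarrow> ip (u p) x = 0" for x
  proof (cases "ip x x = 0")
    case True
    have "x i = 0" for i
    proof (cases "i < n")
      case True
      have "x i * x i \<le> ip x x" unfolding ip_def by (rule member_le_sum) (use True in auto)
      then show ?thesis using \<open>ip x x = 0\<close> by (auto simp: mult_le_0_iff)
    qed (use x in auto)
    then show ?thesis by (simp add: ip_def)
  next
    case False
    moreover have "ip x x \<ge> 0" unfolding ip_def by (intro sum_nonneg) auto
    ultimately have pos: "ip x x > 0" by simp
    define r where "r = 1 / sqrt (ip x x)"
    have rr: "r * r * ip x x = 1" using pos by (simp add: r_def)
    have "(\<lambda>i. r * x i) \<in> S"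
      by (rule memS) (use x rr in \<open>auto simp: ip_scale mult.assoc\<close>)
    from v(2)[OF this] have "r * r * ip x (A x) \<le> m" by (simp add: m_def A_scale ip_scale mult.assoc)
    then have "r * r * ip x (A x) * ip x x \<le> m * ip x x" using pos by (intro mult_right_mono) auto
    moreover have "r * r * ip x (A x) * ip x x = (r * r * ip x x) * ip x (A x)" by simp
    ultimately show ?thesis using rr by simp
  qed
  \<comment> \<open>\<open>h\<close> is the residual A v - m v. It is orthogonal to every
    \<open>u p\<close>, so \<open>v + t * h\<close> is an admissible competitor for all t.\<close>
  define h where "h i = (if i < n then A v i - m * v i else 0)" for i
  have ip_h: "ip z h = ip z (A v) - m * ip z v" for z
    by (simp add: ip_def h_def algebra_simps sum_subtractf sum_distrib_left)
  have h0: "h i = 0" if "i \<ge> n" for i using that by (simp add: h_def)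
  have h_orth: "ip (u p) h = 0" if "p < k" for p
    using that by (simp add: ip_h selfadj evA v1)
  have "2 * ip h h = 0"
  proof (rule linear_coeff_zero)
    fix t
    let ?x = "\<lambda>i. v i + t * h i"
    have "ip ?x (A ?x) \<le> m * ip ?x ?x"
      by (rule ray) (use v0 v1 h_orth h0 in \<open>auto simp: ip_add ip_scale\<close>)
    moreover have e1: "ip ?x (A ?x) = m + 2 * t * ip h (A v) + t * t * ip h (A h)"
      by (simp add: A_add A_scale ip_add ip_scale m_def[symmetric] selfadj[of v h] ip_comm[of "A v" h] algebra_simps)
    moreover have e2: "ip ?x ?x = 1 + 2 * t * ip h v + t * t * ip h h"
      by (simp add: ip_add ip_scale v1 ip_comm[of v h] algebra_simps)
    \<comment> \<open>The linear coefficient in t of the Rayleigh defect is 2 * ip h h, so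
      maximality of \<open>v\<close> forces the residual to vanish.\<close>
    have "t * (2 * ip h h) + t * t * (ip h (A h) - m * ip h h) = ip ?x (A ?x) - m * ip ?x ?x"
      unfolding e1 e2 ip_h[of h] by (simp add: algebra_simps)
    ultimately show "t * (2 * ip h h) + t * t * (ip h (A h) - m * ip h h) \<le> 0" by simp
  qed
  then have hh: "(\<Sum>i<n. h i * h i) = 0" by (simp add: ip_def)
  have "h i = 0" if "i < n" for i
    using hh that by (subst (asm) sum_nonneg_eq_0_iff) auto
  then have "A v i = m * v i" if "i < n" for i
    using that by (auto simp: h_def)
  then show thesis using v1 by (intro that[of v m]) (auto simp: ip_def A_def)
qed

lemma symmetric_orthonormal_eigenbasis:
  fixes a :: "nat \<Rightarrow> nat \<Rightarrow> real"
  assumes sym: "\<And>i j. i < n \<Longrightarrow> j < n \<Longrightarrow> a i j = a j i"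
  shows "\<exists>l u. (\<forall>p<n. \<forall>q<n. (\<Sum>i<n. u p i * u q i) = (if p = q then 1 else 0)) \<and>
     (\<forall>p<n. \<forall>i<n. (\<Sum>j<n. a i j * u p j) = l p * u p i)"
proof -
  have "k \<le> n \<Longrightarrow> \<exists>l u. (\<forall>p<k. \<forall>q<k. (\<Sum>i<n. u p i * u q i) = (if p = q then 1 else 0)) \<and>
     (\<forall>p<k. \<forall>i<n. (\<Sum>j<n. a i j * u p j) = l p * u p i)" for k
  proof (induction k)
    case (Suc k)
    then have kn: "k < n" "k \<le> n" by auto
    obtain l u where
      lu: "\<forall>p<k. \<forall>q<k. (\<Sum>i<n. u p i * u q i) = (if p = q then 1 else 0)"
        "\<forall>p<k. \<forall>i<n. (\<Sum>j<n. a i j * u p j) = l p * u p i" 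
      using Suc.IH[OF kn(2)] by (elim exE conjE) rule
    have on: "(\<Sum>i<n. u p i * u q i) = (if p = q then 1 else 0)" if "p < k" "q < k" for p q
      using lu(1) that by simp
    have ev: "(\<Sum>j<n. a i j * u p j) = l p * u p i" if "p < k" "i < n" for p i
      using lu(2) that by simp
    obtain v m where v: "(\<Sum>i<n. v i * v i) = 1" "\<And>p. p < k \<Longrightarrow> (\<Sum>i<n. u p i * v i) = 0"
      "\<And>i. i < n \<Longrightarrow> (\<Sum>j<n. a i j * v j) = m * v i"
      by (rule extend_eigenvectors[where a = a and u = u and l = l, OF sym kn(1) on ev]) auto
    have "\<And>p. p < k \<Longrightarrow> (\<Sum>i<n. v i * u p i) = 0" using v(2) by (simp add: mult.commute)
    with on ev v show ?case
      by (intro exI[of _ "l(k := m)"] exI[of _ "u(k := v)"]) (auto simp: less_Suc_eq)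
  qed auto
  then show ?thesis by blast
qed


section \<open>Lower bound on the nonzero eigenvalues by a cut\<close>

text \<open>Pigeonhole: cut the range from 0 to Y into n open intervals of length Y / n. If each
  contained a value of \<open>y\<close>, this would give n distinct indices, all different from
  \<open>i\<close> because \<open>y i = Y\<close> lies in none of the intervals.\<close>

lemma gap_index:
  fixes y :: "nat \<Rightarrow> real"
  assumes "i < n" "y i = Y" "Y > 0"
  obtains k where "k < n" "\<And>j. j < n \<Longrightarrow> y j > Y * k / n \<Longrightarrow> y j \<ge> Y * (k + 1) / n"
proof -
  have "\<exists>k<n. \<forall>j<n. y j > Y * k / n \<longrightarrow> y j \<ge> Y * (k + 1) / n"
  proof (rule ccontr)
    assume "\<not> ?thesis"
    then have "\<forall>k. \<exists>j. k < n \<longrightarrow> j < n \<and> y j > Y * k / n \<and> y j < Y * (k + 1) / n"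
      by (metis not_le)
    then obtain f where f: "\<And>k. k < n \<Longrightarrow> f k < n" "\<And>k. k < n \<Longrightarrow> y (f k) > Y * k / n"
      "\<And>k. k < n \<Longrightarrow> y (f k) < Y * (k + 1) / n" by metis
    have n: "n > 0" using assms by simp
    have "k = m" if "k < n" "m < n" "f k = f m" for k m
    proof -
      have "Y * k / n < Y * (m + 1) / n" "Y * m / n < Y * (k + 1) / n"
        using f(2,3)[OF that(1)] f(2,3)[OF that(2)] that(3) by auto
      then have "real k < real m + 1" "real m < real k + 1"
        using n assms by (auto simp: divide_less_cancel)
      then show ?thesis by linarith
    qed
    then have "inj_on f {..<n}" by (auto simp: inj_on_def)
    moreover have "f k \<noteq> i" if "k < n" for k
    proof
      assume "f k = i"
      then have "Y < Y * (real k + 1) / n" using f(3)[OF that] assms by (simp add: add.commute)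
      moreover have "Y * (real k + 1) \<le> Y * n" using that assms by (intro mult_left_mono) auto
      then have "Y * (real k + 1) / n \<le> Y" using n by (simp add: field_simps)
      ultimately show False by simp
    qed
    then have "f ` {..<n} \<subseteq> {..<n} - {i}" using f by auto
    ultimately have "card {..<n} \<le> card ({..<n} - {i})"
      by (metis card_image card_mono finite_Diff finite_lessThan)
    then show False using assms by simp
  qed
  then show thesis using that by blast
qed

text \<open>The threshold set \<open>S\<close> of the gap has only edges of length at least \<open>Y / n\<close> in its boundary, and
  summing the eigenvalue equation over \<open>S\<close> leaves only boundary terms.\<close>

lemma walk_eigenvalue_bounds_pos:
  fixes w :: "nat \<Rightarrow> nat \<Rightarrow> real" and D :: real
  assumes sym: "\<And>i j. w i j = w j i"
    and lo: "\<And>i j. w i j = 0 \<or> lo \<le> w i j" "lo > 0"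
    and d: "\<And>i. d i = (\<Sum>j<n. w i j)" "\<And>i. i < n \<Longrightarrow> d i \<le> D"
    and ev: "\<And>i. i < n \<Longrightarrow> (\<Sum>j<n. w i j * (y i - y j)) = l * (d i * y i)"
    and l: "l \<noteq> 0"
    and i: "i < n" "d i > 0" "y i > 0" "\<And>j. j < n \<Longrightarrow> \<bar>y j\<bar> \<le> y i"
  shows "lo / ((real n)\<^sup>2 * D) \<le> l" "l \<le> 2"
proof -
  define Y where "Y = y i"
  have Y: "Y > 0" using i by (simp add: Y_def)
  have w0: "w p q \<ge> 0" for p q using lo by (metis order.refl order.strict_implies_order order_trans)
  have n: "n > 0" using i by simp
  have d0: "d p \<ge> 0" for p using w0 by (simp add: d sum_nonneg)
  \<comment> \<open>At the peak vertex every difference of values is at most 2 * Y, which gives the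
    upper bound 2.\<close>
  have "l * (d i * Y) \<le> 2 * (d i * Y)"
  proof -
    have "l * (d i * Y) = (\<Sum>j<n. w i j * (y i - y j))" using ev i by (simp add: Y_def)
    also have "\<dots> \<le> (\<Sum>j<n. w i j * (2 * Y))"
    proof (intro sum_mono mult_left_mono w0)
      fix j assume "j \<in> {..<n}"
      then show "y i - y j \<le> 2 * Y" using i(4)[of j] by (simp add: Y_def abs_le_iff)
    qed
    also have "\<dots> = 2 * (d i * Y)" by (simp add: d sum_distrib_right[symmetric])
    finally show ?thesis .
  qed
  then show "l \<le> 2" using i Y by simp
  obtain k where k: "k < n" "\<And>j. j < n \<Longrightarrow> y j > Y * k / n \<Longrightarrow> y j \<ge> Y * (k + 1) / n"
    using gap_index[OF i(1), of y Y] Y by (auto simp: Y_def)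
  define S where "S = {j. j < n \<and> y j > Y * k / n}"
  define R where "R = {..<n} - S"
  have S: "S \<subseteq> {..<n}" "finite S" "finite R" "S \<inter> R = {}" "S \<union> R = {..<n}" by (auto simp: S_def R_def)
  have "Y * k / n < Y" using k Y n by (simp add: field_simps)
  then have iS: "i \<in> S" using i by (simp add: S_def Y_def)
  have yS: "y p > 0" if "p \<in> S" for p
  proof -
    have "0 \<le> Y * k / n" using Y by simp
    then show ?thesis using that by (simp add: S_def)
  qed
  define E where "E = (\<Sum>p\<in>S. \<Sum>q\<in>R. w p q * (y p - y q))"
  \<comment> \<open>Inside S each pair occurs with both signs and the same weight, so only the edges
    leaving S survive.\<close>
  have "(\<Sum>p\<in>S. \<Sum>q\<in>S. w p q * (y p - y q)) = (\<Sum>p\<in>S. \<Sum>q\<in>S. w p q * y p) - (\<Sum>p\<in>S. \<Sum>q\<in>S. w q p * y q)"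
    by (simp add: algebra_simps sum_subtractf sym)
  also have "(\<Sum>p\<in>S. \<Sum>q\<in>S. w q p * y q) = (\<Sum>p\<in>S. \<Sum>q\<in>S. w p q * y p)" by (rule sum.swap)
  finally have SS: "(\<Sum>p\<in>S. \<Sum>q\<in>S. w p q * (y p - y q)) = 0" by simp
  have "l * (\<Sum>p\<in>S. d p * y p) = (\<Sum>p\<in>S. \<Sum>q<n. w p q * (y p - y q))"
    unfolding sum_distrib_left by (rule sum.cong) (use ev S in auto)
  also have "\<dots> = (\<Sum>p\<in>S. \<Sum>q\<in>S. w p q * (y p - y q)) + E"
    unfolding S(5)[symmetric] E_def
    by (simp only: sum.union_disjoint[OF S(2,3,4)] sum.distrib)
  finally have lE: "l * (\<Sum>p\<in>S. d p * y p) = E" using SS by simp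
  have "0 < d i * y i" using i by simp
  also have "\<dots> \<le> (\<Sum>p\<in>S. d p * y p)"
    by (rule member_le_sum) (use iS S d0 yS in \<open>auto intro!: mult_nonneg_nonneg intro: less_imp_le\<close>)
  finally have pos: "(\<Sum>p\<in>S. d p * y p) > 0" .
  have "(\<Sum>p\<in>S. d p * y p) \<le> (\<Sum>p\<in>S. D * Y)"
  proof (intro sum_mono mult_mono)
    fix p assume p: "p \<in> S"
    then have "p < n" using S by auto
    then show "d p \<le> D" "y p \<le> Y" "0 \<le> D" "0 \<le> y p"
      using d(2)[of p] d0[of p] i(4)[of p] yS[OF p] by (auto simp: Y_def)
  qed
  also have "\<dots> = card S * (D * Y)" by simp
  also have "\<dots> \<le> n * (D * Y)"
    using card_mono[of "{..<n}" S] S d(2)[OF i(1)] i(2) Y by (intro mult_right_mono) auto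
  finally have upper: "(\<Sum>p\<in>S. d p * y p) \<le> n * (D * Y)" .
  have diff: "Y / n \<le> y p - y q" if "p \<in> S" "q \<in> R" for p q
  proof -
    have "y p \<ge> Y * (k + 1) / n" "y q \<le> Y * k / n" using k(2) that by (auto simp: S_def R_def)
    then show ?thesis by (simp add: add_divide_distrib distrib_left)
  qed
  have diff0: "0 \<le> y p - y q" if "p \<in> S" "q \<in> R" for p q
    using diff[OF that] Y by (smt (verit) divide_nonneg_nonneg of_nat_0_le_iff)
  \<comment> \<open>Without a boundary edge, l times a positive sum would be 0; this is where
    \<open>l\<close> being nonzero enters.\<close>
  have "\<exists>p\<in>S. \<exists>q\<in>R. w p q \<noteq> 0"
  proof (rule ccontr)
    assume "\<not> ?thesis"
    then have "E = 0" by (simp add: E_def)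
    then show False using lE pos l by simp
  qed
  then obtain p q where pq: "p \<in> S" "q \<in> R" "w p q \<noteq> 0" by blast
  \<comment> \<open>A single boundary edge already contributes this much, and no other boundary term
    is negative.\<close>
  have "lo * (Y / n) \<le> w p q * (y p - y q)"
    using pq lo diff Y by (intro mult_mono) (auto intro: w0)
  also have "\<dots> \<le> (\<Sum>q\<in>R. w p q * (y p - y q))"
    by (rule member_le_sum) (use pq S w0 diff0 in auto)
  also have "\<dots> \<le> E"
    unfolding E_def by (rule member_le_sum) (use pq S w0 diff0 in \<open>auto intro!: sum_nonneg\<close>)
  finally have E: "lo * (Y / n) \<le> E" .
  moreover have "0 < lo * (Y / n)" using lo Y n by simp
  ultimately have "E > 0" by simp
  then have "l > 0" using lE pos by (metis zero_less_mult_pos2)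
  have "lo * (Y / n) \<le> l * (n * (D * Y))"
    using E lE upper \<open>l > 0\<close> by (smt (verit) mult_left_mono)
  then have "Y * (lo / n) \<le> Y * (l * n * D)" by (simp add: mult_ac)
  then have "lo / n \<le> l * n * D" using Y by (meson mult_le_cancel_left_pos)
  moreover have "D > 0" using d(2)[OF i(1)] i(2) by simp
  ultimately show "lo / ((real n)\<^sup>2 * D) \<le> l" using n by (simp add: field_simps power2_eq_square)
qed

text \<open>The peak is an entry of largest modulus. If it is negative, the argument is applied to
  the negated vector, which satisfies the same equation. An entry of largest modulus is nonzero, so
  its vertex has positive degree.\<close>

lemma walk_eigenvalue_bounds:
  fixes w :: "nat \<Rightarrow> nat \<Rightarrow> real" and D :: real
  assumes sym: "\<And>i j. w i j = w j i"
    and lo: "\<And>i j. w i j = 0 \<or> lo \<le> w i j" "lo > 0"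
    and d: "\<And>i. d i = (\<Sum>j<n. w i j)" "\<And>i. i < n \<Longrightarrow> d i \<le> D"
    and ev: "\<And>i. i < n \<Longrightarrow> (\<Sum>j<n. w i j * (y i - y j)) = l * (d i * y i)"
    and l: "l \<noteq> 0"
    and y: "i0 < n" "y i0 \<noteq> 0" "\<And>j. d j = 0 \<Longrightarrow> y j = 0"
  shows "lo / ((real n)\<^sup>2 * D) \<le> l \<and> l \<le> 2"
proof -
  have w0: "w p q \<ge> 0" for p q using lo by (metis order.refl order.strict_implies_order order_trans)
  have d0: "d p \<ge> 0" for p using w0 by (simp add: d sum_nonneg)
  have "Max ((\<lambda>i. \<bar>y i\<bar>) ` {..<n}) \<in> (\<lambda>i. \<bar>y i\<bar>) ` {..<n}"
    by (rule Max_in) (use y(1) in auto)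
  then obtain i where i': "i < n" "\<bar>y i\<bar> = Max ((\<lambda>i. \<bar>y i\<bar>) ` {..<n})" by auto
  then have i: "i < n" "\<And>j. j < n \<Longrightarrow> \<bar>y j\<bar> \<le> \<bar>y i\<bar>" by auto
  then have yi: "y i \<noteq> 0" using y by force
  then have di: "d i > 0" using y(3) d0 by (metis less_le)
  show ?thesis
  proof (cases "y i > 0")
    case True
    then show ?thesis
      using walk_eigenvalue_bounds_pos[OF sym lo d ev l i(1) di True] i(2) by force
  next
    case False
    have "(\<Sum>j<n. w p j * (- y p - - y j)) = l * (d p * - y p)" if "p < n" for p
    proof -
      have "(\<Sum>j<n. w p j * (- y p - - y j)) = - (\<Sum>j<n. w p j * (y p - y j))"
        by (simp add: sum_negf[symmetric] algebra_simps)
      then show ?thesis using ev that by simp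
    qed
    from walk_eigenvalue_bounds_pos[OF sym lo d this l i(1) di] yi False i(2)
    show ?thesis by force
  qed
qed

section \<open>Eigenbasis, image and pseudo-inverse in terms of matrices\<close>

lemma scalar_prod_sum: "x \<in> carrier_vec n \<Longrightarrow> y \<in> carrier_vec n \<Longrightarrow> x \<bullet> y = (\<Sum>i<n. x $ i * y $ i)"
  by (auto simp: scalar_prod_def atLeast0LessThan)

lemma mult_mat_vec_sum:
  "A \<in> carrier_mat m n \<Longrightarrow> x \<in> carrier_vec n \<Longrightarrow> i < m \<Longrightarrow> (A *\<^sub>v x) $ i = (\<Sum>j<n. A $$ (i, j) * x $ j)"
  by (auto simp: scalar_prod_def atLeast0LessThan)

lemma ex_orthonormal_eigenbasis:
  assumes A: "A \<in> carrier_mat n n" and sym: "\<And>i j. i < n \<Longrightarrow> j < n \<Longrightarrow> A $$ (i, j) = A $$ (j, i)"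
  shows "\<exists>l u. orthonormal_eigenbasis A l u"
proof -
  obtain l u where on: "\<And>p q. p < n \<Longrightarrow> q < n \<Longrightarrow> (\<Sum>i<n. u p i * u q i) = (if p = q then 1 else 0)"
    and ev: "\<And>p i. p < n \<Longrightarrow> i < n \<Longrightarrow> (\<Sum>j<n. A $$ (i, j) * u p j) = l p * u p i"
    using symmetric_orthonormal_eigenbasis[of n "\<lambda>i j. A $$ (i, j)", OF sym] by blast
  have "orthonormal_eigenbasis A l (\<lambda>p. vec n (u p))"
    unfolding orthonormal_eigenbasis_def
  proof (intro conjI allI impI)
    fix p assume p: "p < dim_row A"
    then have p': "p < n" using A by simp
    have "vec n (u p) \<noteq> 0\<^sub>v n"
    proof
      assume 0: "vec n (u p) = 0\<^sub>v n"
      have "u p i = 0" if "i < n" for i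
        using arg_cong[OF 0, of "\<lambda>v. v $ i"] that by simp
      then show False using on[OF p' p'] by simp
    qed
    moreover have "A *\<^sub>v vec n (u p) = l p \<cdot>\<^sub>v vec n (u p)"
      by (rule eq_vecI) (use A p' ev in \<open>auto simp: mult_mat_vec_sum[OF A vec_carrier] simp del: index_mult_mat_vec\<close>)
    ultimately show "eigenvector A (vec n (u p)) (l p)" using A by (simp add: eigenvector_def)
    fix q assume "q < dim_row A"
    then show "vec n (u p) \<bullet> vec n (u q) = (if p = q then 1 else 0)"
      using on p' A by (simp add: scalar_prod_sum[of _ n])
  qed
  then show ?thesis by blast
qed

lemma eigen_image_carrier:
  assumes "A \<in> carrier_mat n n" "b \<in> eigen_image A"
  shows "b \<in> carrier_vec n"
proof -
  interpret vec_space "TYPE(real)" n .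
  have "{v. \<exists>k. k \<noteq> 0 \<and> eigenvector A v k} \<subseteq> carrier_vec n"
    using assms by (auto simp: eigenvector_def)
  from span_closed[OF this] show ?thesis using assms by (auto simp: eigen_image_def)
qed

text \<open>By symmetry k * (u \<bullet> v) = (A u) \<bullet> v = 0 for an eigenvector v with
  eigenvalue k \<noteq> 0, and linear combinations inherit this. It is what keeps the non-decaying
  modes out of \<open>b\<close>.\<close>

lemma eigen_image_orthogonal:
  assumes A: "A \<in> carrier_mat n n" and sym: "\<And>i j. i < n \<Longrightarrow> j < n \<Longrightarrow> A $$ (i, j) = A $$ (j, i)"
    and b: "b \<in> eigen_image A" and u: "u \<in> carrier_vec n" "A *\<^sub>v u = 0\<^sub>v n"
  shows "u \<bullet> b = 0"
proof -
  interpret vec_space "TYPE(real)" n .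
  let ?V = "{v. \<exists>k. k \<noteq> 0 \<and> eigenvector A v k}"
  have V: "?V \<subseteq> carrier_vec n" using A by (auto simp: eigenvector_def)
  have orth: "u \<bullet> v = 0" if v: "v \<in> ?V" for v
  proof -
    obtain k where k: "k \<noteq> 0" "v \<in> carrier_vec n" "A *\<^sub>v v = k \<cdot>\<^sub>v v"
      using v A unfolding eigenvector_def by auto
    have "k * (u \<bullet> v) = u \<bullet> (A *\<^sub>v v)" using k u by simp
    also have "\<dots> = (\<Sum>i<n. u $ i * (A *\<^sub>v v) $ i)" using A u k by (intro scalar_prod_sum) auto
    also have "\<dots> = (\<Sum>i<n. \<Sum>j<n. A $$ (i, j) * u $ i * v $ j)"
      by (intro sum.cong refl) (simp add: mult_mat_vec_sum[OF A k(2)] sum_distrib_left mult_ac del: index_mult_mat_vec)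
    also have "\<dots> = (\<Sum>j<n. \<Sum>i<n. A $$ (i, j) * u $ i * v $ j)" by (rule sum.swap)
    also have "\<dots> = (\<Sum>j<n. (\<Sum>i<n. A $$ (j, i) * u $ i) * v $ j)"
      unfolding sum_distrib_right by (intro sum.cong refl) (use sym in auto)
    also have "\<dots> = (\<Sum>j<n. (A *\<^sub>v u) $ j * v $ j)"
      by (intro sum.cong refl) (use mult_mat_vec_sum[OF A u(1)] in auto)
    also have "\<dots> = 0" using u by simp
    finally show ?thesis using k by simp
  qed
  obtain a B where B: "finite B" "B \<subseteq> ?V" "b = lincomb a B"
    using b A in_spanE[of b ?V] unfolding eigen_image_def by auto
  have "u \<bullet> b = (\<Sum>i<n. \<Sum>v\<in>B. u $ i * (a v * v $ i))"
    using B V u by (simp add: scalar_prod_sum[of _ n] lincomb_index sum_distrib_left subset_trans)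
  also have "\<dots> = (\<Sum>v\<in>B. \<Sum>i<n. u $ i * (a v * v $ i))" by (rule sum.swap)
  also have "\<dots> = (\<Sum>v\<in>B. a v * (u \<bullet> v))"
  proof (rule sum.cong[OF refl])
    fix v assume "v \<in> B"
    then have "v \<in> carrier_vec n" using B V by blast
    then show "(\<Sum>i<n. u $ i * (a v * v $ i)) = a v * (u \<bullet> v)"
      using u by (simp add: scalar_prod_sum[of _ n] sum_distrib_left mult_ac)
  qed
  also have "\<dots> = 0" using B orth by (intro sum.neutral) auto
  finally show ?thesis .
qed

text \<open>A right inverse of a square matrix is also a left inverse, so orthonormal rows give
  orthonormal columns.\<close>

lemma orthonormal_complete:
  fixes u :: "nat \<Rightarrow> nat \<Rightarrow> real"
  assumes on: "\<And>p q. p < n \<Longrightarrow> q < n \<Longrightarrow> (\<Sum>i<n. u p i * u q i) = (if p = q then 1 else 0)"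
    and ij: "i < n" "j < n"
  shows "(\<Sum>p<n. u p i * u p j) = (if i = j then 1 else 0)"
proof -
  define U where "U = mat n n (\<lambda>(p, i). u p i)"
  have U: "U \<in> carrier_mat n n" "transpose_mat U \<in> carrier_mat n n" by (auto simp: U_def)
  have "U * transpose_mat U = 1\<^sub>m n"
    by (rule eq_matI) (use on in \<open>auto simp: U_def scalar_prod_def atLeast0LessThan\<close>)
  then have "transpose_mat U * U = 1\<^sub>m n" by (rule mat_mult_left_right_inverse[OF U])
  from arg_cong[OF this, of "\<lambda>M. M $$ (i, j)"] show ?thesis
    using ij by (simp add: U_def scalar_prod_def atLeast0LessThan)
qed

text \<open>The eigenbasis obtained is the very one that \<open>SOME\<close> selects inside
  \<open>pseudo_inverse\<close>, so \<open>b\<close> and the solution are expanded in the same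
  \<open>u\<close> and \<open>l\<close>.\<close>

lemma pseudo_inverse_expansion:
  assumes A: "A \<in> carrier_mat n n" and sym: "\<And>i j. i < n \<Longrightarrow> j < n \<Longrightarrow> A $$ (i, j) = A $$ (j, i)"
    and b: "b \<in> eigen_image A"
  obtains l u \<beta> where
    "\<And>p q. p < n \<Longrightarrow> q < n \<Longrightarrow> (\<Sum>i<n. u p i * u q i) = (if p = q then 1 else 0)"
    "\<And>p i. p < n \<Longrightarrow> i < n \<Longrightarrow> (\<Sum>j<n. A $$ (i, j) * u p j) = l p * u p i"
    "\<And>p. p < n \<Longrightarrow> \<beta> p = (\<Sum>i<n. u p i * b $ i)"
    "\<And>p. p < n \<Longrightarrow> l p = 0 \<Longrightarrow> \<beta> p = 0"
    "\<And>i. i < n \<Longrightarrow> b $ i = (\<Sum>p<n. \<beta> p * u p i)"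
    "\<And>i. i < n \<Longrightarrow> (pseudo_inverse A *\<^sub>v b) $ i = (\<Sum>p | p < n \<and> l p \<noteq> 0. \<beta> p / l p * u p i)"
proof -
  have bc: "b \<in> carrier_vec n" using eigen_image_carrier[OF A b] .
  have "\<exists>P l u. orthonormal_eigenbasis A l u \<and>
     P = mat (dim_row A) (dim_row A)
           (\<lambda>(i, j). \<Sum>k | k < dim_row A \<and> l k \<noteq> 0. inverse (l k) * (u k $ i * u k $ j))"
    using ex_orthonormal_eigenbasis[OF A sym] by blast
  from someI_ex[OF this] obtain l u where lu: "orthonormal_eigenbasis A l u" and
    P: "pseudo_inverse A = mat n n (\<lambda>(i, j). \<Sum>k | k < n \<and> l k \<noteq> 0. inverse (l k) * (u k $ i * u k $ j))"
    using A unfolding pseudo_inverse_def by auto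
  have uc: "u p \<in> carrier_vec n" "A *\<^sub>v u p = l p \<cdot>\<^sub>v u p" if "p < n" for p
    using lu A that by (auto simp: orthonormal_eigenbasis_def eigenvector_def)
  have on: "(\<Sum>i<n. u p $ i * u q $ i) = (if p = q then 1 else 0)" if "p < n" "q < n" for p q
    using lu A uc that by (simp add: orthonormal_eigenbasis_def scalar_prod_sum[of _ n, symmetric])
  define \<beta> where "\<beta> p = (\<Sum>i<n. u p $ i * b $ i)" for p
  show thesis
  proof (rule that[of "\<lambda>p i. u p $ i" l \<beta>, OF on])
    show "(\<Sum>j<n. A $$ (i, j) * u p $ j) = l p * u p $ i" if "p < n" "i < n" for p i
      using uc[OF that(1)] that mult_mat_vec_sum[OF A, of "u p" i] by simp
    show "\<beta> p = 0" if "p < n" "l p = 0" for p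
    proof -
      have "A *\<^sub>v u p = 0\<^sub>v n" using uc[OF that(1)] that(2) by auto
      from eigen_image_orthogonal[OF A sym b uc(1)[OF that(1)] this]
      show ?thesis using uc(1)[OF that(1)] bc by (simp add: \<beta>_def scalar_prod_sum[of _ n])
    qed
    show "b $ i = (\<Sum>p<n. \<beta> p * u p $ i)" if "i < n" for i
    proof -
      have "(\<Sum>p<n. \<beta> p * u p $ i) = (\<Sum>p<n. \<Sum>j<n. b $ j * (u p $ i * u p $ j))"
        by (simp add: \<beta>_def sum_distrib_right sum_distrib_left mult_ac)
      also have "\<dots> = (\<Sum>j<n. b $ j * (\<Sum>p<n. u p $ i * u p $ j))"
        by (subst sum.swap) (simp add: sum_distrib_left)
      also have "\<dots> = (\<Sum>j<n. b $ j * (if i = j then 1 else 0))"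
        by (intro sum.cong refl) (use orthonormal_complete[of n "\<lambda>p i. u p $ i", OF on] that in auto)
      also have "\<dots> = b $ i" using that by (simp add: if_distrib cong: if_cong)
      finally show ?thesis by simp
    qed
    show "(pseudo_inverse A *\<^sub>v b) $ i = (\<Sum>p | p < n \<and> l p \<noteq> 0. \<beta> p / l p * u p $ i)" if "i < n" for i
    proof -
      have "(pseudo_inverse A *\<^sub>v b) $ i = (\<Sum>j<n. \<Sum>p | p < n \<and> l p \<noteq> 0. inverse (l p) * (u p $ i * u p $ j) * b $ j)"
        using that bc by (subst mult_mat_vec_sum[of _ n n]) (simp_all add: P sum_distrib_right)
      also have "\<dots> = (\<Sum>p | p < n \<and> l p \<noteq> 0. \<Sum>j<n. inverse (l p) * (u p $ i * u p $ j) * b $ j)"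
        by (rule sum.swap)
      also have "\<dots> = (\<Sum>p | p < n \<and> l p \<noteq> 0. \<beta> p / l p * u p $ i)"
        by (simp add: \<beta>_def sum_distrib_left sum_distrib_right sum_divide_distrib divide_inverse mult_ac)
      finally show ?thesis .
    qed
  qed (auto simp: \<beta>_def)
qed

section \<open>Truncated Neumann series of the Laplacian\<close>

text \<open>The expectation of \<open>h\<close> after one move from \<open>x\<close> when each j is
  proposed with probability 1 / N and accepted with probability \<open>a x j\<close>. Rejected
  proposals, and those outside the graph, leave the walk at \<open>x\<close>; the difference form
  accounts for them without naming their probability.\<close>

definition walk_op :: "real \<Rightarrow> nat \<Rightarrow> (nat \<Rightarrow> nat \<Rightarrow> real) \<Rightarrow> (nat \<Rightarrow> real) \<Rightarrow> nat \<Rightarrow> real" where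
  "walk_op N n a h x = h x - (\<Sum>j<n. a x j * (h x - h j)) / N"

locale laplacian_system =
  fixes G :: wgraph and n :: nat and lo D :: real
  assumes graph: "weighted_graph G" and n: "nverts G = n"
    and lo: "0 < lo" "\<And>i j. (i, j) \<in> edges G \<Longrightarrow> lo \<le> wt G i j"
    and D: "\<And>i. i < n \<Longrightarrow> degree G i \<le> D"
begin

abbreviation "w \<equiv> wt G"
abbreviation "d \<equiv> degree G"

definition trans_prob :: "nat \<Rightarrow> nat \<Rightarrow> real" where
  "trans_prob i j = w i j / d i"

lemma w_sym: "w i j = w j i" and w_cases: "w i j = 0 \<or> lo \<le> w i j" and w_nonneg: "0 \<le> w i j"
  and w_edge: "(i, j) \<notin> edges G \<Longrightarrow> w i j = 0"
  using graph lo unfolding weighted_graph_def by (auto, metis, metis less_imp_le order_refl)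

lemma w_outside: "j \<ge> n \<Longrightarrow> w i j = 0"
  using graph n w_edge[of i j] unfolding weighted_graph_def by (meson SigmaD2 leD lessThan_iff subsetD)

lemma d_eq: "d i = (\<Sum>j<n. w i j)"
  by (simp add: degree_def n)

lemma d_nonneg: "0 \<le> d i"
  by (simp add: d_eq sum_nonneg w_nonneg)

lemma w_le_d: "w i j \<le> d i"
proof (cases "j < n")
  case True
  then show ?thesis unfolding d_eq by (intro member_le_sum) (auto simp: w_nonneg)
qed (auto simp: w_outside d_nonneg)

lemma w_isolated: "d i = 0 \<Longrightarrow> w i j = 0"
  using w_le_d[of i j] w_nonneg[of i j] by simp

lemma d_cases: "d i = 0 \<or> lo \<le> d i"
proof (cases "d i = 0")
  case False
  then obtain j where "w i j \<noteq> 0" unfolding d_eq by (meson sum.not_neutral_contains_not_neutral)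
  then show ?thesis using w_cases[of i j] w_le_d[of i j] by linarith
qed simp

lemma laplacian_carrier: "laplacian G \<in> carrier_mat n n"
  by (simp add: laplacian_def n)

text \<open>One formula covers loops, non-edges and isolated vertices: on the diagonal the two
  square roots multiply to \<open>d i\<close>, and a quotient by 0 is 0.\<close>

lemma laplacian_entry:
  assumes "i < n" "j < n"
  shows "laplacian G $$ (i, j) = (if i = j \<and> d i \<noteq> 0 then 1 else 0) - w i j / (sqrt (d i) * sqrt (d j))"
  using assms w_edge[of i j] w_isolated[of i i] d_nonneg[of i]
  by (auto simp: laplacian_def n real_sqrt_mult)

lemma laplacian_sym: "i < n \<Longrightarrow> j < n \<Longrightarrow> laplacian G $$ (i, j) = laplacian G $$ (j, i)"
  by (auto simp: laplacian_entry w_sym[of i j] mult.commute)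

text \<open>In the coordinates x j / sqrt (d j) the normalized Laplacian becomes the weighted
  difference operator of the graph.\<close>

lemma laplacian_apply:
  assumes i: "i < n"
  shows "(\<Sum>j<n. laplacian G $$ (i, j) * x j) = (\<Sum>j<n. w i j * (x i / sqrt (d i) - x j / sqrt (d j))) / sqrt (d i)"
proof (cases "d i = 0")
  case True
  then show ?thesis using i by (simp add: laplacian_entry w_isolated)
next
  case False
  then have di: "d i > 0" using d_nonneg[of i] by simp
  have "(\<Sum>j<n. laplacian G $$ (i, j) * x j) = (\<Sum>j<n. (if i = j then x j else 0) - w i j * x j / (sqrt (d i) * sqrt (d j)))"
    by (rule sum.cong) (use i False in \<open>auto simp: laplacian_entry algebra_simps\<close>)
  also have "\<dots> = x i - (\<Sum>j<n. w i j * x j / (sqrt (d i) * sqrt (d j)))"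
    using i by (simp add: sum_subtractf)
  \<comment> \<open>The diagonal term is spread over the neighbours, \<open>d i\<close> being the
    sum of the weights at \<open>i\<close>, so that it pairs up with the off-diagonal terms.\<close>
  also have "x i = (\<Sum>j<n. w i j) * x i / (sqrt (d i) * sqrt (d i))"
    using di by (simp add: d_eq[symmetric])
  also have "\<dots> - (\<Sum>j<n. w i j * x j / (sqrt (d i) * sqrt (d j))) =
      (\<Sum>j<n. w i j * (x i / sqrt (d i) - x j / sqrt (d j))) / sqrt (d i)"
    by (simp add: sum_divide_distrib sum_distrib_right sum_distrib_left sum_subtractf right_diff_distrib diff_divide_distrib mult_ac)
  finally show ?thesis .
qed

lemma walk_op_isolated: "d i = 0 \<Longrightarrow> walk_op N n trans_prob h i = h i"
  by (simp add: walk_op_def trans_prob_def)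

lemma walk_op_laplacian:
  assumes i: "i < n" and h0: "\<And>j. d j = 0 \<Longrightarrow> h j = 0"
  shows "sqrt (d i) * walk_op N n trans_prob h i =
    sqrt (d i) * h i - (\<Sum>j<n. laplacian G $$ (i, j) * (sqrt (d j) * h j)) / N"
proof -
  \<comment> \<open>At an isolated vertex this rests on \<open>h j = 0\<close> and on a quotient by
    0 being 0.\<close>
  have cancel: "sqrt (d j) * h j / sqrt (d j) = h j" for j using h0 by (cases "d j = 0") auto
  have sq: "sqrt (d i) / d i = 1 / sqrt (d i)"
    using d_nonneg[of i] real_sqrt_mult_self[of "d i"] by (cases "d i = 0") (auto simp: field_simps)
  have "sqrt (d i) * walk_op N n trans_prob h i = sqrt (d i) * h i - (sqrt (d i) / d i) * (\<Sum>j<n. w i j * (h i - h j)) / N"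
    by (simp add: walk_op_def trans_prob_def right_diff_distrib sum_distrib_left sum_divide_distrib sum_subtractf)
  also have "\<dots> = sqrt (d i) * h i - (\<Sum>j<n. laplacian G $$ (i, j) * (sqrt (d j) * h j)) / N"
    unfolding laplacian_apply[OF i] cancel sq by simp
  finally show ?thesis .
qed

text \<open>The right-hand side in walk coordinates. It vanishes at isolated vertices because a
  quotient by 0 is 0, and the iterates inherit this.\<close>

definition start :: "real vec \<Rightarrow> nat \<Rightarrow> real" where
  "start b j = b $ j / sqrt (d j)"

lemma start_iterate_isolated: "d j = 0 \<Longrightarrow> (walk_op N n trans_prob ^^ t) (start b) j = 0"
  by (induction t) (simp_all add: walk_op_isolated start_def)

text \<open>Dividing an eigenvector by the square roots of the degrees turns the eigenvalue equation
  into the one of \<open>walk_eigenvalue_bounds\<close>. Isolated vertices have zero rows, so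
  \<open>v\<close> vanishes there when l \<noteq> 0.\<close>

lemma eigenvalue_bounds:
  assumes ev: "\<And>i. i < n \<Longrightarrow> (\<Sum>j<n. laplacian G $$ (i, j) * v j) = l * v i"
    and l: "l \<noteq> 0" and v: "i0 < n" "v i0 \<noteq> 0"
  shows "lo / ((real n)\<^sup>2 * D) \<le> l" "l \<le> 2"
proof -
  define y where "y j = v j / sqrt (d j)" for j
  have v0: "v i = 0" if "d i = 0" "i < n" for i
    using ev[OF that(2)] that l by (simp add: laplacian_apply)
  have eq: "(\<Sum>j<n. w i j * (y i - y j)) = l * (d i * y i)" if i: "i < n" for i
  proof (cases "d i = 0")
    case False
    then have "(\<Sum>j<n. w i j * (y i - y j)) = sqrt (d i) * (l * v i)"
      using ev[OF i] laplacian_apply[OF i, of v] by (simp add: y_def divide_eq_eq mult_ac)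
    moreover have "d i / sqrt (d i) = sqrt (d i)" using d_nonneg[of i] real_div_sqrt by blast
    then have "d i * y i = sqrt (d i) * v i" by (simp only: y_def times_divide_eq_right flip: times_divide_eq_left)
    ultimately show ?thesis by simp
  qed (simp add: w_isolated)
  have "y i0 \<noteq> 0" using v v0[of i0] by (auto simp: y_def)
  have "lo / ((real n)\<^sup>2 * D) \<le> l \<and> l \<le> 2"
    by (rule walk_eigenvalue_bounds[where w = w and y = y and d = d and ?i0.0 = i0])
      (use w_sym w_cases lo d_eq D eq l v(1) \<open>y i0 \<noteq> 0\<close> in \<open>auto simp: y_def\<close>)
  then show "lo / ((real n)\<^sup>2 * D) \<le> l" "l \<le> 2" by auto
qed

text \<open>This is the remainder of the geometric series with sum 1 / l. The decay exp (- T * \<mu>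
  / N) is weakened to N / (T * \<mu>): then T can be a plain power of N, which the machine computes
  by multiplications alone.\<close>

lemma geometric_tail:
  fixes l N \<mu> :: real and T :: nat
  assumes "0 < \<mu>" "\<mu> \<le> l" "l \<le> N" "0 < T"
  shows "\<bar>(1 - l / N) ^ T / l\<bar> \<le> N / (\<mu>\<^sup>2 * T)"
proof -
  have N: "0 < N" "0 < l" using assms by auto
  have r: "0 \<le> 1 - l / N" "1 - l / N \<le> 1 - \<mu> / N" using assms N by (auto simp: field_simps)
  have "(1 - l / N) ^ T \<le> (1 - \<mu> / N) ^ T" using r by (intro power_mono)
  also have "\<dots> \<le> exp (- (\<mu> / N)) ^ T"
    using r exp_ge_add_one_self[of "- (\<mu> / N)"] by (intro power_mono) auto
  also have "\<dots> = 1 / exp (T * \<mu> / N)" 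
    by (simp add: exp_of_nat_mult[symmetric] exp_minus inverse_eq_divide)
      (simp add: exp_of_nat_mult[symmetric] power_one_over)
  also have "\<dots> \<le> 1 / (T * \<mu> / N)"
    using order_trans[OF _ exp_ge_add_one_self[of "T * \<mu> / N"]] assms N
    by (intro divide_left_mono) (auto intro!: mult_pos_pos divide_pos_pos)
  finally have "(1 - l / N) ^ T \<le> N / (T * \<mu>)" by simp
  then have "(1 - l / N) ^ T / l \<le> (N / (T * \<mu>)) / \<mu>"
    using assms N r by (intro frac_le) auto
  then show ?thesis using r N by (simp add: power2_eq_square mult_ac)
qed

text \<open>In the eigenbasis the T-term sum differs from 1 / l p by the geometric remainder. There
  are at most n modes, each with a coefficient and an eigenvector entry of modulus at most 1. From l
  p \<le> 2 \<le> N it follows that all ratios are nonnegative.\<close>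

lemma pseudo_inverse_series:
  fixes N :: real and T :: nat
  assumes b: "b \<in> eigen_image (laplacian G)" "b \<bullet> b = 1" and i: "i < n"
    and N: "2 \<le> N" and T: "0 < T" and D0: "0 < D"
  shows "\<bar>(pseudo_inverse (laplacian G) *\<^sub>v b) $ i -
     (\<Sum>t<T. sqrt (d i) * (walk_op N n trans_prob ^^ t) (start b) i) / N\<bar> \<le> n * N / ((lo / ((real n)\<^sup>2 * D))\<^sup>2 * T)"
proof -
  let ?L = "laplacian G"
  obtain l u \<beta> where on: "\<And>p q. p < n \<Longrightarrow> q < n \<Longrightarrow> (\<Sum>i<n. u p i * u q i) = (if p = q then 1 else 0)"
    and ev: "\<And>p i. p < n \<Longrightarrow> i < n \<Longrightarrow> (\<Sum>j<n. ?L $$ (i, j) * u p j) = l p * u p i"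
    and \<beta>: "\<And>p. p < n \<Longrightarrow> \<beta> p = (\<Sum>i<n. u p i * b $ i)"
    and \<beta>0: "\<And>p. p < n \<Longrightarrow> l p = 0 \<Longrightarrow> \<beta> p = 0"
    and b_exp: "\<And>i. i < n \<Longrightarrow> b $ i = (\<Sum>p<n. \<beta> p * u p i)"
    and pinv: "\<And>i. i < n \<Longrightarrow> (pseudo_inverse ?L *\<^sub>v b) $ i = (\<Sum>p | p < n \<and> l p \<noteq> 0. \<beta> p / l p * u p i)"
    apply (rule pseudo_inverse_expansion[OF laplacian_carrier _ b(1)])
    subgoal by (rule laplacian_sym)
    subgoal premises p for l u \<beta> by (rule p(1)[OF p(2-)])
    done
  define S where "S = {p. p < n \<and> l p \<noteq> 0}"
  have S: "finite S" "S \<subseteq> {..<n}" by (auto simp: S_def)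
  have bS: "b $ i = (\<Sum>p\<in>S. \<beta> p * u p i)" if "i < n" for i
    unfolding b_exp[OF that] by (rule sum.mono_neutral_right) (use \<beta>0 in \<open>auto simp: S_def\<close>)
  \<comment> \<open>Eigenvectors with nonzero eigenvalue vanish at an isolated vertex, hence so does
    \<open>b\<close>; this justifies the division by the square root of 0 in
    \<open>start\<close>.\<close>
  have b_isolated: "b $ i = 0" if "i < n" "d i = 0" for i
  proof -
    have "u p i = 0" if "p \<in> S" for p
      using ev[of p i] that \<open>i < n\<close> \<open>d i = 0\<close> by (simp add: laplacian_apply S_def)
    then show ?thesis by (simp add: bS[OF that(1)])
  qed
  have iter: "sqrt (d i) * (walk_op N n trans_prob ^^ t) (start b) i = (\<Sum>p\<in>S. \<beta> p * (1 - l p / N) ^ t * u p i)"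
    if "i < n" for i t
    using that
  proof (induction t arbitrary: i)
    case 0
    then show ?case using b_isolated[of i] bS[of i] by (cases "d i = 0") (auto simp: start_def)
  next
    case (Suc t)
    have "(\<Sum>j<n. ?L $$ (i, j) * (\<Sum>p\<in>S. \<beta> p * (1 - l p / N) ^ t * u p j)) =
        (\<Sum>p\<in>S. \<beta> p * (1 - l p / N) ^ t * (\<Sum>j<n. ?L $$ (i, j) * u p j))"
      unfolding sum_distrib_left by (subst sum.swap) (simp add: mult_ac)
    also have "\<dots> = (\<Sum>p\<in>S. \<beta> p * (1 - l p / N) ^ t * (l p * u p i))"
      by (intro sum.cong refl) (use ev Suc.prems in \<open>auto simp: S_def\<close>)
    finally have L: "(\<Sum>j<n. ?L $$ (i, j) * (sqrt (d j) * (walk_op N n trans_prob ^^ t) (start b) j)) =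
        (\<Sum>p\<in>S. \<beta> p * (1 - l p / N) ^ t * (l p * u p i))"
      using Suc.IH by simp
    have "sqrt (d i) * (walk_op N n trans_prob ^^ Suc t) (start b) i =
       (\<Sum>p\<in>S. \<beta> p * (1 - l p / N) ^ t * u p i) - (\<Sum>p\<in>S. \<beta> p * (1 - l p / N) ^ t * (l p * u p i)) / N"
      using walk_op_laplacian[OF Suc.prems, of "(walk_op N n trans_prob ^^ t) (start b)" N]
      unfolding L Suc.IH[OF Suc.prems] by (simp add: start_iterate_isolated)
    also have "\<dots> = (\<Sum>p\<in>S. \<beta> p * (1 - l p / N) ^ Suc t * u p i)"
      by (simp add: sum_divide_distrib sum_subtractf[symmetric] algebra_simps)
    finally show ?case .
  qed
  define \<mu> where "\<mu> = lo / ((real n)\<^sup>2 * D)"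
  have n0: "n > 0" using i by simp
  have lam: "\<mu> > 0" using lo D0 n0 by (simp add: \<mu>_def)
  have u1: "(\<Sum>i<n. (u p i)\<^sup>2) = 1" if "p < n" for p using on[OF that that] by (simp add: power2_eq_square)
  have lp: "\<mu> \<le> l p" "l p \<le> 2" if "p \<in> S" for p
  proof -
    have "\<exists>i0<n. u p i0 \<noteq> 0" using u1[of p] that by (auto simp: S_def intro: ccontr)
    then obtain i0 where "i0 < n" "u p i0 \<noteq> 0" by blast
    then show "\<mu> \<le> l p" "l p \<le> 2"
      using eigenvalue_bounds[of "u p" "l p" i0] ev that by (auto simp: S_def \<mu>_def)
  qed
  have bc: "b \<in> carrier_vec n" using eigen_image_carrier[OF laplacian_carrier b(1)] .
  have b1: "(\<Sum>i<n. (b $ i)\<^sup>2) = 1" using b(2) bc by (simp add: scalar_prod_sum[of _ n] power2_eq_square)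
  have beta: "\<bar>\<beta> p\<bar> \<le> 1" if "p \<in> S" for p
  proof -
    have "(\<beta> p)\<^sup>2 \<le> (\<Sum>i<n. (u p i)\<^sup>2) * (\<Sum>i<n. (b $ i)\<^sup>2)"
      using \<beta>[of p] that by (simp add: S_def Cauchy_Schwarz_ineq_sum)
    then show ?thesis using u1[of p] b1 that by (simp add: S_def abs_square_le_1)
  qed
  have u_le: "\<bar>u p i\<bar> \<le> 1" if "p \<in> S" for p
  proof -
    have "(u p i)\<^sup>2 \<le> (\<Sum>i<n. (u p i)\<^sup>2)" by (rule member_le_sum) (use i in auto)
    then show ?thesis using u1[of p] that by (simp add: S_def abs_square_le_1)
  qed
  have geo: "\<beta> p / l p * u p i - (\<Sum>t<T. \<beta> p * (1 - l p / N) ^ t * u p i) / N = \<beta> p * u p i * ((1 - l p / N) ^ T / l p)"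
    if "p \<in> S" for p
  proof -
    have l0: "l p > 0" using lp(1)[OF that] lam by simp
    have "(\<Sum>t<T. (1 - l p / N) ^ t) = (1 - (1 - l p / N) ^ T) / (l p / N)"
      using sum_gp_strict[of "1 - l p / N" T] l0 N by simp
    then have e1: "(\<Sum>t<T. (1 - l p / N) ^ t) / N = (1 - (1 - l p / N) ^ T) / l p"
      using N l0 by simp
    have e2: "(\<Sum>t<T. \<beta> p * (1 - l p / N) ^ t * u p i) / N = \<beta> p * u p i * ((\<Sum>t<T. (1 - l p / N) ^ t) / N)"
      by (simp add: sum_distrib_left sum_divide_distrib mult_ac)
    show ?thesis unfolding e2 e1 using l0 by (simp add: field_simps)
  qed
  have "(pseudo_inverse ?L *\<^sub>v b) $ i - (\<Sum>t<T. sqrt (d i) * (walk_op N n trans_prob ^^ t) (start b) i) / N =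
      (\<Sum>p\<in>S. \<beta> p / l p * u p i) - (\<Sum>p\<in>S. \<Sum>t<T. \<beta> p * (1 - l p / N) ^ t * u p i) / N"
    using pinv[OF i] iter[OF i] by (simp add: S_def[symmetric] sum.swap[of _ S])
  also have "\<dots> = (\<Sum>p\<in>S. \<beta> p * u p i * ((1 - l p / N) ^ T / l p))"
    unfolding sum_divide_distrib[of _ S] sum_subtractf[symmetric] by (rule sum.cong[OF refl geo])
  finally have eq: "(pseudo_inverse ?L *\<^sub>v b) $ i - (\<Sum>t<T. sqrt (d i) * (walk_op N n trans_prob ^^ t) (start b) i) / N =
      (\<Sum>p\<in>S. \<beta> p * u p i * ((1 - l p / N) ^ T / l p))" .
  have "\<bar>\<Sum>p\<in>S. \<beta> p * u p i * ((1 - l p / N) ^ T / l p)\<bar> \<le> (\<Sum>p\<in>S. N / (\<mu>\<^sup>2 * T))"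
  proof (rule order_trans[OF sum_abs], rule sum_mono)
    fix p assume p: "p \<in> S"
    have "\<bar>\<beta> p * u p i * ((1 - l p / N) ^ T / l p)\<bar> \<le> 1 * 1 * (N / (\<mu>\<^sup>2 * T))"
      unfolding abs_mult using geometric_tail[OF lam, of "l p" N T] lp[OF p] N T beta[OF p] u_le[OF p]
      by (intro mult_mono) auto
    then show "\<bar>\<beta> p * u p i * ((1 - l p / N) ^ T / l p)\<bar> \<le> N / (\<mu>\<^sup>2 * T)" by simp
  qed
  also have "\<dots> = card S * (N / (\<mu>\<^sup>2 * T))" by simp
  also have "\<dots> \<le> n * (N / (\<mu>\<^sup>2 * T))"
    using card_mono[OF _ S(2)] N by (intro mult_right_mono) auto
  finally show ?thesis unfolding eq by (simp add: \<mu>_def)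
qed

end

section \<open>A program logic for the register machine\<close>

definition bounded_store :: "int \<Rightarrow> store \<Rightarrow> bool" where
  "bounded_store B s \<longleftrightarrow> (\<forall>r. \<bar>s r\<bar> \<le> B)"

lemma bounded_store_upd [simp]: "bounded_store B s \<Longrightarrow> bounded_store B (s(r := z)) \<longleftrightarrow> \<bar>z\<bar> \<le> B"
  by (auto simp: bounded_store_def)

text \<open>\<open>halts I B cfg D\<close>: every computation from \<open>cfg\<close> halts, all its stores are bounded by \<open>B\<close>,
  and \<open>D\<close> is the distribution of the final configuration.\<close>

inductive halts :: "problem \<Rightarrow> int \<Rightarrow> config \<Rightarrow> config pmf \<Rightarrow> bool" for I B where
  halts_Skip: "bounded_store B s \<Longrightarrow> halts I B (Skip, s, out) (return_pmf (Skip, s, out))"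
| halts_step: "c \<noteq> Skip \<Longrightarrow> bounded_store B s \<Longrightarrow>
    (\<And>cfg'. cfg' \<in> set_pmf (step I (c, s, out)) \<Longrightarrow> halts I B cfg' (F cfg')) \<Longrightarrow>
    halts I B (c, s, out) (bind_pmf (step I (c, s, out)) F)"

definition steps :: "problem \<Rightarrow> nat \<Rightarrow> config \<Rightarrow> config pmf" where
  "steps I t cfg = ((\<lambda>D. bind_pmf D (step I)) ^^ t) (return_pmf cfg)"

lemma steps_0 [simp]: "steps I 0 cfg = return_pmf cfg"
  by (simp add: steps_def)

text \<open>\<open>run\<close> appends each new step at the end, whereas induction over a
  computation peels off the first one; this lemma lets \<open>steps_Suc\<close> change
  sides.\<close>

lemma funpow_bind_pmf:
  fixes f :: "'a \<Rightarrow> 'a pmf"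
  shows "((\<lambda>D. bind_pmf D f) ^^ t) D = bind_pmf D (\<lambda>x. ((\<lambda>D. bind_pmf D f) ^^ t) (return_pmf x))"
proof (induction t)
  case (Suc t)
  then have "((\<lambda>D. bind_pmf D f) ^^ Suc t) D = bind_pmf (bind_pmf D (\<lambda>x. ((\<lambda>D. bind_pmf D f) ^^ t) (return_pmf x))) f"
    by simp
  then show ?case by (simp add: bind_assoc_pmf)
qed (simp add: bind_return_pmf')

lemma steps_Suc: "steps I (Suc t) cfg = bind_pmf (step I cfg) (steps I t)"
  unfolding steps_def funpow_Suc_right comp_def by (subst funpow_bind_pmf) (simp add: bind_return_pmf)

lemma steps_Skip [simp]: "steps I t (Skip, s, out) = return_pmf (Skip, s, out)"
  by (induction t) (simp_all add: steps_Suc bind_return_pmf)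

lemma finite_set_step: "finite (set_pmf (step I cfg))"
proof -
  have "finite (set_pmf (step I (c, s, out)))" for c s out
    by (induction c) (auto simp: set_map_pmf)
  then show ?thesis by (cases cfg) auto
qed

text \<open>A step has finitely many outcomes, so the maximum of the halting times of the successors
  is finite. This yields one time bound for all coin sequences, as \<open>outputs_with_prob\<close>
  demands.\<close>

lemma halts_steps:
  "halts I B cfg D \<Longrightarrow> (\<exists>T. \<forall>t\<ge>T. steps I t cfg = D) \<and>
     (\<forall>t. \<forall>(c, s, out) \<in> set_pmf (steps I t cfg). bounded_store B s) \<and> (\<forall>(c, s, out) \<in> set_pmf D. c = Skip)"
proof (induction rule: halts.induct)
  case (halts_step c s out F)
  let ?S = "set_pmf (step I (c, s, out))"
  have "\<forall>x\<in>?S. \<exists>T. \<forall>t\<ge>T. steps I t x = F x" using halts_step.IH by blast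
  then obtain T where T: "\<And>x t. x \<in> ?S \<Longrightarrow> t \<ge> T x \<Longrightarrow> steps I t x = F x" by metis
  have fin: "finite (T ` ?S)" using finite_set_step by blast
  have "steps I t (c, s, out) = bind_pmf (step I (c, s, out)) F" if "t \<ge> Suc (Max (T ` ?S))" for t
  proof -
    obtain t' where t': "t = Suc t'" "t' \<ge> Max (T ` ?S)" using \<open>t \<ge> _\<close> by (cases t) auto
    have "T x \<le> t'" if "x \<in> ?S" for x
      using t'(2) fin that by (meson Max_ge dual_order.trans imageI)
    then show ?thesis unfolding t' steps_Suc by (intro bind_pmf_cong refl T) auto
  qed
  moreover have "\<forall>(c', s', out') \<in> set_pmf (steps I t (c, s, out)). bounded_store B s'" for t
    using halts_step.IH halts_step.hyps by (cases t) (fastforce simp: steps_Suc)+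
  moreover have "\<forall>(c', s', out') \<in> set_pmf (bind_pmf (step I (c, s, out)) F). c' = Skip"
    using halts_step.IH by fastforce
  ultimately show ?case by blast
qed auto

lemma halts_SkipD: "halts I B cfg D \<Longrightarrow> x \<in> set_pmf D \<Longrightarrow> fst x = Skip"
  using halts_steps[of I B cfg D] by (cases x) auto

lemma halts_unique:
  assumes "halts I B cfg D" "halts I B cfg E"
  shows "D = E"
proof -
  obtain T U where "\<And>t. t \<ge> T \<Longrightarrow> steps I t cfg = D" "\<And>t. t \<ge> U \<Longrightarrow> steps I t cfg = E"
    using halts_steps[OF assms(1)] halts_steps[OF assms(2)] by blast
  from this(1)[of "max T U"] this(2)[of "max T U"] show ?thesis by simp
qed

lemma halts_Seq:
  assumes "halts I B cfg D" "cfg = (c, s, out)"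
    and "\<And>s' out'. (Skip, s', out') \<in> set_pmf D \<Longrightarrow> halts I B (d, s', out') (F (Skip, s', out'))"
  shows "halts I B (Seq c d, s, out) (bind_pmf D F)"
  using assms
proof (induction arbitrary: c s out rule: halts.induct)
  case (halts_Skip s0 out0 c s out)
  have "halts I B (Seq Skip d, s, out) (bind_pmf (step I (Seq Skip d, s, out)) (\<lambda>_. F (Skip, s, out)))"
    using halts_Skip by (intro halts_step) auto
  then show ?case using halts_Skip by (simp add: bind_return_pmf)
next
  case (halts_step c0 s0 out0 G c s out)
  then have [simp]: "c0 = c" "s0 = s" "out0 = out" by auto
  \<comment> \<open>A step of \<open>Seq c d\<close> is a step of \<open>c\<close> transported by
    the injection \<open>h\<close>; inverting \<open>h\<close> recovers the continuation
    distribution chosen for \<open>c\<close>.\<close>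
  define h where "h = (\<lambda>(c', s', out'). (Seq c' d, s', out') :: config)"
  have inj: "inj h" by (auto simp: h_def inj_def)
  have st: "step I (Seq c d, s, out) = map_pmf h (step I (c, s, out))"
    using halts_step.hyps by (simp add: h_def)
  have "halts I B (Seq c d, s, out) (bind_pmf (step I (Seq c d, s, out)) (\<lambda>x. bind_pmf (G (the_inv h x)) F))"
  proof (rule halts.halts_step)
    fix cfg' assume "cfg' \<in> set_pmf (step I (Seq c d, s, out))"
    then obtain x where x: "x \<in> set_pmf (step I (c, s, out))" "cfg' = h x" by (auto simp: st simp del: step.simps)
    obtain c' s' out' where [simp]: "x = (c', s', out')" by (cases x) auto
    have "halts I B (Seq c' d, s', out') (bind_pmf (G x) F)"
      by (rule halts_step.IH) (use x halts_step.prems in auto)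
    moreover have "the_inv h cfg' = x" using x by (simp only: the_inv_f_f[OF inj])
    moreover have "cfg' = (Seq c' d, s', out')" using x by (simp add: h_def)
    ultimately show "halts I B cfg' (bind_pmf (G (the_inv h cfg')) F)" by simp
  qed (use halts_step.hyps in auto)
  also have "bind_pmf (step I (Seq c d, s, out)) (\<lambda>x. bind_pmf (G (the_inv h x)) F) = bind_pmf (bind_pmf (step I (c, s, out)) G) F"
    unfolding st by (simp only: bind_map_pmf bind_assoc_pmf the_inv_f_f[OF inj])
  finally show ?case using halts_step.prems by simp
qed

text \<open>The final state is coupled with an abstract random value: the value is distributed
  according to \<open>X\<close> and is related to the state by \<open>Q\<close>.\<close>

definition computes ::
  "problem \<Rightarrow> int \<Rightarrow> program \<Rightarrow> store \<Rightarrow> real list \<Rightarrow> 'a pmf \<Rightarrow> ('a \<Rightarrow> store \<Rightarrow> real list \<Rightarrow> bool) \<Rightarrow> bool" where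
  "computes I B c s out X Q \<longleftrightarrow> (\<exists>D. halts I B (c, s, out) D \<and>
     rel_pmf (\<lambda>x (_, s', out'). bounded_store B s' \<and> Q x s' out') X D)"

lemma computes_conseq:
  assumes "computes I B c s out X Q"
    and "\<And>x s' out'. x \<in> set_pmf X \<Longrightarrow> bounded_store B s' \<Longrightarrow> Q x s' out' \<Longrightarrow> R x s' out'"
  shows "computes I B c s out X R"
proof -
  from assms(1) obtain D where D: "halts I B (c, s, out) D"
    "rel_pmf (\<lambda>x (_, s', out'). bounded_store B s' \<and> Q x s' out') X D" by (auto simp: computes_def)
  have "rel_pmf (\<lambda>x (_, s', out'). bounded_store B s' \<and> R x s' out') X D"
    by (rule pmf.rel_mono_strong[OF D(2)]) (use assms(2) in auto)
  with D(1) show ?thesis by (auto simp: computes_def)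
qed

lemma computes_map:
  assumes "computes I B c s out X (\<lambda>x. Q (f x))"
  shows "computes I B c s out (map_pmf f X) Q"
  using assms by (auto simp: computes_def pmf.rel_map)

lemma computes_Seq:
  assumes c: "computes I B c s out X Q"
    and d: "\<And>x s' out'. x \<in> set_pmf X \<Longrightarrow> bounded_store B s' \<Longrightarrow> Q x s' out' \<Longrightarrow> computes I B d s' out' (Y x) R"
  shows "computes I B (Seq c d) s out (bind_pmf X Y) R"
proof -
  from c obtain D where D: "halts I B (c, s, out) D"
    "rel_pmf (\<lambda>x (_, s', out'). bounded_store B s' \<and> Q x s' out') X D" by (auto simp: computes_def)
  let ?R = "\<lambda>x (_, s', out'). bounded_store B s' \<and> R x s' out'"
  \<comment> \<open>The same final state may be coupled with several abstract values, yet the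
    continuation must be a function of the state alone. Uniqueness of the final distribution makes
    \<open>THE\<close> a consistent choice.\<close>
  define F where "F y = (THE E. halts I B (d, snd y) E)" for y :: config
  have F: "F y = E" if "halts I B (d, snd y) E" for y E
    unfolding F_def using that by (intro the_equality halts_unique[OF _ that])
  have D2: "rel_pmf (\<lambda>x y. fst y = Skip \<and> halts I B (d, snd y) (F y) \<and> rel_pmf ?R (Y x) (F y)) X D"
  proof (rule pmf.rel_mono_strong[OF D(2)])
    fix x y assume xy: "x \<in> set_pmf X" "y \<in> set_pmf D" "(case y of (_, s', out') \<Rightarrow> bounded_store B s' \<and> Q x s' out')"
    then obtain E where E: "halts I B (d, snd y) E" "rel_pmf ?R (Y x) E"
      using d[of x "fst (snd y)" "snd (snd y)"] by (cases y) (auto simp: computes_def)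
    then show "fst y = Skip \<and> halts I B (d, snd y) (F y) \<and> rel_pmf ?R (Y x) (F y)"
      using halts_SkipD[OF D(1) xy(2)] F by auto
  qed
  have Fh: "halts I B (d, s', out') (F (Skip, s', out'))" if "(Skip, s', out') \<in> set_pmf D" for s' out'
    using rel_pmf_imp_rel_set[OF D2] that by (auto simp: rel_set_def)
  have "halts I B (Seq c d, s, out) (bind_pmf D F)"
    by (rule halts_Seq[OF D(1) refl Fh])
  moreover have "rel_pmf ?R (bind_pmf X Y) (bind_pmf D F)"
    by (rule rel_pmf_bindI[OF D2]) auto
  ultimately show ?thesis by (auto simp: computes_def)
qed

lemma computes_Seq_det:
  assumes "computes I B c s out (return_pmf ()) (\<lambda>_. Q)"
    and "\<And>s' out'. bounded_store B s' \<Longrightarrow> Q s' out' \<Longrightarrow> computes I B d s' out' Y R"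
  shows "computes I B (Seq c d) s out Y R"
  using computes_Seq[OF assms(1), of d "\<lambda>_. Y" R] assms(2) by (simp add: bind_return_pmf)

lemma computes_Skip:
  "bounded_store B s \<Longrightarrow> Q () s out \<Longrightarrow> computes I B Skip s out (return_pmf ()) Q"
  unfolding computes_def by (intro exI conjI, rule halts_Skip) auto

lemma computes_step:
  assumes "c \<noteq> Skip" "bounded_store B s" "step I (c, s, out) = return_pmf (c', s', out')"
    and "computes I B c' s' out' X Q"
  shows "computes I B c s out X Q"
proof -
  from assms(4) obtain D where D: "halts I B (c', s', out') D"
    "rel_pmf (\<lambda>x (_, s', out'). bounded_store B s' \<and> Q x s' out') X D" by (auto simp: computes_def)
  have "halts I B (c, s, out) (bind_pmf (step I (c, s, out)) (\<lambda>_. D))"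
    by (rule halts_step) (use assms D in auto)
  with D show ?thesis by (auto simp: computes_def assms(3) bind_return_pmf)
qed

lemma computes_det:
  assumes "c \<noteq> Skip" "bounded_store B s" "step I (c, s, out) = return_pmf (Skip, s', out')"
    and "bounded_store B s'" "Q s' out'"
  shows "computes I B c s out (return_pmf ()) (\<lambda>_. Q)"
  by (rule computes_step[OF assms(1-3)], rule computes_Skip) (use assms in auto)

lemma computes_Cond:
  assumes "bounded_store B s" "computes I B (if s p < s q then c else d) s out X Q"
  shows "computes I B (Cond p q c d) s out X Q"
  by (rule computes_step[OF _ _ _ assms(2)]) (use assms in auto)

lemma computes_Coin:
  assumes s: "bounded_store B s" "B \<ge> 1" "\<And>b. Q b (s(r := of_bool b)) out"
  shows "computes I B (Coin r) s out (bernoulli_pmf (1 / 2)) Q"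
proof -
  let ?c = "bernoulli_pmf (1 / 2)"
  have "halts I B (Coin r, s, out) (bind_pmf (step I (Coin r, s, out)) return_pmf)"
    by (rule halts_step) (use s in \<open>auto intro: halts_Skip\<close>)
  moreover have "rel_pmf (\<lambda>x (_, s', out'). bounded_store B s' \<and> Q x s' out') ?c (step I (Coin r, s, out))"
    using s by (simp add: pmf.rel_map rel_pmf_reflI)
  ultimately show ?thesis by (auto simp: computes_def bind_return_pmf')
qed

fun iter_pmf :: "nat \<Rightarrow> ('a \<Rightarrow> 'a pmf) \<Rightarrow> 'a \<Rightarrow> 'a pmf" where
  "iter_pmf 0 f x = return_pmf x"
| "iter_pmf (Suc k) f x = bind_pmf (f x) (iter_pmf k f)"

text \<open>For loops whose number \<open>m\<close> of passes does not depend on the coins. The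
  invariant relates the pass number and the abstract random value to the store.\<close>

lemma computes_Loop:
  assumes body: "\<And>k x s out. k < m \<Longrightarrow> bounded_store B s \<Longrightarrow> J k x s out \<Longrightarrow>
        s p < s q \<and> computes I B c s out (f x) (J (Suc k))"
    and stop: "\<And>x s out. bounded_store B s \<Longrightarrow> J m x s out \<Longrightarrow> \<not> s p < s q"
    and init: "bounded_store B s" "J 0 x s out"
  shows "computes I B (Loop p q c) s out (iter_pmf m f x) (J m)"
proof -
  have "k + d = m \<Longrightarrow> bounded_store B s \<Longrightarrow> J k x s out \<Longrightarrow>
      computes I B (Loop p q c) s out (iter_pmf d f x) (J m)" for k d x s out
  proof (induction d arbitrary: k x s out)
    case 0
    have "computes I B Skip s out (return_pmf ()) (\<lambda>_. J m x)"
      using 0 by (intro computes_Skip) auto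
    then have "computes I B Skip s out (map_pmf (\<lambda>_. x) (return_pmf ())) (J m)"
      by (intro computes_map)
    then have "computes I B (Cond p q (Seq c (Loop p q c)) Skip) s out (return_pmf x) (J m)"
      using stop[of s x out] 0 by (intro computes_Cond) auto
    then show ?case using 0 by (intro computes_step[of "Loop p q c"]) auto
  next
    case (Suc d)
    then have b: "s p < s q" "computes I B c s out (f x) (J (Suc k))" using body[of k s x out] by auto
    have "computes I B (Seq c (Loop p q c)) s out (bind_pmf (f x) (iter_pmf d f)) (J m)"
      by (rule computes_Seq[OF b(2)]) (use Suc in auto)
    then have "computes I B (Cond p q (Seq c (Loop p q c)) Skip) s out (iter_pmf (Suc d) f x) (J m)"
      using b Suc.prems by (intro computes_Cond) auto
    then show ?case using Suc.prems by (intro computes_step[of "Loop p q c"]) auto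
  qed
  from this[of 0 m] init show ?thesis by simp
qed

lemma iter_pmf_return: "iter_pmf m (\<lambda>_. return_pmf x) x = return_pmf x"
  by (induction m) (simp_all add: bind_return_pmf)

lemma computes_Loop_det:
  assumes body: "\<And>k s out. k < m \<Longrightarrow> bounded_store B s \<Longrightarrow> J k s out \<Longrightarrow>
        s p < s q \<and> computes I B c s out (return_pmf ()) (\<lambda>_. J (Suc k))"
    and stop: "\<And>s out. bounded_store B s \<Longrightarrow> J m s out \<Longrightarrow> \<not> s p < s q"
    and init: "bounded_store B s" "J 0 s out"
  shows "computes I B (Loop p q c) s out (return_pmf ()) (\<lambda>_. J m)"
proof -
  have "computes I B (Loop p q c) s out (iter_pmf m (\<lambda>_. return_pmf ()) ()) (\<lambda>_. J m)"
    by (rule computes_Loop[where J = "\<lambda>k _. J k"]) (fact body stop init)+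
  then show ?thesis by (simp only: iter_pmf_return)
qed

section \<open>Proof rules for straight-line code\<close>

fun block :: "program list \<Rightarrow> program" where
  "block [] = Skip"
| "block (c # cs) = Seq c (block cs)"

lemma computes_return: "bounded_store B s \<Longrightarrow> Q x s out \<Longrightarrow> computes I B (block []) s out (return_pmf x) Q"
  using computes_map[of I B Skip s out "return_pmf ()" Q "\<lambda>_. x"] computes_Skip[of B s "\<lambda>_. Q x" out I] by simp

lemma block_det:
  assumes "computes I B c s out (return_pmf ()) (\<lambda>_. P)"
    and "\<And>s' out'. bounded_store B s' \<Longrightarrow> P s' out' \<Longrightarrow> computes I B (block cs) s' out' X Q"
  shows "computes I B (block (c # cs)) s out X Q"
  using computes_Seq_det[OF assms] by simp

lemma block_bind:
  assumes "computes I B c s out X P"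
    and "\<And>x s' out'. x \<in> set_pmf X \<Longrightarrow> bounded_store B s' \<Longrightarrow> P x s' out' \<Longrightarrow> computes I B (block cs) s' out' (Y x) Q"
  shows "computes I B (block (c # cs)) s out (bind_pmf X Y) Q"
  using computes_Seq[OF assms] by simp

lemma block_step:
  assumes "c \<noteq> Skip" "bounded_store B s" "step I (c, s, out) = return_pmf (Skip, s', out')"
    and "bounded_store B s'" "bounded_store B s' \<Longrightarrow> computes I B (block cs) s' out' X Q"
  shows "computes I B (block (c # cs)) s out X Q"
  by (rule block_det[OF computes_det[OF assms(1-4), where Q = "\<lambda>t o'. t = s' \<and> o' = out'"]])
    (use assms in auto)

lemma block_Const:
  assumes "bounded_store B s" "\<bar>z\<bar> \<le> B"
    "bounded_store B (s(r := z)) \<Longrightarrow> computes I B (block cs) (s(r := z)) out X Q"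
  shows "computes I B (block (Const r z # cs)) s out X Q"
  by (rule block_step[where s' = "s(r := z)"]) (use assms in auto)

lemma block_Arith:
  assumes "bounded_store B s" "z = arith f (s p) (s q)" "\<bar>z\<bar> \<le> B"
    "bounded_store B (s(r := z)) \<Longrightarrow> computes I B (block cs) (s(r := z)) out X Q"
  shows "computes I B (block (Arith f r p q # cs)) s out X Q"
  by (rule block_step[where s' = "s(r := z)"]) (use assms in auto)

lemma block_ReadSize:
  assumes "bounded_store B s" "z = int (nverts (graph I))" "\<bar>z\<bar> \<le> B"
    "bounded_store B (s(r := z)) \<Longrightarrow> computes I B (block cs) (s(r := z)) out X Q"
  shows "computes I B (block (ReadSize r # cs)) s out X Q"
  by (rule block_step[where s' = "s(r := z)"]) (use assms in auto)

lemma block_ReadWeight: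
  assumes "bounded_store B s" "z = fixed_point (wt (graph I) (nat (s i)) (nat (s j))) (s k)" "\<bar>z\<bar> \<le> B"
    "bounded_store B (s(r := z)) \<Longrightarrow> computes I B (block cs) (s(r := z)) out X Q"
  shows "computes I B (block (ReadWeight r i j k # cs)) s out X Q"
  by (rule block_step[where s' = "s(r := z)"]) (use assms in auto)

lemma block_ReadRhs:
  assumes "bounded_store B s" "z = fixed_point (rhs_entry I (s i)) (s k)" "\<bar>z\<bar> \<le> B"
    "bounded_store B (s(r := z)) \<Longrightarrow> computes I B (block cs) (s(r := z)) out X Q"
  shows "computes I B (block (ReadRhs r i k # cs)) s out X Q"
  by (rule block_step[where s' = "s(r := z)"]) (use assms in auto)

lemma block_ReadEps:
  assumes "bounded_store B s" "z = fixed_point (eps I) (s k)" "\<bar>z\<bar> \<le> B"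
    "bounded_store B (s(r := z)) \<Longrightarrow> computes I B (block cs) (s(r := z)) out X Q"
  shows "computes I B (block (ReadEps r k # cs)) s out X Q"
  by (rule block_step[where s' = "s(r := z)"]) (use assms in auto)

lemma block_ReadGam:
  assumes "bounded_store B s" "z = fixed_point (gam I) (s k)" "\<bar>z\<bar> \<le> B"
    "bounded_store B (s(r := z)) \<Longrightarrow> computes I B (block cs) (s(r := z)) out X Q"
  shows "computes I B (block (ReadGam r k # cs)) s out X Q"
  by (rule block_step[where s' = "s(r := z)"]) (use assms in auto)

lemma block_Write:
  assumes "bounded_store B s" "a = of_int (s r) / 2 ^ nat (s k)" "computes I B (block cs) s (out @ [a]) X Q"
  shows "computes I B (block (Write r k # cs)) s out X Q"
  by (rule block_step[where s' = s]) (use assms in auto)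

section \<open>The random walk program\<close>

text \<open>Registers up to 10 hold the parameters, fixed once initialisation is over; those above
  10 are working registers. \<open>params_upd\<close> and \<open>params_frame\<close> rely on this
  split.\<close>

abbreviation (input) "rZero \<equiv> 0 :: nat"
abbreviation (input) "rExp \<equiv> 2 :: nat"
abbreviation (input) "rSize \<equiv> 3 :: nat"
abbreviation (input) "rOne \<equiv> 4 :: nat"
abbreviation (input) "rConf \<equiv> 5 :: nat"
abbreviation (input) "rScale \<equiv> 6 :: nat"
abbreviation (input) "rPrec \<equiv> 7 :: nat"
abbreviation (input) "rLen \<equiv> 8 :: nat"
abbreviation (input) "rRuns \<equiv> 9 :: nat"
abbreviation (input) "rOut \<equiv> 10 :: nat"
abbreviation (input) "rVertex \<equiv> 11 :: nat"
abbreviation (input) "rPos \<equiv> 12 :: nat"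
abbreviation (input) "rDegStart \<equiv> 13 :: nat"
abbreviation (input) "rAcc \<equiv> 14 :: nat"
abbreviation (input) "rRun \<equiv> 15 :: nat"
abbreviation (input) "rSum \<equiv> 16 :: nat"
abbreviation (input) "rTime \<equiv> 17 :: nat"
abbreviation (input) "rDeg \<equiv> 18 :: nat"
abbreviation (input) "rArg \<equiv> 19 :: nat"
abbreviation (input) "rRoot \<equiv> 20 :: nat"
abbreviation (input) "rNext \<equiv> 21 :: nat"
abbreviation (input) "rRhs \<equiv> 22 :: nat"
abbreviation (input) "rTarget \<equiv> 23 :: nat"
abbreviation (input) "rThreshold \<equiv> 24 :: nat"
abbreviation (input) "rCount \<equiv> 25 :: nat"
abbreviation (input) "rCoin \<equiv> 26 :: nat"
abbreviation (input) "rWeight \<equiv> 27 :: nat"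
abbreviation (input) "rLeft \<equiv> 28 :: nat"
abbreviation (input) "rRight \<equiv> 29 :: nat"
abbreviation (input) "rBase \<equiv> 30 :: nat"

definition degree_prog :: program where
  "degree_prog = block [Const rDeg 0, Const rCount 0,
     Loop rCount rSize (block [ReadWeight rWeight rPos rCount rPrec, Arith Plus rDeg rDeg rWeight,
       Arith Plus rCount rCount rOne])]"

text \<open>\<open>rArg\<close> holds the radicand plus one, because the test of a loop is strict.\<close>

definition sqrt_prog :: program where
  "sqrt_prog = block [Const rRoot 0, Const rNext 1,
     Loop rNext rArg (block [Arith Plus rRoot rRoot rOne, Arith Plus rNext rRoot rOne,
       Arith Times rNext rNext rNext])]"

definition draw_prog :: "nat \<Rightarrow> nat \<Rightarrow> program" where
  "draw_prog r bits = block [Const r 0, Const rCount 0,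
     Loop rCount bits (block [Coin rCoin, Arith Plus r r r, Arith Plus r r rCoin,
       Arith Plus rCount rCount rOne])]"

text \<open>Everything stays in integers: the root of the scaled quotient of degrees approximates
  2^k * sqrt (d i / d x), and a proposal is accepted by comparing u * deg with 2^k * weight instead
  of dividing. The test is strict, so a proposal of weight 0, in particular an index outside the
  graph, is always rejected.\<close>

definition step_prog :: program where
  "step_prog = block [degree_prog,
     Arith Times rArg rScale rScale, Arith Times rArg rArg rDegStart, Arith Divide rArg rArg rDeg,
     Arith Plus rArg rArg rOne, sqrt_prog,
     ReadRhs rRhs rPos rPrec, Arith Times rRhs rRoot rRhs, Arith Plus rSum rSum rRhs,
     draw_prog rTarget rExp, draw_prog rThreshold rPrec, ReadWeight rWeight rPos rTarget rPrec,
     Arith Times rLeft rThreshold rDeg, Arith Times rRight rScale rWeight,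
     Cond rLeft rRight (Arith Plus rPos rTarget rZero) Skip,
     Arith Plus rTime rTime rOne]"

definition run_prog :: program where
  "run_prog = block [Arith Plus rPos rVertex rZero, Const rSum 0, Const rTime 0,
     Loop rTime rLen step_prog, Arith Plus rAcc rAcc rSum, Arith Plus rRun rRun rOne]"

text \<open>To average over the runs, only the factor \<open>g\<close> of their number is divided
  out. The remaining factors are powers of two and go into the exponent with which the result is
  written.\<close>

definition vertex_prog :: program where
  "vertex_prog = block [Arith Plus rPos rVertex rZero, degree_prog, Arith Plus rDegStart rDeg rZero,
     Const rAcc 0, Const rRun 0, Loop rRun rRuns run_prog,
     Arith Divide rAcc rAcc rConf, Write rAcc rOut, Arith Plus rVertex rVertex rOne]"

section \<open>Sampling by coins and integer square roots\<close>

definition unif :: "nat \<Rightarrow> nat pmf" where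
  "unif m = pmf_of_set {..<2 ^ m}"

text \<open>The first coin becomes the most significant bit, matching a loop that doubles the number
  and adds the new coin.\<close>

lemma unif_Suc: "unif (Suc m) = bind_pmf (bernoulli_pmf (1 / 2)) (\<lambda>b. map_pmf (\<lambda>u. of_bool b * 2 ^ m + u) (unif m))"
proof -
  define h where "h = (\<lambda>(b, u). of_bool b * 2 ^ m + u :: nat)"
  have "bind_pmf (bernoulli_pmf (1 / 2)) (\<lambda>b. map_pmf (\<lambda>u. of_bool b * 2 ^ m + u) (unif m)) =
      map_pmf h (pair_pmf (bernoulli_pmf (1 / 2)) (unif m))"
    by (simp add: pair_pmf_def map_bind_pmf map_pmf_def bind_assoc_pmf bind_return_pmf h_def)
  also have "pair_pmf (bernoulli_pmf (1 / 2)) (unif m) = pmf_of_set (UNIV \<times> {..<2 ^ m})"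
    unfolding unif_def bernoulli_pmf_half_conv_pmf_of_set
    by (rule pmf_eqI) (auto simp: pmf_pair lessThan_empty_iff indicator_def)
  also have "map_pmf h \<dots> = pmf_of_set (h ` (UNIV \<times> {..<2 ^ m}))"
  proof (rule map_pmf_of_set_inj)
    show "inj_on h (UNIV \<times> {..<2 ^ m})"
      by (auto simp: inj_on_def h_def split: if_splits simp: of_bool_def)
  qed (auto simp: lessThan_empty_iff)
  also have "h ` (UNIV \<times> {..<2 ^ m}) = {..<2 ^ Suc m}"
  proof (intro equalityI subsetI)
    fix z assume "z \<in> {..<2 ^ Suc m :: nat}"
    then have "z = h (2 ^ m \<le> z, if 2 ^ m \<le> z then z - 2 ^ m else z)"
      "(2 ^ m \<le> z, if 2 ^ m \<le> z then z - 2 ^ m else z) \<in> UNIV \<times> {..<2 ^ m}"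
      by (auto simp: h_def)
    then show "z \<in> h ` (UNIV \<times> {..<2 ^ m})" by blast
  qed (auto simp: h_def of_bool_def)
  finally show ?thesis by (simp add: unif_def)
qed

lemma iter_coin:
  "iter_pmf m (\<lambda>x. bind_pmf (bernoulli_pmf (1 / 2)) (\<lambda>b. return_pmf (2 * x + of_bool b))) x =
     map_pmf (\<lambda>u. x * 2 ^ m + u) (unif m)"
proof (induction m arbitrary: x)
  case 0
  then show ?case by (simp add: unif_def lessThan_Suc map_pmf_of_set_inj pmf_of_set_singleton)
next
  case (Suc m)
  then show ?case
    by (simp add: unif_Suc bind_assoc_pmf bind_return_pmf map_bind_pmf pmf.map_comp comp_def algebra_simps)
qed

lemma computes_draw:
  assumes s: "bounded_store B s" "s bits = int m" "s rOne = 1" and B: "2 ^ m \<le> B" "int m \<le> B"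
    and r: "distinct [r, bits, rCount, rCoin, rOne]"
  shows "computes I B (draw_prog r bits) s out (unif m)
    (\<lambda>u s' out'. out' = out \<and> s' r = int u \<and> (\<forall>p. p \<notin> {r, rCount, rCoin} \<longrightarrow> s' p = s p))"
proof -
  let ?body = "block [Coin rCoin, Arith Plus r r r, Arith Plus r r rCoin, Arith Plus rCount rCount rOne]"
  have B1: "1 \<le> B" using B(1) by (smt (verit) one_le_power)
  define J where "J k u s' out' \<longleftrightarrow> out' = out \<and> u < 2 ^ k \<and> s' r = int u \<and> s' rCount = int k \<and>
      (\<forall>p. p \<notin> {r, rCount, rCoin} \<longrightarrow> s' p = s p)" for k u s' and out' :: "real list"
  let ?f = "\<lambda>x. bind_pmf (bernoulli_pmf (1 / 2)) (\<lambda>b. return_pmf (2 * x + of_bool b))"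
  have loop: "computes I B (Loop rCount bits ?body) s' out (iter_pmf m ?f 0) (J m)"
    if "bounded_store B s'" "J 0 0 s' out" for s'
  proof (rule computes_Loop[where J = J, OF _ _ that])
    fix k u s' out' assume *: "k < m" "bounded_store B s'" "J k u s' out'"
    have "(2::nat) ^ Suc k \<le> 2 ^ m" using *(1) by (intro power_increasing) auto
    moreover have u': "2 * u + 1 < 2 ^ Suc k" using *(3) by (simp add: J_def)
    ultimately have "int (2 * u + 1) \<le> int (2 ^ m)" unfolding of_nat_le_iff by linarith
    with u' have u: "int (2 * u + 1) \<le> 2 ^ m" "2 * u + 1 < 2 ^ Suc k" by simp_all
    have "s' rCount < s' bits" using * s r by (simp add: J_def)
    moreover have "computes I B ?body s' out' (?f u) (J (Suc k))"
    proof (rule block_bind[OF computes_Coin[where Q = "\<lambda>b t o'. t = s'(rCoin := of_bool b) \<and> o' = out'"]])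
      fix b t o' assume t: "bounded_store B t" "t = s'(rCoin := of_bool b) \<and> o' = out'"
      have ub: "\<bar>int (2 * u)\<bar> \<le> B" "\<bar>int (2 * u + of_bool b)\<bar> \<le> B" using u B by auto
      show "computes I B (block [Arith Plus r r r, Arith Plus r r rCoin, Arith Plus rCount rCount rOne])
          t o' (return_pmf (2 * u + of_bool b)) (J (Suc k))"
        apply (rule block_Arith[OF t(1), of "int (2 * u)"])
        subgoal using t * r by (auto simp: J_def)
        subgoal using ub by simp
        apply (rule block_Arith[of _ _ "int (2 * u + of_bool b)"], assumption)
        subgoal using t * r by (auto simp: J_def)
        subgoal using ub by simp
        apply (rule block_Arith[of _ _ "int (Suc k)"], assumption)
        subgoal using t * r s by (auto simp: J_def)
        subgoal using * B by simp
        apply (rule computes_return, assumption)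
        using t * r u by (auto simp: J_def)
    qed (use * B1 in auto)
    ultimately show "s' rCount < s' bits \<and> computes I B ?body s' out' (?f u) (J (Suc k))" ..
  qed (use s r in \<open>auto simp: J_def\<close>)
  have "computes I B (draw_prog r bits) s out (bind_pmf (iter_pmf m ?f 0) return_pmf)
    (\<lambda>u s' out'. out' = out \<and> s' r = int u \<and> (\<forall>p. p \<notin> {r, rCount, rCoin} \<longrightarrow> s' p = s p))"
    unfolding draw_prog_def
    apply (rule block_Const[OF s(1)])
    subgoal using B1 by simp
    apply (rule block_Const, assumption)
    subgoal using B1 by simp
    apply (rule block_bind)
     apply (rule loop, assumption)
    subgoal using r by (auto simp: J_def)
    apply (rule computes_return, assumption)
    by (auto simp: J_def)
  also have "bind_pmf (iter_pmf m ?f 0) return_pmf = unif m"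
    by (simp add: bind_return_pmf' iter_coin)
  finally show ?thesis .
qed

lemma computes_sqrt:
  assumes s: "bounded_store B s" "s rArg = int X + 1" "s rOne = 1" and B: "4 * int X + 4 \<le> B"
  shows "computes I B sqrt_prog s out (return_pmf ())
    (\<lambda>_ s' out'. out' = out \<and> s' rRoot = int (floor_sqrt X) \<and> (\<forall>p. p \<notin> {rRoot, rNext} \<longrightarrow> s' p = s p))"
proof -
  let ?body = "block [Arith Plus rRoot rRoot rOne, Arith Plus rNext rRoot rOne, Arith Times rNext rNext rNext]"
  define J where "J k s' out' \<longleftrightarrow> out' = out \<and> s' rRoot = int k \<and> s' rNext = int ((Suc k)\<^sup>2) \<and>
      (\<forall>p. p \<notin> {rRoot, rNext} \<longrightarrow> s' p = s p)" for k s' and out' :: "real list"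
  have loop: "computes I B (Loop rNext rArg ?body) s' out (return_pmf ()) (\<lambda>_. J (floor_sqrt X))"
    if "bounded_store B s'" "J 0 s' out" for s'
  proof (rule computes_Loop_det[where J = J, OF _ _ that])
    fix k s' out' assume *: "k < floor_sqrt X" "bounded_store B s'" "J k s' out'"
    have "(Suc k)\<^sup>2 \<le> (floor_sqrt X)\<^sup>2" using * by (intro power_mono) auto
    also have "\<dots> \<le> X" by (rule floor_sqrt_power2_le)
    finally have k: "(Suc k)\<^sup>2 \<le> X" .
    have "s' rNext < s' rArg" using * s k by (simp add: J_def del: of_nat_power)
    \<comment> \<open>The next candidate square is formed before it is tested, so it may exceed X;
      from (k + 1)^2 \<le> X it follows that (k + 2)^2 is at most 4 * X. This is the origin of the
      factor 4 in the bounds.\<close>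
    have k2: "Suc (Suc k) * Suc (Suc k) \<le> 4 * X + 4" "Suc k \<le> X" "Suc (Suc k) \<le> 4 * X + 4"
      using k by (simp_all add: power2_eq_square)
    then have k3: "int (Suc (Suc k) * Suc (Suc k)) \<le> B" "int (Suc k) \<le> B" "int (Suc (Suc k)) \<le> B"
      using B by linarith+
    have "computes I B ?body s' out' (return_pmf ()) (\<lambda>_. J (Suc k))"
      apply (rule block_Arith[OF *(2), of "int (Suc k)"])
      subgoal using * s by (simp add: J_def)
      subgoal using k3 by simp
      apply (rule block_Arith[of _ _ "int (Suc (Suc k))"], assumption)
      subgoal using * s by (simp add: J_def)
      subgoal using k3 by simp
      apply (rule block_Arith[of _ _ "int (Suc (Suc k) * Suc (Suc k))"], assumption)
      subgoal by (simp add: algebra_simps)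
      subgoal using k3 by simp
      apply (rule computes_return, assumption)
      using * by (auto simp: J_def power2_eq_square)
    with \<open>s' rNext < s' rArg\<close> show "s' rNext < s' rArg \<and> computes I B ?body s' out' (return_pmf ()) (\<lambda>_. J (Suc k))" ..
  next
    fix s' out' assume "J (floor_sqrt X) s' out'"
    then show "\<not> s' rNext < s' rArg"
      using s Suc_floor_sqrt_power2_gt[of X] by (auto simp: J_def simp del: of_nat_power)
  qed
  show ?thesis
    unfolding sqrt_prog_def
    apply (rule block_Const[OF s(1)])
    subgoal using B by simp
    apply (rule block_Const, assumption)
    subgoal using B by simp
    apply (rule block_det)
     apply (rule loop, assumption)
    subgoal by (auto simp: J_def)
    apply (rule computes_return, assumption)
    by (auto simp: J_def)
qed

lemma block_Cond_Arith:
  assumes "bounded_store B s" "z = (if s p < s q then arith f (s a) (s b) else s r)" "\<bar>z\<bar> \<le> B"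
    "bounded_store B (s(r := z)) \<Longrightarrow> computes I B (block cs) (s(r := z)) out X Q"
  shows "computes I B (block (Cond p q (Arith f r a b) Skip # cs)) s out X Q"
proof (rule block_det[where P = "\<lambda>s' out'. s' = s(r := z) \<and> out' = out"])
  let ?P = "\<lambda>s' out'. s' = s(r := z) \<and> out' = out"
  have "computes I B (Arith f r a b) s out (return_pmf ()) (\<lambda>_. ?P)" if "s p < s q"
    by (rule computes_det[where s' = "s(r := z)"]) (use assms that in auto)
  moreover have "computes I B Skip s out (return_pmf ()) (\<lambda>_. ?P)" if "\<not> s p < s q"
    by (rule computes_Skip) (use assms that in auto)
  ultimately show "computes I B (Cond p q (Arith f r a b) Skip) s out (return_pmf ()) (\<lambda>_. ?P)"
    by (intro computes_Cond[OF assms(1)]) simp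
qed (use assms in auto)

section \<open>The walk program with abstract parameters\<close>

text \<open>\<open>e\<close> is the number of bits of a proposed vertex, \<open>k\<close> the binary
  precision, \<open>T\<close> the length of a walk, \<open>R\<close> the number of walks per vertex,
  \<open>g\<close> the factor of \<open>R\<close> that stands for log (1 / \<gamma>),
  \<open>oe\<close> the output exponent, and \<open>B\<close> the bound on all registers.\<close>

locale walk_machine =
  fixes I :: problem and B :: int and n e g k T R oe :: nat
  assumes size: "nverts (graph I) = n" "n \<le> 2 ^ e"
    and wt_nonneg: "\<And>i j. wt (graph I) i j \<ge> 0"
    and wt_outside: "\<And>i j. j \<ge> n \<Longrightarrow> wt (graph I) i j = 0"
    and bounds: "int n \<le> B" "int e \<le> B" "int k \<le> B" "2 ^ e \<le> B" "2 ^ k * 2 ^ k \<le> B" "int T \<le> B" "int R \<le> B"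
    and conf: "g \<ge> 1"
begin

definition wt_int :: "nat \<Rightarrow> nat \<Rightarrow> int" where
  "wt_int i j = \<lfloor>2 ^ k * wt (graph I) i j\<rfloor>"

definition deg_int :: "nat \<Rightarrow> int" where
  "deg_int i = (\<Sum>j<n. wt_int i j)"

text \<open>An integer approximation of 2^k * 2^k * sqrt (d i / d x) * b x. For a rounded degree 0
  of \<open>x\<close> the quotient, and so the value, is 0.\<close>

definition contrib :: "nat \<Rightarrow> nat \<Rightarrow> int" where
  "contrib i x = int (floor_sqrt (nat (2 ^ k * 2 ^ k * deg_int i div deg_int x))) * fixed_point (rhs_entry I (int x)) (int k)"

definition walk_step :: "nat \<Rightarrow> nat pmf" where
  "walk_step x = bind_pmf (unif e) (\<lambda>j. bind_pmf (unif k) (\<lambda>u.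
     return_pmf (if int u * deg_int x < 2 ^ k * wt_int x j then j else x)))"

text \<open>The contribution is added before the move, so T steps collect the positions at times 0
  to T - 1.\<close>

definition sum_step :: "nat \<Rightarrow> nat \<times> int \<Rightarrow> (nat \<times> int) pmf" where
  "sum_step i = (\<lambda>(x, v). bind_pmf (walk_step x) (\<lambda>y. return_pmf (y, v + contrib i x)))"

definition run_pmf :: "nat \<Rightarrow> int pmf" where
  "run_pmf i = map_pmf snd (iter_pmf T (sum_step i) (i, 0))"

definition acc_pmf :: "nat \<Rightarrow> int pmf" where
  "acc_pmf i = iter_pmf R (\<lambda>a. bind_pmf (run_pmf i) (\<lambda>v. return_pmf (a + v))) 0"

text \<open>The length of the output written so far is the index of the vertex to be treated
  next.\<close>

definition out_pmf :: "real list pmf" where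
  "out_pmf = iter_pmf n (\<lambda>xs. bind_pmf (acc_pmf (length xs))
     (\<lambda>a. return_pmf (xs @ [of_int (a div int g) / 2 ^ oe]))) []"

definition params :: "store \<Rightarrow> bool" where
  "params s \<longleftrightarrow> s rZero = 0 \<and> s rExp = int e \<and> s rSize = int n \<and> s rOne = 1 \<and> s rConf = int g \<and>
     s rScale = 2 ^ k \<and> s rPrec = int k \<and> s rLen = int T \<and> s rRuns = int R \<and> s rOut = int oe"

lemma params_upd [simp]: "r > 10 \<Longrightarrow> params (s(r := z)) = params s"
  by (auto simp: params_def)

lemma params_frame: "params s \<Longrightarrow> (\<And>p. p \<le> 10 \<Longrightarrow> s' p = s p) \<Longrightarrow> params s'"
  by (simp add: params_def)

lemma wt_int_nonneg: "wt_int i j \<ge> 0"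
  using wt_nonneg by (simp add: wt_int_def)

lemma wt_int_outside: "j \<ge> n \<Longrightarrow> wt_int i j = 0"
  using wt_outside by (simp add: wt_int_def)

lemma deg_int_nonneg: "deg_int i \<ge> 0"
  unfolding deg_int_def by (intro sum_nonneg wt_int_nonneg)

lemma wt_int_le_deg: "wt_int i j \<le> deg_int i"
proof (cases "j < n")
  case True
  then show ?thesis unfolding deg_int_def by (intro member_le_sum) (auto simp: wt_int_nonneg)
qed (auto simp: wt_int_outside deg_int_nonneg)

lemma computes_degree:
  assumes s: "bounded_store B s" "params s" "s rPos = int x" and B: "deg_int x \<le> B"
  shows "computes I B degree_prog s out (return_pmf ())
    (\<lambda>_ s' out'. out' = out \<and> s' rDeg = deg_int x \<and> (\<forall>p. p \<notin> {rDeg, rCount, rWeight} \<longrightarrow> s' p = s p))"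
proof -
  have B0: "0 \<le> B" using bounds by linarith
  define J where "J m s' out' \<longleftrightarrow> out' = out \<and> s' rDeg = (\<Sum>j<m. wt_int x j) \<and> s' rCount = int m \<and>
      (\<forall>p. p \<notin> {rDeg, rCount, rWeight} \<longrightarrow> s' p = s p)" for m s' and out' :: "real list"
  let ?body = "block [ReadWeight rWeight rPos rCount rPrec, Arith Plus rDeg rDeg rWeight,
       Arith Plus rCount rCount rOne]"
  have loop: "computes I B (Loop rCount rSize ?body) s' out (return_pmf ()) (\<lambda>_. J n)"
    if "bounded_store B s'" "J 0 s' out" for s'
  proof (rule computes_Loop_det[where J = J, OF _ _ that])
    fix m s' out' assume *: "m < n" "bounded_store B s'" "J m s' out'"
    have "(\<Sum>j<Suc m. wt_int x j) \<le> deg_int x" unfolding deg_int_def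
      by (rule sum_mono2) (use * wt_int_nonneg in auto)
    moreover have "(\<Sum>j<Suc m. wt_int x j) \<ge> 0" by (intro sum_nonneg wt_int_nonneg)
    ultimately have b: "\<bar>\<Sum>j<Suc m. wt_int x j\<bar> \<le> B" "\<bar>wt_int x m\<bar> \<le> B"
      using B wt_int_nonneg[of x m] wt_int_le_deg[of x m] by linarith+
    have "computes I B ?body s' out' (return_pmf ()) (\<lambda>_. J (Suc m))"
      apply (rule block_ReadWeight[OF *(2), of "wt_int x m"])
      subgoal using * s by (simp add: J_def params_def fixed_point_def wt_int_def)
      subgoal using b by simp
      apply (rule block_Arith[of _ _ "\<Sum>j<Suc m. wt_int x j"], assumption)
      subgoal using * by (simp add: J_def)
      subgoal using b by simp
      apply (rule block_Arith[of _ _ "int (Suc m)"], assumption)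
      subgoal using * s by (simp add: J_def params_def)
      subgoal using * bounds by simp
      apply (rule computes_return, assumption)
      using * by (auto simp: J_def)
    moreover have "s' rCount < s' rSize" using * s by (simp add: J_def params_def)
    ultimately show "s' rCount < s' rSize \<and> computes I B ?body s' out' (return_pmf ()) (\<lambda>_. J (Suc m))" by blast
  qed (use s in \<open>auto simp: J_def params_def\<close>)
  show ?thesis
    unfolding degree_prog_def
    apply (rule block_Const[OF s(1)])
    subgoal using B0 by simp
    apply (rule block_Const, assumption)
    subgoal using B0 by simp
    apply (rule block_det)
     apply (rule loop, assumption)
    subgoal by (auto simp: J_def)
    apply (rule computes_return, assumption)
    by (auto simp: J_def deg_int_def)
qed

end

text \<open>Space is charged on every coin sequence, so these are worst-case bounds.
  \<open>deg_bound\<close> has the form 4 * X + 4 asked for by \<open>computes_sqrt\<close>, and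
  \<open>acc_bound\<close> covers the accumulator after all runs.\<close>

locale bounded_walk_machine = walk_machine +
  fixes FB :: int
  assumes deg_bound: "\<And>x. x < n \<Longrightarrow> 4 * (2 ^ k * 2 ^ k * deg_int x) + 4 \<le> B"
    and contrib_bound: "\<And>i x. i < n \<Longrightarrow> x < n \<Longrightarrow> \<bar>contrib i x\<bar> \<le> FB"
    and rhs_bound: "\<And>x. \<bar>fixed_point (rhs_entry I (int x)) (int k)\<bar> \<le> B"
    and acc_bound: "int R * (int T * FB) \<le> B" and pos: "1 \<le> R" "1 \<le> T"
begin

lemma FB_nonneg: "x < n \<Longrightarrow> 0 \<le> FB"
  using contrib_bound[of x x] by linarith

lemma sum_bound: "x < n \<Longrightarrow> m \<le> T \<Longrightarrow> int m * FB \<le> B"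
proof -
  assume *: "x < n" "m \<le> T"
  have "int m * FB \<le> int T * FB" using * FB_nonneg by (intro mult_right_mono) auto
  also have "\<dots> \<le> int R * (int T * FB)"
    using mult_right_mono[of 1 "int R" "int T * FB"] * FB_nonneg[of x] pos by simp
  finally show ?thesis using acc_bound by linarith
qed

lemma computes_step_prog:
  assumes s: "bounded_store B s" "params s" "s rPos = int x" "s rDegStart = deg_int i" "s rSum = v"
      "s rTime = int t" and x: "x < n" "i < n" and t: "t < T" and v: "\<bar>v\<bar> \<le> int t * FB"
  shows "computes I B step_prog s out (sum_step i (x, v))
    (\<lambda>(y, v') s' out'. out' = out \<and> params s' \<and> y < n \<and> s' rPos = int y \<and> s' rSum = v' \<and>
       \<bar>v'\<bar> \<le> int (Suc t) * FB \<and> s' rTime = int (Suc t) \<and> (\<forall>p \<in> {rVertex, rDegStart, rAcc, rRun}. s' p = s p))"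
proof -
  define K :: int where "K = 2 ^ k"
  have K: "1 \<le> K" "K * K \<le> B" using bounds by (auto simp: K_def)
  have le1: "a \<le> K * a" if "0 \<le> a" for a
    using mult_right_mono[of 1 K a] K that by simp
  have KB: "K \<le> B" using le1[of K] K by linarith
  have di: "0 \<le> deg_int i" "0 \<le> deg_int x" using deg_int_nonneg by auto
  define X where "X = nat (K * K * deg_int i div deg_int x)"
  have X: "int X = K * K * deg_int i div deg_int x"
    unfolding X_def using K di by (intro nat_0_le div_int_pos_iff[THEN iffD2]) auto
  have KK: "4 * (K * K * deg_int i) + 4 \<le> B" "4 * (K * K * deg_int x) + 4 \<le> B"
    using deg_bound[OF x(2)] deg_bound[OF x(1)] by (simp_all add: K_def)
  have nn: "0 \<le> K * deg_int i" "0 \<le> K * deg_int x" "0 \<le> K * K * deg_int i" "0 \<le> K * K * deg_int x"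
    using K di by auto
  \<comment> \<open>A nonzero rounded degree is at least 1, so dividing by it does not enlarge; for
    degree 0 the quotient is 0.\<close>
  have "int X \<le> K * K * deg_int i"
  proof (cases "deg_int x = 0")
    case False
    then have "K * K * deg_int i div deg_int x \<le> K * K * deg_int i div 1"
      using di nn by (intro zdiv_mono2) auto
    then show ?thesis using X by simp
  qed (use X nn in simp)
  then have XB: "4 * int X + 4 \<le> B" using KK by linarith
  have dB: "deg_int x \<le> B" "K * deg_int x \<le> B" "K * K * deg_int i \<le> B"
    using le1[OF di(2)] le1[OF nn(2)] KK nn by (simp_all add: mult.assoc)
  have c: "contrib i x = int (floor_sqrt X) * fixed_point (rhs_entry I (int x)) (int k)"
    by (simp add: contrib_def X_def K_def)
  have cB: "\<bar>contrib i x\<bar> \<le> B" using contrib_bound[OF x(2,1)] sum_bound[OF x(1), of 1] pos by simp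
  have vB: "\<bar>v + contrib i x\<bar> \<le> int (Suc t) * FB"
    using contrib_bound[OF x(2,1)] v by (simp add: algebra_simps)
  then have vB': "\<bar>v + contrib i x\<bar> \<le> B" using sum_bound[OF x(1), of "Suc t"] t by linarith
  let ?Q = "\<lambda>(y, v') s' out'. out' = out \<and> params s' \<and> y < n \<and> s' rPos = int y \<and> s' rSum = v' \<and>
       \<bar>v'\<bar> \<le> int (Suc t) * FB \<and> s' rTime = int (Suc t) \<and> (\<forall>p \<in> {rVertex, rDegStart, rAcc, rRun}. s' p = s p)"
  have "computes I B step_prog s out (bind_pmf (unif e) (\<lambda>j. bind_pmf (unif k) (\<lambda>u.
     return_pmf (if int u * deg_int x < K * wt_int x j then j else x, v + contrib i x)))) ?Q"
    unfolding step_prog_def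
    apply (rule block_det[OF computes_degree[OF s(1-3) dB(1)]])
    subgoal premises d for s1 out1
    proof -
      have s1: "params s1" "s1 rPos = int x" "s1 rDeg = deg_int x" "s1 rDegStart = deg_int i" "s1 rSum = v"
        "s1 rTime = int t" "\<forall>p\<in>{rVertex, rDegStart, rAcc, rRun}. s1 p = s p" "out1 = out"
        using d(2) s params_frame[OF s(2), of s1] by auto
      note p1 = s1(1)[unfolded params_def, folded K_def]
      define s2 where "s2 = s1(rArg := K * K * deg_int i div deg_int x + 1)"
      show ?thesis
        apply (rule block_Arith[OF d(1), of "K * K"])
        subgoal using p1 by simp
        subgoal using K by simp
        apply (rule block_Arith[of _ _ "K * K * deg_int i"], assumption)
        subgoal using s1 by simp
        subgoal using dB nn by simp
        apply (rule block_Arith[of _ _ "int X"], assumption)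
        subgoal using s1 X by simp
        subgoal using XB by simp
        apply (rule block_Arith[of _ _ "int X + 1"], assumption)
        subgoal using p1 by simp
        subgoal using XB by simp
        apply (rule block_det[OF computes_sqrt[where X = X]], assumption)
        subgoal by simp
        subgoal using p1 by simp
        subgoal by (rule XB)
        subgoal premises e for s3 out3
        proof -
          have b3: "bounded_store B s3" by (rule e)
          have s3: "params s3" "s3 rPos = int x" "s3 rDeg = deg_int x" "s3 rDegStart = deg_int i" "s3 rSum = v"
            "s3 rTime = int t" "\<forall>p\<in>{rVertex, rDegStart, rAcc, rRun}. s3 p = s p" "out3 = out" "s3 rRoot = int (floor_sqrt X)"
            using e s1 params_frame[OF s1(1), of s3] by auto
          note p3 = s3(1)[unfolded params_def, folded K_def]
          show ?thesis
            apply (rule block_ReadRhs[OF b3, of "fixed_point (rhs_entry I (int x)) (int k)"])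
            subgoal using s3 p3 by simp
            subgoal by (rule rhs_bound)
            apply (rule block_Arith[of _ _ "contrib i x"], assumption)
            subgoal using s3 by (simp add: c)
            subgoal by (rule cB)
            apply (rule block_Arith[of _ _ "v + contrib i x"], assumption)
            subgoal using s3 by simp
            subgoal by (rule vB')
            apply (rule block_bind, rule computes_draw[where m = e], assumption)
            subgoal using p3 by simp
            subgoal using p3 by simp
            subgoal using bounds by simp
            subgoal using bounds by simp
            subgoal by simp
            apply (rule block_bind, rule computes_draw[where m = k], assumption)
            subgoal using p3 by simp
            subgoal using p3 by simp
            subgoal using KB by (simp add: K_def)
            subgoal using bounds by simp
            subgoal by simp
            subgoal premises f for j s4 out4 u s5 out5
            proof -
              have b5: "bounded_store B s5" by (rule f)
              have s5: "params s5" "s5 rPos = int x" "s5 rDeg = deg_int x" "s5 rDegStart = deg_int i" "s5 rSum = v + contrib i x"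
                "s5 rTime = int t" "\<forall>p\<in>{rVertex, rDegStart, rAcc, rRun}. s5 p = s p" "out5 = out"
                "s5 rTarget = int j" "s5 rThreshold = int u"
                using f s3 params_frame[OF s3(1), of s5] by auto
              note p5 = s5(1)[unfolded params_def, folded K_def]
              have "u < 2 ^ k" using f by (simp add: unif_def lessThan_empty_iff)
              then have "int u < int (2 ^ k)" by (simp only: of_nat_less_iff)
              then have u: "int u \<le> K" by (simp add: K_def)
              have l: "0 \<le> int u * deg_int x" "int u * deg_int x \<le> K * deg_int x"
                using u di by (auto intro: mult_right_mono)
              have r: "0 \<le> wt_int x j" "K * wt_int x j \<le> K * deg_int x" "0 \<le> K * wt_int x j"
                using K wt_int_nonneg[of x j] wt_int_le_deg[of x j] by auto
              define y where "y = (if int u * deg_int x < K * wt_int x j then j else x)"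
              \<comment> \<open>Weights outside the graph are 0 and the left side is nonnegative, so
                every accepted proposal is a vertex although proposals range over all numbers below
                2^e.\<close>
              have jn: "j < n" if "int u * deg_int x < K * wt_int x j"
                using wt_int_outside[of j x] that l by (cases "j < n") auto
              have yn: "y < n" using jn x by (simp add: y_def)
              have jB: "int j \<le> B" if "int u * deg_int x < K * wt_int x j" using jn[OF that] bounds by simp
              show ?thesis
                unfolding y_def[symmetric]
                apply (rule block_ReadWeight[OF b5, of "wt_int x j"])
                subgoal using s5 p5 by (simp add: fixed_point_def wt_int_def)
                subgoal using r wt_int_le_deg[of x j] dB by simp
                apply (rule block_Arith[of _ _ "int u * deg_int x"], assumption)
                subgoal using s5 by simp
                subgoal using l dB by simp
                apply (rule block_Arith[of _ _ "K * wt_int x j"], assumption)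
                subgoal using p5 by simp
                subgoal using r dB by simp
                apply (rule block_Cond_Arith[of _ _ "int y"], assumption)
                subgoal using s5 p5 by (simp add: y_def)
                subgoal using yn bounds by simp
                apply (rule block_Arith[of _ _ "int (Suc t)"], assumption)
                subgoal using s5 p5 by simp
                subgoal using t bounds by simp
                apply (rule computes_return, assumption)
                using s5 yn vB by simp
            qed
            done
        qed
        done
    qed
    done
  also have "bind_pmf (unif e) (\<lambda>j. bind_pmf (unif k) (\<lambda>u.
     return_pmf (if int u * deg_int x < K * wt_int x j then j else x, v + contrib i x))) = sum_step i (x, v)"
    by (simp add: sum_step_def walk_step_def K_def bind_assoc_pmf bind_return_pmf)
  finally show ?thesis .
qed

lemma computes_run_prog:
  assumes s: "bounded_store B s" "params s" "s rVertex = int i" "s rDegStart = deg_int i" "s rAcc = a"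
      "s rRun = int r" and i: "i < n" and r: "r < R" and a: "\<bar>a\<bar> \<le> int r * (int T * FB)"
  shows "computes I B run_prog s out (bind_pmf (run_pmf i) (\<lambda>v. return_pmf (a + v)))
    (\<lambda>a' s' out'. out' = out \<and> params s' \<and> s' rAcc = a' \<and> \<bar>a'\<bar> \<le> int (Suc r) * (int T * FB) \<and>
       s' rRun = int (Suc r) \<and> (\<forall>p \<in> {rVertex, rDegStart}. s' p = s p))"
proof -
  have B0: "0 \<le> B" using bounds by linarith
  define J where "J t xv s' out' \<longleftrightarrow> out' = out \<and> params s' \<and> fst xv < n \<and> s' rPos = int (fst xv) \<and>
      s' rSum = snd xv \<and> \<bar>snd xv\<bar> \<le> int t * FB \<and> s' rTime = int t \<and>
      (\<forall>p \<in> {rVertex, rDegStart, rAcc, rRun}. s' p = s p)" for t and xv :: "nat \<times> int" and s' and out' :: "real list"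
  have loop: "computes I B (Loop rTime rLen step_prog) s' out (iter_pmf T (sum_step i) (i, 0)) (J T)"
    if "bounded_store B s'" "J 0 (i, 0) s' out" for s'
  proof (rule computes_Loop[where J = J, OF _ _ that])
    fix t xv s' out' assume *: "t < T" "bounded_store B s'" "J t xv s' out'"
    obtain x v where [simp]: "xv = (x, v)" by (cases xv)
    have "s' rTime < s' rLen" using * by (simp add: J_def params_def)
    moreover have "computes I B step_prog s' out' (sum_step i xv) (J (Suc t))"
      unfolding \<open>xv = (x, v)\<close>
      by (rule computes_conseq[OF computes_step_prog[of s' x i v t]])
        (use * s i in \<open>auto simp: J_def\<close>)
    ultimately show "s' rTime < s' rLen \<and> computes I B step_prog s' out' (sum_step i xv) (J (Suc t))" ..
  qed (auto simp: J_def params_def)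
  have "computes I B run_prog s out (bind_pmf (iter_pmf T (sum_step i) (i, 0)) (\<lambda>xv. return_pmf (a + snd xv)))
    (\<lambda>a' s' out'. out' = out \<and> params s' \<and> s' rAcc = a' \<and> \<bar>a'\<bar> \<le> int (Suc r) * (int T * FB) \<and>
       s' rRun = int (Suc r) \<and> (\<forall>p \<in> {rVertex, rDegStart}. s' p = s p))"
    unfolding run_prog_def
    apply (rule block_Arith[OF s(1), of "int i"])
    subgoal using s by (simp add: params_def)
    subgoal using i bounds by simp
    apply (rule block_Const, assumption)
    subgoal using B0 by simp
    apply (rule block_Const, assumption)
    subgoal using B0 by simp
    apply (rule block_bind, rule loop, assumption)
    subgoal using s i by (simp add: J_def)
    subgoal premises d for xv s1 out1
    proof -
      have b1: "bounded_store B s1" by (rule d)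
      have s1: "params s1" "s1 rSum = snd xv" "s1 rAcc = a" "s1 rRun = int r" "out1 = out"
         "\<forall>p \<in> {rVertex, rDegStart}. s1 p = s p" "\<bar>snd xv\<bar> \<le> int T * FB"
        using d s by (auto simp: J_def)
      have b: "\<bar>a + snd xv\<bar> \<le> int (Suc r) * (int T * FB)" using a s1 by (simp add: algebra_simps)
      also have "\<dots> \<le> int R * (int T * FB)" using r FB_nonneg[OF i] by (intro mult_right_mono) auto
      finally have b': "\<bar>a + snd xv\<bar> \<le> B" using acc_bound by linarith
      show ?thesis
        apply (rule block_Arith[OF b1, of "a + snd xv"])
        subgoal using s1 by simp
        subgoal by (rule b')
        apply (rule block_Arith[of _ _ "int (Suc r)"], assumption)
        subgoal using s1 by (simp add: params_def)
        subgoal using r bounds by simp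
        apply (rule computes_return, assumption)
        using s1 b by simp
    qed
    done
  then show ?thesis by (simp add: run_pmf_def bind_map_pmf)
qed

lemma computes_vertex_prog:
  assumes s: "bounded_store B s" "params s" "s rVertex = int i" and i: "i < n"
  shows "computes I B vertex_prog s out (bind_pmf (acc_pmf i) (\<lambda>a. return_pmf (out @ [of_int (a div int g) / 2 ^ oe])))
    (\<lambda>xs s' out'. out' = xs \<and> params s' \<and> length xs = Suc (length out) \<and> s' rVertex = int (Suc i))"
proof -
  have B0: "0 \<le> B" using bounds by linarith
  have K: "(1::int) \<le> 2 ^ k" by simp
  have dB: "deg_int i \<le> B"
  proof -
    have "1 * deg_int i \<le> 2 ^ k * 2 ^ k * deg_int i"
      using deg_int_nonneg[of i] K mult_mono[OF K K] by (intro mult_right_mono) auto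
    then show ?thesis using deg_bound[OF i] deg_int_nonneg[of i] by linarith
  qed
  define J where "J r a s' out' \<longleftrightarrow> out' = out \<and> params s' \<and> s' rAcc = a \<and> \<bar>a\<bar> \<le> int r * (int T * FB) \<and>
      s' rRun = int r \<and> s' rVertex = int i \<and> s' rDegStart = deg_int i" for r a s' and out' :: "real list"
  have loop: "computes I B (Loop rRun rRuns run_prog) s' out (acc_pmf i) (J R)"
    if "bounded_store B s'" "J 0 0 s' out" for s'
    unfolding acc_pmf_def
  proof (rule computes_Loop[where J = J, OF _ _ that])
    fix r a s' out' assume *: "r < R" "bounded_store B s'" "J r a s' out'"
    have "s' rRun < s' rRuns" using * by (simp add: J_def params_def)
    moreover have "computes I B run_prog s' out' (bind_pmf (run_pmf i) (\<lambda>v. return_pmf (a + v))) (J (Suc r))"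
      by (rule computes_conseq[OF computes_run_prog[of s' i a r]]) (use * i in \<open>auto simp: J_def\<close>)
    ultimately show "s' rRun < s' rRuns \<and>
      computes I B run_prog s' out' (bind_pmf (run_pmf i) (\<lambda>v. return_pmf (a + v))) (J (Suc r))" ..
  qed (auto simp: J_def params_def)
  show ?thesis
    unfolding vertex_prog_def
    apply (rule block_Arith[OF s(1), of "int i"])
    subgoal using s by (simp add: params_def)
    subgoal using i bounds by simp
    apply (rule block_det[OF computes_degree[where x = i]], assumption)
    subgoal using s by (simp add: params_def)
    subgoal by simp
    subgoal by (rule dB)
    subgoal premises d for s1 out1
    proof -
      have b1: "bounded_store B s1" by (rule d)
      have s1: "params s1" "s1 rDeg = deg_int i" "s1 rVertex = int i" "out1 = out"
        using d s by (auto intro: params_frame[OF s(2)])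
      show ?thesis
        apply (rule block_Arith[OF b1, of "deg_int i"])
        subgoal using s1 by (simp add: params_def)
        subgoal using dB deg_int_nonneg[of i] by simp
        apply (rule block_Const, assumption)
        subgoal using B0 by simp
        apply (rule block_Const, assumption)
        subgoal using B0 by simp
        unfolding s1(4)
        apply (rule block_bind, rule loop, assumption)
        subgoal using s1 by (simp add: J_def)
        subgoal premises f for a s2 out2
        proof -
          have b2: "bounded_store B s2" by (rule f)
          have s2: "params s2" "s2 rAcc = a" "s2 rVertex = int i" "out2 = out"  "\<bar>a\<bar> \<le> int R * (int T * FB)"
            using f by (auto simp: J_def)
          have "\<bar>a div int g\<bar> \<le> B"
          proof -
            have g: "1 \<le> int g" using conf by simp
            \<comment> \<open>\<open>div\<close> rounds towards minus infinity, so the negative side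
              is bounded separately.\<close>
            have "- B div int g \<ge> - B"
              using g B0 zdiv_mono2_neg[of "-B" 1 "int g"] by (cases "B = 0") auto
            moreover have "B div int g \<le> B" using g B0 zdiv_mono2[of B 1 "int g"] by simp
            moreover have "- B div int g \<le> a div int g" "a div int g \<le> B div int g"
              using s2 acc_bound g by (auto intro!: zdiv_mono1)
            ultimately show ?thesis by linarith
          qed
          then show ?thesis
            apply (intro block_Arith[OF b2, of "a div int g"])
            subgoal using s2 by (simp add: params_def)
            subgoal .
            apply (rule block_Write[where a = "of_int (a div int g) / 2 ^ oe"], assumption)
            subgoal using s2 by (simp add: params_def)
            apply (rule block_Arith[of _ _ "int (Suc i)"], assumption)
            subgoal using s2 by (simp add: params_def)
            subgoal using i bounds by simp
            apply (rule computes_return, assumption)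
            using s2 by simp
        qed
        done
    qed
    done
qed

lemma computes_all_vertices:
  assumes s: "bounded_store B s" "params s"
  shows "computes I B (block [Const rVertex 0, Loop rVertex rSize vertex_prog]) s [] out_pmf
    (\<lambda>xs s' out'. out' = xs)"
proof -
  have B0: "0 \<le> B" using bounds by linarith
  define J where "J i xs s' out' \<longleftrightarrow> out' = xs \<and> length xs = i \<and> params s' \<and> s' rVertex = int i" for i xs s' and out' :: "real list"
  have loop: "computes I B (Loop rVertex rSize vertex_prog) s' [] out_pmf (J n)"
    if "bounded_store B s'" "J 0 [] s' []" for s'
    unfolding out_pmf_def
  proof (rule computes_Loop[where J = J, OF _ _ that])
    fix i xs s' out' assume *: "i < n" "bounded_store B s'" "J i xs s' out'"
    then have [simp]: "out' = xs" "length xs = i" by (auto simp: J_def)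
    have "s' rVertex < s' rSize" using * by (simp add: J_def params_def)
    moreover have "computes I B vertex_prog s' out' (bind_pmf (acc_pmf (length xs))
        (\<lambda>a. return_pmf (xs @ [of_int (a div int g) / 2 ^ oe]))) (J (Suc i))"
      using computes_conseq[OF computes_vertex_prog[of s' i xs], of "J (Suc i)"] * by (auto simp: J_def)
    ultimately show "s' rVertex < s' rSize \<and> computes I B vertex_prog s' out' (bind_pmf (acc_pmf (length xs))
        (\<lambda>a. return_pmf (xs @ [of_int (a div int g) / 2 ^ oe]))) (J (Suc i))" ..
  qed (auto simp: J_def params_def)
  have "computes I B (block [Const rVertex 0, Loop rVertex rSize vertex_prog]) s [] (bind_pmf out_pmf return_pmf)
    (\<lambda>xs s' out'. out' = xs)"
    apply (rule block_Const[OF s(1)])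
    subgoal using B0 by simp
    apply (rule block_bind, rule loop, assumption)
    subgoal using s by (simp add: J_def)
    apply (rule computes_return, assumption)
    by (auto simp: J_def)
  then show ?thesis by (simp add: bind_return_pmf')
qed

end

section \<open>Concentration of sums of independent samples\<close>

lemma finite_iter_pmf:
  "(\<And>x. finite (set_pmf (f x))) \<Longrightarrow> finite (set_pmf (iter_pmf m f x))"
  by (induction m arbitrary: x) auto

text \<open>The exponential moment of a sum of independent samples is a product: conditioning on the
  first sample pulls out one factor.\<close>

lemma nn_integral_iter_sum:
  fixes p :: "int pmf" and l \<mu> c :: real
  assumes step: "(\<integral>\<^sup>+v. ennreal (exp (l * (real_of_int v - \<mu>))) \<partial>measure_pmf p) \<le> ennreal c" and c: "c \<ge> 0"
  shows "(\<integral>\<^sup>+x. ennreal (exp (l * (real_of_int x - real_of_int a - real m * \<mu>)))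
     \<partial>measure_pmf (iter_pmf m (\<lambda>a. bind_pmf p (\<lambda>v. return_pmf (a + v))) a)) \<le> ennreal (c ^ m)"
proof (induction m arbitrary: a)
  case (Suc m)
  let ?f = "\<lambda>a. bind_pmf p (\<lambda>v. return_pmf (a + v))"
  have "(\<integral>\<^sup>+x. ennreal (exp (l * (real_of_int x - real_of_int a - real (Suc m) * \<mu>))) \<partial>measure_pmf (iter_pmf (Suc m) ?f a)) =
    (\<integral>\<^sup>+v. \<integral>\<^sup>+x. ennreal (exp (l * (real_of_int x - real_of_int a - real (Suc m) * \<mu>))) \<partial>measure_pmf (iter_pmf m ?f (a + v)) \<partial>measure_pmf p)"
    by (simp add: bind_assoc_pmf bind_return_pmf)
  also have "\<dots> = (\<integral>\<^sup>+v. ennreal (exp (l * (real_of_int v - \<mu>))) *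
     (\<integral>\<^sup>+x. ennreal (exp (l * (real_of_int x - real_of_int (a + v) - real m * \<mu>))) \<partial>measure_pmf (iter_pmf m ?f (a + v))) \<partial>measure_pmf p)"
    by (intro nn_integral_cong, subst nn_integral_cmult[symmetric])
      (auto simp: ennreal_mult[symmetric] exp_add[symmetric] algebra_simps)
  also have "\<dots> \<le> (\<integral>\<^sup>+v. ennreal (exp (l * (real_of_int v - \<mu>))) * ennreal (c ^ m) \<partial>measure_pmf p)"
    by (intro nn_integral_mono mult_left_mono Suc.IH) auto
  also have "\<dots> = (\<integral>\<^sup>+v. ennreal (exp (l * (real_of_int v - \<mu>))) \<partial>measure_pmf p) * ennreal (c ^ m)"
    by (rule nn_integral_multc) auto
  also have "\<dots> \<le> ennreal c * ennreal (c ^ m)" by (intro mult_right_mono step) auto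
  finally show ?case using c by (simp add: ennreal_mult)
qed simp

text \<open>Chernoff's method: Markov's inequality for the exponential, with Hoeffding's lemma for a
  single sample. The sign \<open>sg\<close> treats both tails at once.\<close>

lemma iter_sum_deviation:
  fixes p :: "int pmf" and M :: real
  assumes M: "\<And>v. v \<in> set_pmf p \<Longrightarrow> \<bar>real_of_int v\<bar> \<le> M" "0 < M" and \<Delta>: "0 < \<Delta>" and m: "0 < m"
    and sg: "\<bar>sg\<bar> = 1"
    and \<mu>: "\<mu> = measure_pmf.expectation p real_of_int"
  shows "measure_pmf.prob (iter_pmf m (\<lambda>a. bind_pmf p (\<lambda>v. return_pmf (a + v))) 0)
     {x. sg * (real_of_int x - m * \<mu>) \<ge> m * \<Delta>} \<le> exp (- (m * \<Delta>\<^sup>2 / (2 * M\<^sup>2)))"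
proof -
  \<comment> \<open>This value minimises the exponent - l * \<Delta> + l^2 * M^2 / 2 per
    sample.\<close>
  define l where "l = \<Delta> / M\<^sup>2"
  have l: "l > 0" using M \<Delta> by (simp add: l_def)
  have E: "measure_pmf.expectation p (\<lambda>v. sg * real_of_int v) = sg * \<mu>"
    unfolding \<mu> by (rule Bochner_Integration.integral_mult_right_zero)
  interpret interval_bounded_random_variable "measure_pmf p" "\<lambda>v. sg * real_of_int v" "-M" M
  proof
    have "sg = 1 \<or> sg = -1" using sg by auto
    then show "AE x in measure_pmf p. sg * real_of_int x \<in> {- M..M}"
      using M by (auto simp: AE_measure_pmf_iff abs_le_iff) (smt (verit, best))+
  qed auto
  let ?q = "iter_pmf m (\<lambda>a. bind_pmf p (\<lambda>v. return_pmf (a + v))) 0"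
  have "(\<integral>\<^sup>+v. ennreal (exp (l * sg * (real_of_int v - \<mu>))) \<partial>measure_pmf p) \<le> ennreal (exp (l\<^sup>2 * (2 * M)\<^sup>2 / 8))"
    using Hoeffdings_lemma_nn_integral[OF l] unfolding E by (simp add: right_diff_distrib mult.assoc)
  from nn_integral_iter_sum[OF this exp_ge_zero, where m = m and a = 0]
  have I: "(\<integral>\<^sup>+x. ennreal (exp (l * sg * (real_of_int x - m * \<mu>))) \<partial>measure_pmf ?q) \<le> ennreal (exp (l\<^sup>2 * (2 * M)\<^sup>2 / 8) ^ m)"
    by (simp only: of_int_0 diff_0_right)
  let ?A = "{x. sg * (real_of_int x - m * \<mu>) \<ge> m * \<Delta>}"
  have "emeasure (measure_pmf ?q) ?A \<le> (\<integral>\<^sup>+x. ennreal (exp (- l * m * \<Delta>)) * ennreal (exp (l * sg * (real_of_int x - m * \<mu>))) \<partial>measure_pmf ?q)"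
  proof -
    have "emeasure (measure_pmf ?q) ?A = (\<integral>\<^sup>+x. indicator ?A x \<partial>measure_pmf ?q)" by simp
    also have "\<dots> \<le> (\<integral>\<^sup>+x. ennreal (exp (- l * m * \<Delta>)) * ennreal (exp (l * sg * (real_of_int x - m * \<mu>))) \<partial>measure_pmf ?q)"
    proof (intro nn_integral_mono)
      fix x
      show "indicator ?A x \<le> ennreal (exp (- l * m * \<Delta>)) * ennreal (exp (l * sg * (real_of_int x - m * \<mu>)))"
      proof (cases "x \<in> ?A")
        case True
        then have "l * (m * \<Delta>) \<le> l * (sg * (real_of_int x - m * \<mu>))" using l by (intro mult_left_mono) auto
        then have "1 \<le> exp (- l * m * \<Delta> + l * sg * (real_of_int x - m * \<mu>))" by (simp add: mult.assoc)
        then have "ennreal 1 \<le> ennreal (exp (- l * m * \<Delta>) * exp (l * sg * (real_of_int x - m * \<mu>)))"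
          unfolding exp_add by (intro ennreal_leI)
        then show ?thesis using True by (simp add: ennreal_mult)
      qed auto
    qed
    finally show ?thesis .
  qed
  also have "\<dots> = ennreal (exp (- l * m * \<Delta>)) * (\<integral>\<^sup>+x. ennreal (exp (l * sg * (real_of_int x - m * \<mu>))) \<partial>measure_pmf ?q)"
    by (rule nn_integral_cmult) auto
  also have "\<dots> \<le> ennreal (exp (- l * m * \<Delta>)) * ennreal (exp (l\<^sup>2 * (2 * M)\<^sup>2 / 8) ^ m)"
    by (intro mult_left_mono I) auto
  also have "\<dots> = ennreal (exp (- l * m * \<Delta> + m * (l\<^sup>2 * (2 * M)\<^sup>2 / 8)))"
    by (simp only: exp_add exp_of_nat_mult) (simp add: ennreal_mult)
  also have "- l * m * \<Delta> + m * (l\<^sup>2 * (2 * M)\<^sup>2 / 8) = - (m * \<Delta>\<^sup>2 / (2 * M\<^sup>2))"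
    using M by (simp add: l_def field_simps power2_eq_square)
  finally show ?thesis by (simp add: measure_pmf.emeasure_eq_measure)
qed

lemma iter_sum_concentration:
  fixes p :: "int pmf" and M :: real
  assumes "\<And>v. v \<in> set_pmf p \<Longrightarrow> \<bar>real_of_int v\<bar> \<le> M" "0 < M" "0 < \<Delta>" "0 < m"
  defines "\<mu> \<equiv> measure_pmf.expectation p real_of_int"
  shows "measure_pmf.prob (iter_pmf m (\<lambda>a. bind_pmf p (\<lambda>v. return_pmf (a + v))) 0)
     {x. \<bar>real_of_int x - m * \<mu>\<bar> \<ge> m * \<Delta>} \<le> 2 * exp (- (m * \<Delta>\<^sup>2 / (2 * M\<^sup>2)))"
proof -
  let ?P = "measure_pmf.prob (iter_pmf m (\<lambda>a. bind_pmf p (\<lambda>v. return_pmf (a + v))) 0)"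
  have "?P {x. \<bar>real_of_int x - m * \<mu>\<bar> \<ge> m * \<Delta>} \<le>
      ?P ({x. 1 * (real_of_int x - m * \<mu>) \<ge> m * \<Delta>} \<union> {x. (-1) * (real_of_int x - m * \<mu>) \<ge> m * \<Delta>})"
    by (intro measure_pmf.finite_measure_mono) auto
  also have "\<dots> \<le> ?P {x. 1 * (real_of_int x - m * \<mu>) \<ge> m * \<Delta>} + ?P {x. (-1) * (real_of_int x - m * \<mu>) \<ge> m * \<Delta>}"
    by (intro measure_Un_le) auto
  also have "\<dots> \<le> exp (- (m * \<Delta>\<^sup>2 / (2 * M\<^sup>2))) + exp (- (m * \<Delta>\<^sup>2 / (2 * M\<^sup>2)))"
    by (intro add_mono iter_sum_deviation assms) (auto simp: \<mu>_def)
  finally show ?thesis by simp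
qed

section \<open>Union bounds and expectations for composed distributions\<close>

lemma prob_bind_ge:
  assumes A: "measure_pmf.prob p A \<ge> 1 - x" and f: "\<And>a. a \<in> A \<Longrightarrow> measure_pmf.prob (f a) B \<ge> 1 - y"
    and y: "0 \<le> y"
  shows "measure_pmf.prob (bind_pmf p f) B \<ge> 1 - (x + y)"
proof -
  have int: "integrable (measure_pmf p) (\<lambda>a. measure_pmf.prob (f a) B)"
    by (rule measure_pmf.integrable_const_bound[where B = 1]) auto
  have iA: "integrable (measure_pmf p) (indicat_real A)"
    by (rule measure_pmf.integrable_const_bound[where B = 1]) (auto simp: indicator_def)
  have "measure_pmf.prob (bind_pmf p f) B = measure_pmf.expectation p (\<lambda>a. measure_pmf.prob (f a) B)"
    unfolding measure_pmf_bind
    by (subst measure_pmf.measure_bind[where N = "count_space UNIV"]) (auto simp: space_subprob_algebra intro: prob_space_imp_subprob_space measure_pmf.prob_space_axioms)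
  also have "\<dots> \<ge> measure_pmf.expectation p (\<lambda>a. indicator A a - y)"
  proof (rule integral_mono[OF _ int])
    show "integrable (measure_pmf p) (\<lambda>a. indicator A a - y)"
      using iA by (intro Bochner_Integration.integrable_diff) auto
    fix a
    show "indicator A a - y \<le> measure_pmf.prob (f a) B"
      using f[of a] y by (cases "a \<in> A") (auto intro: order_trans[OF _ measure_nonneg])
  qed
  also have "measure_pmf.expectation p (\<lambda>a. indicator A a - y) = measure_pmf.prob p A - y"
    using iA by (subst Bochner_Integration.integral_diff) auto
  finally show ?thesis using A by simp
qed

text \<open>Union bound along an iteration: if each pass breaks the invariant with probability at
  most \<delta>, the failure probabilities add up.\<close>

lemma prob_iter_ge:
  assumes step: "\<And>k x. k < m \<Longrightarrow> J k x \<Longrightarrow> measure_pmf.prob (f x) {y. J (Suc k) y} \<ge> 1 - \<delta>"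
    and x: "J 0 x" and \<delta>: "0 \<le> \<delta>"
  shows "measure_pmf.prob (iter_pmf m f x) {y. J m y} \<ge> 1 - m * \<delta>"
proof -
  have "k + d = m \<Longrightarrow> J k x \<Longrightarrow> measure_pmf.prob (iter_pmf d f x) {y. J m y} \<ge> 1 - d * \<delta>" for k d x
  proof (induction d arbitrary: k x)
    case (Suc d)
    have "measure_pmf.prob (bind_pmf (f x) (iter_pmf d f)) {y. J m y} \<ge> 1 - (\<delta> + d * \<delta>)"
    proof (rule prob_bind_ge[OF step])
      fix y assume "y \<in> {y. J (Suc k) y}"
      then show "1 - d * \<delta> \<le> measure_pmf.prob (iter_pmf d f y) {y. J m y}"
        using Suc.IH[of "Suc k" y] Suc.prems by auto
    qed (use Suc.prems \<delta> in auto)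
    then show ?case by (simp add: algebra_simps)
  qed simp
  from this[of 0 m x] x show ?thesis by simp
qed

lemma expectation_bind_finite:
  fixes h :: "'b \<Rightarrow> real"
  assumes "finite (set_pmf p)" "\<And>x. finite (set_pmf (f x))"
  shows "measure_pmf.expectation (bind_pmf p f) h = measure_pmf.expectation p (\<lambda>x. measure_pmf.expectation (f x) h)"
  using assms by (subst pmf_expectation_bind[where A = "set_pmf p"])
    (auto simp: integral_measure_pmf[of "set_pmf p"])

section \<open>Perturbation and rounding\<close>

text \<open>The row sum s is at most n \<le> N, so the new value is an average of the old ones with
  nonnegative weights N - s and \<open>a x j\<close>, divided by N. Hence the maximum norm does not
  grow.\<close>

lemma walk_op_bounded:
  assumes a: "\<And>j. j < n \<Longrightarrow> 0 \<le> a x j \<and> a x j \<le> 1" and h: "\<And>j. j < n \<Longrightarrow> \<bar>h j\<bar> \<le> b"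
    and x: "x < n" and N: "real n \<le> N"
  shows "\<bar>walk_op N n a h x\<bar> \<le> b"
proof -
  have N0: "N > 0" using x N by linarith
  define s where "s = (\<Sum>j<n. a x j)"
  have "s \<le> (\<Sum>j<n. 1)" unfolding s_def by (intro sum_mono) (use a in auto)
  then have s: "0 \<le> s" "s \<le> N" using N a by (auto simp: s_def intro: sum_nonneg)
  have "N * walk_op N n a h x = N * h x - (\<Sum>j<n. a x j * (h x - h j))"
    using N0 by (simp add: walk_op_def right_diff_distrib)
  also have "(\<Sum>j<n. a x j * (h x - h j)) = s * h x - (\<Sum>j<n. a x j * h j)"
    by (simp add: s_def right_diff_distrib sum_subtractf sum_distrib_right)
  finally have "N * walk_op N n a h x = (N - s) * h x + (\<Sum>j<n. a x j * h j)"
    by (simp add: algebra_simps)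
  also have "\<bar>(N - s) * h x + (\<Sum>j<n. a x j * h j)\<bar> \<le> (N - s) * b + (\<Sum>j<n. a x j * b)"
  proof (rule order_trans[OF abs_triangle_ineq], rule add_mono)
    show "\<bar>(N - s) * h x\<bar> \<le> (N - s) * b" using s h[OF x] by (simp add: abs_mult mult_left_mono)
    show "\<bar>\<Sum>j<n. a x j * h j\<bar> \<le> (\<Sum>j<n. a x j * b)"
      by (rule order_trans[OF sum_abs], rule sum_mono) (use a h in \<open>auto simp: abs_mult intro!: mult_left_mono\<close>)
  qed
  also have "\<dots> = N * b" by (simp add: s_def sum_distrib_right[symmetric] left_diff_distrib)
  finally show ?thesis using N0 by (simp add: abs_mult)
qed

lemma walk_op_iterate_bounded:
  assumes "\<And>x j. x < n \<Longrightarrow> j < n \<Longrightarrow> 0 \<le> a x j \<and> a x j \<le> 1" and "\<And>x. x < n \<Longrightarrow> \<bar>h x\<bar> \<le> b"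
    and "real n \<le> N" and "x < n"
  shows "\<bar>(walk_op N n a ^^ t) h x\<bar> \<le> b"
  using assms(4)
proof (induction t arbitrary: x)
  case (Suc t)
  have "\<bar>walk_op N n a ((walk_op N n a ^^ t) h) x\<bar> \<le> b"
    by (rule walk_op_bounded) (use assms(1)[OF Suc.prems] Suc.IH Suc.prems assms(3) in auto)
  then show ?case by simp
qed (simp add: assms(2))

text \<open>In each step the accumulated error passes through an averaging operator unchanged in
  size, and replacing the operator acts on an iterate still bounded by \<open>b\<close>, which adds
  at most 2 * \<delta> * b. So the error is linear in t.\<close>

lemma walk_op_perturb:
  assumes a: "\<And>x j. x < n \<Longrightarrow> j < n \<Longrightarrow> 0 \<le> a x j \<and> a x j \<le> 1"
    and a': "\<And>x j. x < n \<Longrightarrow> j < n \<Longrightarrow> 0 \<le> a' x j \<and> a' x j \<le> 1"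
    and diff: "\<And>x j. x < n \<Longrightarrow> j < n \<Longrightarrow> \<bar>a x j - a' x j\<bar> \<le> \<delta>"
    and F: "\<And>x. x < n \<Longrightarrow> \<bar>F x - f x\<bar> \<le> \<eta>" and f: "\<And>x. x < n \<Longrightarrow> \<bar>f x\<bar> \<le> b"
    and N: "real n \<le> N" and x: "x < n"
  shows "\<bar>(walk_op N n a ^^ t) F x - (walk_op N n a' ^^ t) f x\<bar> \<le> \<eta> + 2 * t * \<delta> * b"
  using x
proof (induction t arbitrary: x)
  case 0
  then show ?case using F by simp
next
  case (Suc t)
  have N0: "N > 0" using Suc.prems N by linarith
  have b0: "0 \<le> b" "0 \<le> \<delta>" using f[OF Suc.prems] diff[OF Suc.prems Suc.prems] by linarith+
  let ?g = "(walk_op N n a' ^^ t) f" and ?G = "(walk_op N n a ^^ t) F"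
  have g: "\<bar>?g y\<bar> \<le> b" if "y < n" for y
    by (rule walk_op_iterate_bounded[OF a' f N that])
  have lin: "walk_op N n a (\<lambda>y. ?G y - ?g y) x = walk_op N n a ?G x - walk_op N n a ?g x"
    by (simp add: walk_op_def right_diff_distrib sum_subtractf diff_divide_distrib)
  have A: "\<bar>walk_op N n a (\<lambda>y. ?G y - ?g y) x\<bar> \<le> \<eta> + 2 * t * \<delta> * b"
    by (rule walk_op_bounded) (use a Suc N in auto)
  have B: "\<bar>walk_op N n a ?g x - walk_op N n a' ?g x\<bar> \<le> 2 * \<delta> * b"
  proof -
    have "walk_op N n a ?g x - walk_op N n a' ?g x = (\<Sum>j<n. (a' x j - a x j) * (?g x - ?g j)) / N"
      by (simp add: walk_op_def algebra_simps sum_subtractf sum.distrib add_divide_distrib diff_divide_distrib)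
    also have "\<bar>\<dots>\<bar> \<le> (\<Sum>j<n. \<delta> * (2 * b)) / N"
      unfolding abs_divide using N0
    proof (intro frac_le order_trans[OF sum_abs] sum_mono sum_nonneg)
      fix j assume "j \<in> {..<n}"
      then have j: "j < n" by simp
      have "\<bar>?g x - ?g j\<bar> \<le> 2 * b" using g[OF j] g[OF Suc.prems] by linarith
      moreover have "\<bar>a' x j - a x j\<bar> \<le> \<delta>" using diff[OF Suc.prems j] by linarith
      ultimately show "\<bar>(a' x j - a x j) * (?g x - ?g j)\<bar> \<le> \<delta> * (2 * b)"
        unfolding abs_mult using b0 by (intro mult_mono) auto
    qed (use b0 in auto)
    also have "\<dots> = (n / N) * (2 * \<delta> * b)" by simp
    also have "\<dots> \<le> 1 * (2 * \<delta> * b)" using N N0 b0 by (intro mult_right_mono) auto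
    finally show ?thesis by simp
  qed
  have "\<eta> + 2 * real (Suc t) * \<delta> * b = (\<eta> + 2 * t * \<delta> * b) + 2 * \<delta> * b"
    by (simp add: algebra_simps)
  then have "\<bar>walk_op N n a ?G x - walk_op N n a' ?g x\<bar> \<le> \<eta> + 2 * real (Suc t) * \<delta> * b"
    using A[unfolded lin] B by linarith
  then show ?case by simp
qed

section \<open>Rounding errors of quotients and square roots\<close>

text \<open>The accepted u are those below z = K * p / q, and there are \<lceil>z\<rceil> of them;
  the granularity of the threshold therefore costs at most 1 / K.\<close>

lemma card_threshold:
  fixes K :: nat and p q :: int
  assumes K: "0 < K" and q: "0 < q" and p: "0 \<le> p" "p \<le> q"
  shows "\<bar>card {u. u < K \<and> int u * q < int K * p} / K - p / q\<bar> \<le> 1 / K"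
proof -
  define z where "z = real K * (p / q)"
  have pq: "real_of_int p / q \<le> 1" "0 \<le> real_of_int p / q" using p q by simp_all
  have z: "0 \<le> z" "z \<le> K"
    unfolding z_def by (rule mult_nonneg_nonneg[OF of_nat_0_le_iff pq(2)], rule mult_left_le[OF pq(1) of_nat_0_le_iff])
  define m where "m = nat \<lceil>z\<rceil>"
  have iff: "int u * q < int K * p \<longleftrightarrow> u < m" for u
  proof -
    have "int u * q < int K * p \<longleftrightarrow> real_of_int (int u * q) < real_of_int (int K * p)"
      by (rule of_int_less_iff[symmetric])
    also have "\<dots> \<longleftrightarrow> real u < z" using q by (simp add: z_def pos_less_divide_eq)
    also have "\<dots> \<longleftrightarrow> u < m" unfolding m_def by (simp add: less_ceiling_iff zless_nat_eq_int_zless)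
    finally show ?thesis .
  qed
  have "m \<le> K" unfolding m_def using z by (simp add: nat_le_iff ceiling_le_iff)
  then have "{u. u < K \<and> u < m} = {..<m}" by auto
  then have c: "card {u. u < K \<and> int u * q < int K * p} = m" by (simp only: iff card_lessThan)
  have "\<bar>real m - z\<bar> \<le> 1" unfolding m_def using z by linarith
  then have "\<bar>real m - z\<bar> / K \<le> 1 / K" by (rule divide_right_mono) simp
  moreover have "real m / K - p / q = (real m - z) / K"
    using K by (simp add: z_def diff_divide_distrib)
  ultimately show ?thesis unfolding c by (simp only: abs_divide abs_of_nat)
qed

text \<open>Subadditivity of the square root. A Lipschitz bound would fail near 0, and the degree
  ratio is 0 when the starting vertex is isolated.\<close>

lemma sqrt_diff_le: "0 \<le> a \<Longrightarrow> 0 \<le> b \<Longrightarrow> \<bar>sqrt a - sqrt b\<bar> \<le> sqrt \<bar>a - b\<bar>"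
proof -
  have *: "sqrt a \<le> sqrt b + sqrt \<bar>a - b\<bar>" if "0 \<le> a" "0 \<le> b" for a b :: real
  proof -
    have "sqrt a \<le> sqrt (b + \<bar>a - b\<bar>)" by simp
    also have "\<dots> \<le> sqrt b + sqrt \<bar>a - b\<bar>" using that by (intro sqrt_add_le_add_sqrt) auto
    finally show ?thesis .
  qed
  assume "0 \<le> a" "0 \<le> b"
  then show ?thesis using *[of a b] *[of b a] by (simp add: abs_minus_commute)
qed

text \<open>For \<open>q = 0\<close> both quotients are zero.\<close>

lemma floor_sqrt_ratio:
  fixes K :: nat and p q :: int
  assumes K: "0 < K" and q: "0 \<le> q" and p: "0 \<le> p"
  shows "\<bar>floor_sqrt (nat (int K * int K * p div q)) / K - sqrt (p / q)\<bar> \<le> 1 / K"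
proof -
  define z where "z = real K * real K * (p / q)"
  define s where "s = floor_sqrt (nat (int K * int K * p div q))"
  have z0: "0 \<le> z" using p q by (simp add: z_def)
  have "int K * int K * p div q = \<lfloor>real_of_int (int K * int K * p) / real_of_int q\<rfloor>"
    by (rule floor_divide_of_int_eq[symmetric])
  then have X: "nat (int K * int K * p div q) = nat \<lfloor>z\<rfloor>" by (simp add: z_def)
  have "s\<^sup>2 \<le> nat \<lfloor>z\<rfloor>" unfolding s_def X by (rule floor_sqrt_power2_le)
  then have "real (s\<^sup>2) \<le> real (nat \<lfloor>z\<rfloor>)" by (simp only: of_nat_le_iff)
  then have "real (s\<^sup>2) \<le> z" using z0 of_int_floor_le[of z] by (simp del: of_int_floor_le)
  then have lower: "real s \<le> sqrt z" using real_le_rsqrt by auto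
  have "nat \<lfloor>z\<rfloor> < (Suc s)\<^sup>2" unfolding s_def X by (rule Suc_floor_sqrt_power2_gt)
  then have "nat \<lfloor>z\<rfloor> + 1 \<le> (Suc s)\<^sup>2" by simp
  then have "real (nat \<lfloor>z\<rfloor> + 1) \<le> real ((Suc s)\<^sup>2)" by (simp only: of_nat_le_iff)
  moreover have "z \<le> real (nat \<lfloor>z\<rfloor> + 1)" using z0 by simp linarith
  ultimately have "z \<le> real ((Suc s)\<^sup>2)" by linarith
  then have "z \<le> (real s + 1)\<^sup>2" by (simp add: add.commute)
  then have upper: "sqrt z \<le> real s + 1" using real_le_lsqrt by auto
  have "sqrt z = K * sqrt (p / q)" unfolding z_def real_sqrt_mult by simp
  then have "\<bar>real s - K * sqrt (p / q)\<bar> / K \<le> 1 / K" using lower upper by (intro divide_right_mono) auto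
  moreover have "s / K - sqrt (p / q) = (real s - K * sqrt (p / q)) / K"
    using K by (simp add: diff_divide_distrib)
  ultimately show ?thesis unfolding s_def[symmetric] by (simp only: abs_divide abs_of_nat)
qed

text \<open>The splitting (w' - w) / d + (w' / d') * ((d - d') / d) keeps only the exact
  \<open>d\<close> as a bare denominator. The ratio w' / d' is at most 1 however small d' is, and 0
  when d' = 0.\<close>

lemma rational_close:
  fixes w' d' w d \<eta> \<nu> lo :: real
  assumes w: "0 \<le> w" "w \<le> d" and w': "0 \<le> w'" "w' \<le> d'" and lo: "0 < lo" "lo \<le> d"
    and dw: "\<bar>w' - w\<bar> \<le> \<eta>" and dd: "\<bar>d' - d\<bar> \<le> \<nu>"
  shows "\<bar>w' / d' - w / d\<bar> \<le> (\<eta> + \<nu>) / lo"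
proof -
  have d: "d > 0" using lo by simp
  have "w' / d' - w / d = (w' - w) / d + (w' / d') * ((d - d') / d)"
  proof (cases "d' = 0")
    case True
    then show ?thesis using w' by simp
  next
    case False
    then show ?thesis using d by (simp add: field_simps)
  qed
  also have "\<bar>\<dots>\<bar> \<le> \<bar>w' - w\<bar> / d + \<bar>w' / d'\<bar> * (\<bar>d - d'\<bar> / d)"
    using d by (intro order_trans[OF abs_triangle_ineq]) (simp add: abs_mult abs_divide)
  also have "\<dots> \<le> \<eta> / d + 1 * (\<nu> / d)"
    using w' d dw dd by (intro add_mono mult_mono divide_right_mono) (auto simp: divide_le_eq_1 abs_minus_commute)
  also have "\<dots> = (\<eta> + \<nu>) / d" by (simp add: add_divide_distrib)
  also have "\<dots> \<le> (\<eta> + \<nu>) / lo" using lo dw dd by (intro divide_left_mono) auto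
  finally show ?thesis .
qed

text \<open>Here numerator and denominator belong to different vertices and their ratio may exceed
  1, so q' is kept away from 0 instead: 2 * \<nu> \<le> lo gives q' \<ge> lo / 2.\<close>

lemma ratio_close:
  fixes p' q' p q lo D \<nu> :: real
  assumes p: "0 \<le> p" "p \<le> D" "\<bar>p' - p\<bar> \<le> \<nu>" and q: "lo \<le> q" "\<bar>q' - q\<bar> \<le> \<nu>" and lo: "0 < lo" "2 * \<nu> \<le> lo"
  shows "\<bar>p' / q' - p / q\<bar> \<le> 2 * \<nu> / lo * (1 + D / lo)"
proof -
  have q': "lo / 2 \<le> q'" using q lo by linarith
  then have pos: "0 < q'" "0 < q" using q lo by linarith+
  have \<nu>: "0 \<le> \<nu>" using p by linarith
  have "p' / q' - p / q = (p' - p) / q' + p / q * ((q - q') / q')" using pos by (simp add: field_simps)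
  also have "\<bar>\<dots>\<bar> \<le> \<bar>p' - p\<bar> / q' + p / q * (\<bar>q - q'\<bar> / q')"
    using pos p by (intro order_trans[OF abs_triangle_ineq]) (simp add: abs_mult abs_divide)
  also have "\<dots> \<le> \<nu> / (lo / 2) + D / lo * (\<nu> / (lo / 2))"
    using p q q' lo pos \<nu> by (intro add_mono mult_mono frac_le) (auto simp: abs_minus_commute)
  also have "\<dots> = 2 * \<nu> / lo * (1 + D / lo)" using lo by (simp add: field_simps)
  finally show ?thesis .
qed

section \<open>Expectation and bias of the rounded walk\<close>

text \<open>\<open>precision\<close> says that the rounding error n / 2^k of a degree is at most
  half the least positive degree, the condition of \<open>ratio_close\<close>.\<close>

locale laplacian_machine = walk_machine I B n e g k T R oe + laplacian_system "graph I" n lo D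
  for I :: problem and B :: int and n e g k T R oe :: nat and lo D :: real +
  assumes b: "rhs I \<in> eigen_image (laplacian (graph I))" "rhs I \<bullet> rhs I = 1"
    and D_pos: "0 < D" and precision: "2 * real n \<le> 2 ^ k * lo"
begin

text \<open>The exact probability with which the machine accepts the proposal \<open>j\<close>,
  against the ideal \<open>trans_prob\<close>.\<close>

definition accept :: "nat \<Rightarrow> nat \<Rightarrow> real" where
  "accept x j = card {u. u < 2 ^ k \<and> int u * deg_int x < 2 ^ k * wt_int x j} / 2 ^ k"

lemma accept_bounds: "0 \<le> accept x j" "accept x j \<le> 1"
proof -
  have "card {u. u < 2 ^ k \<and> int u * deg_int x < 2 ^ k * wt_int x j} \<le> card {..<2 ^ k :: nat}"
    by (rule card_mono) auto
  then have "real (card {u. u < 2 ^ k \<and> int u * deg_int x < 2 ^ k * wt_int x j}) \<le> real (2 ^ k)"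
    unfolding of_nat_le_iff card_lessThan .
  then show "0 \<le> accept x j" "accept x j \<le> 1" by (simp_all add: accept_def)
qed

lemma accept_outside: "j \<ge> n \<Longrightarrow> accept x j = 0"
proof -
  assume "j \<ge> n"
  moreover have "\<not> int u * deg_int x < 0" for u using deg_int_nonneg[of x] by (simp add: not_less)
  ultimately show ?thesis by (simp add: accept_def wt_int_outside)
qed

lemma set_unif: "set_pmf (unif m) = {..<2 ^ m}"
  by (simp add: unif_def lessThan_empty_iff)

lemma expectation_unif: "measure_pmf.expectation (unif m) h = (\<Sum>u<2 ^ m. h u) / 2 ^ m" for h :: "nat \<Rightarrow> real"
  unfolding unif_def by (subst integral_pmf_of_set) (auto simp: lessThan_empty_iff)

lemma finite_walk_step: "finite (set_pmf (walk_step x))"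
  by (simp add: walk_step_def set_unif)

lemma set_walk_step: "y \<in> set_pmf (walk_step x) \<Longrightarrow> x < n \<Longrightarrow> y < n"
proof -
  assume y: "y \<in> set_pmf (walk_step x)" and x: "x < n"
  then obtain j u where *: "y = (if int u * deg_int x < 2 ^ k * wt_int x j then j else x)"
    by (auto simp: walk_step_def)
  have "0 \<le> int u * deg_int x" using deg_int_nonneg[of x] by simp
  then have "j < n" if "int u * deg_int x < 2 ^ k * wt_int x j"
    using wt_int_outside[of j x] that by (cases "j < n") auto
  then show ?thesis using * x by auto
qed

lemma expectation_walk_step:
  "measure_pmf.expectation (walk_step x) h = walk_op (2 ^ e) n accept h x"
proof -
  let ?P = "\<lambda>u j. int u * deg_int x < 2 ^ k * wt_int x j"
  have inner: "measure_pmf.expectation (bind_pmf (unif k) (\<lambda>u. return_pmf (if ?P u j then j else x))) h =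
      h x - accept x j * (h x - h j)" for j
  proof -
    have "measure_pmf.expectation (bind_pmf (unif k) (\<lambda>u. return_pmf (if ?P u j then j else x))) h =
        (\<Sum>u<2 ^ k. h (if ?P u j then j else x)) / 2 ^ k"
      by (subst expectation_bind_finite) (auto simp: set_unif expectation_unif)
    also have "(\<Sum>u<2 ^ k. h (if ?P u j then j else x)) = (\<Sum>u<2 ^ k. h x - (if ?P u j then h x - h j else 0))"
      by (rule sum.cong) auto
    also have "\<dots> = 2 ^ k * h x - (\<Sum>u<2 ^ k. if ?P u j then h x - h j else 0)"
      by (simp add: sum_subtractf)
    also have "(\<Sum>u<2 ^ k. if ?P u j then h x - h j else 0) = (\<Sum>u\<in>{u. u < 2 ^ k \<and> ?P u j}. h x - h j)"
      by (subst sum.inter_filter[symmetric]) (auto intro: sum.cong)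
    also have "\<dots> = 2 ^ k * (accept x j * (h x - h j))" by (simp add: accept_def)
    finally show ?thesis by (simp add: right_diff_distrib diff_divide_distrib)
  qed
  have "measure_pmf.expectation (walk_step x) h = (\<Sum>j<2 ^ e. h x - accept x j * (h x - h j)) / 2 ^ e"
    unfolding walk_step_def
    by (subst expectation_bind_finite) (auto simp: set_unif expectation_unif inner)
  also have "(\<Sum>j<2 ^ e. h x - accept x j * (h x - h j)) = 2 ^ e * h x - (\<Sum>j<2 ^ e. accept x j * (h x - h j))"
    by (simp add: sum_subtractf)
  \<comment> \<open>Proposals from n on are never accepted, so the sum over all 2^e proposals
    shrinks to the vertices while the divisor remains 2^e.\<close>
  also have "(\<Sum>j<2 ^ e. accept x j * (h x - h j)) = (\<Sum>j<n. accept x j * (h x - h j))"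
    by (rule sum.mono_neutral_right) (use size in \<open>auto simp: accept_outside\<close>)
  finally show ?thesis by (simp add: walk_op_def diff_divide_distrib)
qed

lemma finite_sum_step: "finite (set_pmf (sum_step i xv))"
  by (cases xv) (simp add: sum_step_def finite_walk_step)

lemma walk_op_add_sum:
  "walk_op N n a (\<lambda>y. c + (\<Sum>t<m. h t y)) x = c + (\<Sum>t<m. walk_op N n a (h t) x)"
proof -
  have "(\<Sum>j<n. a x j * ((\<Sum>t<m. h t x) - (\<Sum>t<m. h t j))) = (\<Sum>t<m. \<Sum>j<n. a x j * (h t x - h t j))"
    by (subst sum.swap) (simp add: sum_subtractf[symmetric] sum_distrib_left)
  then show ?thesis
    by (simp add: walk_op_def sum_subtractf sum_divide_distrib[symmetric])
qed

text \<open>Markov property: conditioning on the first move applies the walk operator once to each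
  term of the remaining sum, which shifts the sum by one.\<close>

lemma expectation_iter_sum_step:
  "measure_pmf.expectation (iter_pmf m (sum_step i) (x, v)) (\<lambda>yv. real_of_int (snd yv)) =
     real_of_int v + (\<Sum>t<m. (walk_op (2 ^ e) n accept ^^ t) (\<lambda>y. real_of_int (contrib i y)) x)"
proof (induction m arbitrary: x v)
  case (Suc m)
  let ?c = "\<lambda>y. real_of_int (contrib i y)" and ?W = "walk_op (2 ^ e) n accept"
  have "measure_pmf.expectation (iter_pmf (Suc m) (sum_step i) (x, v)) (\<lambda>yv. real_of_int (snd yv)) =
     measure_pmf.expectation (bind_pmf (walk_step x) (\<lambda>y. iter_pmf m (sum_step i) (y, v + contrib i x))) (\<lambda>yv. real_of_int (snd yv))"
    by (simp add: sum_step_def bind_assoc_pmf bind_return_pmf)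
  also have "\<dots> = measure_pmf.expectation (walk_step x) (\<lambda>y. (real_of_int v + ?c x) + (\<Sum>t<m. (?W ^^ t) ?c y))"
    by (subst expectation_bind_finite) (simp_all add: finite_walk_step finite_iter_pmf finite_sum_step Suc.IH)
  also have "\<dots> = (real_of_int v + ?c x) + (\<Sum>t<m. ?W ((?W ^^ t) ?c) x)"
    unfolding expectation_walk_step by (rule walk_op_add_sum)
  also have "\<dots> = real_of_int v + (\<Sum>t<Suc m. (?W ^^ t) ?c x)"
    by (subst sum.lessThan_Suc_shift) simp
  finally show ?case .
qed simp

lemma expectation_run:
  "measure_pmf.expectation (run_pmf i) real_of_int = (\<Sum>t<T. (walk_op (2 ^ e) n accept ^^ t) (\<lambda>y. real_of_int (contrib i y)) i)"
  using expectation_iter_sum_step[of T i i 0] by (simp add: run_pmf_def)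

lemma set_iter_sum_step:
  assumes FB: "\<And>x. x < n \<Longrightarrow> \<bar>contrib i x\<bar> \<le> FB"
  shows "(y, v') \<in> set_pmf (iter_pmf m (sum_step i) (x, v)) \<Longrightarrow> x < n \<Longrightarrow> \<bar>v'\<bar> \<le> \<bar>v\<bar> + int m * FB"
proof (induction m arbitrary: x v)
  case (Suc m)
  then obtain z where z: "z \<in> set_pmf (walk_step x)" "(y, v') \<in> set_pmf (iter_pmf m (sum_step i) (z, v + contrib i x))"
    by (auto simp: sum_step_def)
  have "\<bar>v'\<bar> \<le> \<bar>v + contrib i x\<bar> + int m * FB"
    using Suc.IH[OF z(2)] set_walk_step[OF z(1) Suc.prems(2)] by simp
  then show ?case using FB[OF Suc.prems(2)] by (simp add: algebra_simps)
qed simp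

lemma set_run_pmf:
  assumes "\<And>x. x < n \<Longrightarrow> \<bar>contrib i x\<bar> \<le> FB" "i < n" "v \<in> set_pmf (run_pmf i)"
  shows "\<bar>v\<bar> \<le> int T * FB"
proof -
  obtain y where "(y, v) \<in> set_pmf (iter_pmf T (sum_step i) (i, 0))"
    using assms(3) by (auto simp: run_pmf_def)
  from set_iter_sum_step[OF assms(1) this assms(2)] show ?thesis by simp
qed

lemma wt_int_close: "\<bar>wt_int i j / 2 ^ k - w i j\<bar> \<le> 1 / 2 ^ k"
proof -
  have "\<bar>real_of_int (wt_int i j) - 2 ^ k * w i j\<bar> \<le> 1" unfolding wt_int_def by linarith
  then have "\<bar>real_of_int (wt_int i j) - 2 ^ k * w i j\<bar> / 2 ^ k \<le> 1 / 2 ^ k" by (intro divide_right_mono) auto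
  moreover have "wt_int i j / 2 ^ k - w i j = (real_of_int (wt_int i j) - 2 ^ k * w i j) / 2 ^ k"
    by (simp add: diff_divide_distrib)
  ultimately show ?thesis by (simp add: abs_divide)
qed

lemma deg_int_close: "\<bar>deg_int i / 2 ^ k - d i\<bar> \<le> n / 2 ^ k"
proof -
  have "deg_int i / 2 ^ k - d i = (\<Sum>j<n. wt_int i j / 2 ^ k - w i j)"
    by (simp add: deg_int_def d_eq sum_subtractf sum_divide_distrib)
  also have "\<bar>\<dots>\<bar> \<le> (\<Sum>j<n. 1 / 2 ^ k)"
    by (rule order_trans[OF sum_abs], rule sum_mono) (rule wt_int_close)
  finally show ?thesis by simp
qed

lemma deg_int_isolated: "d i = 0 \<Longrightarrow> deg_int i = 0"
  by (simp add: deg_int_def wt_int_def w_isolated)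

lemma trans_prob_bounds: "0 \<le> trans_prob x j \<and> trans_prob x j \<le> 1"
  using w_nonneg[of x j] w_le_d[of x j] d_nonneg[of x] by (auto simp: trans_prob_def divide_le_eq_1)

text \<open>The first term is the granularity of the threshold, the second the effect of rounding
  the weight (by at most 1 / 2^k) and the degree (by at most n / 2^k).\<close>

lemma accept_close: "\<bar>accept x j - trans_prob x j\<bar> \<le> 1 / 2 ^ k + (1 + n) / (2 ^ k * lo)"
proof (cases "d x = 0")
  case True
  then have "wt_int x j = 0" by (simp add: wt_int_def w_isolated)
  then have "accept x j = 0" using True by (simp add: accept_def deg_int_isolated)
  then show ?thesis using True lo by (simp add: trans_prob_def)
next
  case False
  then have d: "lo \<le> d x" using d_cases[of x] by simp
  have "\<bar>accept x j - wt_int x j / deg_int x\<bar> \<le> 1 / 2 ^ k"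
  proof (cases "deg_int x = 0")
    case True
    then show ?thesis using wt_int_nonneg[of x j] wt_int_le_deg[of x j] by (simp add: accept_def)
  next
    case False
    then have "0 < deg_int x" using deg_int_nonneg[of x] by simp
    from card_threshold[of "2 ^ k" "deg_int x" "wt_int x j", OF _ this wt_int_nonneg wt_int_le_deg]
    show ?thesis by (simp add: accept_def)
  qed
  moreover have "\<bar>wt_int x j / deg_int x - w x j / d x\<bar> \<le> (1 + n) / (2 ^ k * lo)"
  proof -
    have "\<bar>(wt_int x j / 2 ^ k) / (deg_int x / 2 ^ k) - w x j / d x\<bar> \<le> (1 / 2 ^ k + n / 2 ^ k) / lo"
      by (rule rational_close) (use w_nonneg w_le_d wt_int_nonneg[of x j] wt_int_le_deg[of x j] lo d wt_int_close deg_int_close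
          in \<open>auto simp: divide_right_mono\<close>)
    then show ?thesis by (simp add: add_divide_distrib[symmetric])
  qed
  ultimately show ?thesis unfolding trans_prob_def by linarith
qed

lemma rhs_carrier: "rhs I \<in> carrier_vec n"
  using eigen_image_carrier[OF laplacian_carrier b(1)] .

lemma rhs_le_1: "\<bar>rhs_entry I (int x)\<bar> \<le> 1"
proof (cases "x < n")
  case True
  have "(rhs I $ x)\<^sup>2 \<le> (\<Sum>i<n. (rhs I $ i)\<^sup>2)" by (rule member_le_sum) (use True in auto)
  also have "\<dots> = 1" using b(2) rhs_carrier by (simp add: scalar_prod_sum[of _ n] power2_eq_square)
  finally show ?thesis using True rhs_carrier by (simp add: rhs_entry_def abs_square_le_1)
qed (use rhs_carrier in \<open>simp add: rhs_entry_def\<close>)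

lemma fixed_rhs_bound: "\<bar>fixed_point (rhs_entry I (int x)) (int k)\<bar> \<le> 2 ^ k"
proof -
  define r where "r = rhs_entry I (int x)"
  have "-1 \<le> r" "r \<le> 1" using rhs_le_1[of x] by (auto simp: r_def abs_le_iff)
  then have "2 ^ k * (-1) \<le> 2 ^ k * r" "2 ^ k * r \<le> 2 ^ k * 1" by (intro mult_left_mono; simp)+
  then have "\<lfloor>2 ^ k * r\<rfloor> \<le> 2 ^ k" "- (2 ^ k) \<le> \<lfloor>2 ^ k * r\<rfloor>"
    by (simp_all add: le_floor_iff floor_le_iff order.strict_trans1[OF _ less_add_one])
  then show ?thesis by (simp add: fixed_point_def r_def abs_le_iff)
qed

lemma scaled_start_bound: "i < n \<Longrightarrow> x < n \<Longrightarrow> \<bar>sqrt (d i) * start (rhs I) x\<bar> \<le> sqrt (D / lo)"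
proof (cases "d x = 0")
  case False
  assume i: "i < n" and x: "x < n"
  have "lo \<le> d x" using False d_cases[of x] by simp
  then have "d i / d x \<le> D / lo" using D[OF i] d_nonneg[of i] lo D_pos by (intro frac_le) auto
  then have "sqrt (d i) / sqrt (d x) \<le> sqrt (D / lo)" by (simp flip: real_sqrt_divide)
  moreover have "\<bar>rhs I $ x\<bar> \<le> 1" using rhs_le_1[of x] x rhs_carrier by (simp add: rhs_entry_def)
  ultimately have "sqrt (d i) / sqrt (d x) * \<bar>rhs I $ x\<bar> \<le> sqrt (D / lo) * 1"
    using d_nonneg D_pos lo by (intro mult_mono) auto
  then show ?thesis using d_nonneg[of i] d_nonneg[of x] by (simp add: start_def abs_mult)
qed (use D_pos lo in \<open>simp add: start_def\<close>)

text \<open>The terms are the error of the integer square root, the error of the rounded degree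
  ratio passed through \<open>sqrt_diff_le\<close>, and the error of the rounded right-hand side,
  magnified by at most sqrt (D / lo).\<close>

lemma contrib_close:
  assumes i: "i < n" and x: "x < n"
  shows "\<bar>contrib i x / (2 ^ k * 2 ^ k) - sqrt (d i) * start (rhs I) x\<bar>
     \<le> 1 / 2 ^ k + sqrt (2 * n / (2 ^ k * lo) * (1 + D / lo)) + sqrt (D / lo) / 2 ^ k"
proof (cases "d x = 0")
  case True
  then show ?thesis using D_pos lo by (simp add: contrib_def start_def deg_int_isolated)
next
  case False
  then have dx: "lo \<le> d x" using d_cases[of x] by simp
  define s where "s = real (floor_sqrt (nat (2 ^ k * 2 ^ k * deg_int i div deg_int x))) / 2 ^ k"
  define r where "r = sqrt (d i / d x)"
  define \<beta> where "\<beta> = rhs_entry I (int x)"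
  define \<beta>' where "\<beta>' = fixed_point \<beta> (int k) / 2 ^ k"
  have c: "contrib i x / (2 ^ k * 2 ^ k) = s * \<beta>'" by (simp add: contrib_def s_def \<beta>'_def \<beta>_def)
  have f: "sqrt (d i) * start (rhs I) x = r * \<beta>"
    using x rhs_carrier by (simp add: start_def r_def \<beta>_def rhs_entry_def real_sqrt_divide)
  have "\<bar>s - sqrt (deg_int i / deg_int x)\<bar> \<le> 1 / 2 ^ k"
    using floor_sqrt_ratio[of "2 ^ k" "deg_int x" "deg_int i"] deg_int_nonneg by (simp add: s_def)
  moreover have "\<bar>sqrt (deg_int i / deg_int x) - r\<bar> \<le> sqrt (2 * n / (2 ^ k * lo) * (1 + D / lo))"
  proof -
    have "\<bar>sqrt (deg_int i / deg_int x) - r\<bar> \<le> sqrt \<bar>deg_int i / deg_int x - d i / d x\<bar>"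
      unfolding r_def by (rule sqrt_diff_le) (use deg_int_nonneg d_nonneg in auto)
    also have "\<bar>(deg_int i / 2 ^ k) / (deg_int x / 2 ^ k) - d i / d x\<bar> \<le> 2 * (n / 2 ^ k) / lo * (1 + D / lo)"
      by (rule ratio_close) (use d_nonneg D[OF i] deg_int_close dx lo precision in \<open>auto simp: field_simps\<close>)
    then have "sqrt \<bar>deg_int i / deg_int x - d i / d x\<bar> \<le> sqrt (2 * n / (2 ^ k * lo) * (1 + D / lo))"
      by (simp add: mult.commute)
    finally show ?thesis .
  qed
  ultimately have sr: "\<bar>s - r\<bar> \<le> 1 / 2 ^ k + sqrt (2 * n / (2 ^ k * lo) * (1 + D / lo))" by linarith
  have "d i / d x \<le> D / lo" using D[OF i] d_nonneg[of i] lo D_pos dx by (intro frac_le) auto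
  then have r: "0 \<le> r" "r \<le> sqrt (D / lo)" using d_nonneg by (simp_all add: r_def)
  have \<beta>': "\<bar>\<beta>'\<bar> \<le> 1"
  proof -
    have "real_of_int \<bar>fixed_point \<beta> (int k)\<bar> \<le> real_of_int (2 ^ k)"
      using fixed_rhs_bound[of x] unfolding \<beta>_def of_int_le_iff .
    then show ?thesis by (simp add: \<beta>'_def)
  qed
  have "\<bar>real_of_int (fixed_point \<beta> (int k)) - 2 ^ k * \<beta>\<bar> \<le> 1" unfolding fixed_point_def nat_int by linarith
  then have "\<bar>real_of_int (fixed_point \<beta> (int k)) - 2 ^ k * \<beta>\<bar> / 2 ^ k \<le> 1 / 2 ^ k" by (intro divide_right_mono) auto
  moreover have "\<beta>' - \<beta> = (real_of_int (fixed_point \<beta> (int k)) - 2 ^ k * \<beta>) / 2 ^ k"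
    by (simp add: \<beta>'_def diff_divide_distrib)
  ultimately have \<beta>\<beta>: "\<bar>\<beta>' - \<beta>\<bar> \<le> 1 / 2 ^ k" by (simp add: abs_divide)
  have "s * \<beta>' - r * \<beta> = (s - r) * \<beta>' + r * (\<beta>' - \<beta>)" by (simp add: algebra_simps)
  also have "\<bar>\<dots>\<bar> \<le> \<bar>s - r\<bar> * \<bar>\<beta>'\<bar> + r * \<bar>\<beta>' - \<beta>\<bar>"
    using r by (intro order_trans[OF abs_triangle_ineq]) (simp add: abs_mult)
  also have "\<dots> \<le> (1 / 2 ^ k + sqrt (2 * n / (2 ^ k * lo) * (1 + D / lo))) * 1 + sqrt (D / lo) * (1 / 2 ^ k)"
    using sr \<beta>' r \<beta>\<beta> lo(1) D_pos by (intro add_mono mult_mono) auto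
  finally show ?thesis unfolding c f by simp
qed

lemma walk_op_scale: "(walk_op N n a ^^ t) (\<lambda>x. c * h x) x = c * (walk_op N n a ^^ t) h x"
proof -
  have *: "walk_op N n a (\<lambda>x. c * h x) = (\<lambda>x. c * walk_op N n a h x)" for h
    by (simp add: fun_eq_iff walk_op_def algebra_simps sum_distrib_left sum_subtractf)
  have "(walk_op N n a ^^ t) (\<lambda>x. c * h x) = (\<lambda>x. c * (walk_op N n a ^^ t) h x)"
    by (induction t) (simp_all add: *)
  then show ?thesis by simp
qed

text \<open>The three terms come from truncating the series, from rounding the contributions, and
  from rounding the transition probabilities. The last error grows along the walk and is summed over
  it, hence the square of T.\<close>

lemma bias:
  fixes \<eta> \<delta> :: real
  assumes i: "i < n" and T: "1 \<le> T" and e: "1 \<le> e"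
    and \<eta>: "1 / 2 ^ k + sqrt (2 * n / (2 ^ k * lo) * (1 + D / lo)) + sqrt (D / lo) / 2 ^ k \<le> \<eta>"
    and \<delta>: "1 / 2 ^ k + (1 + n) / (2 ^ k * lo) \<le> \<delta>"
  shows "\<bar>(pseudo_inverse (laplacian (graph I)) *\<^sub>v rhs I) $ i -
      measure_pmf.expectation (run_pmf i) real_of_int / (2 ^ k * 2 ^ k * 2 ^ e)\<bar>
    \<le> real n * 2 ^ e / ((lo / ((real n)\<^sup>2 * D))\<^sup>2 * real T) + real T * \<eta> + 2 * (real T)\<^sup>2 * \<delta> * sqrt (D / lo)"
proof -
  let ?N = "2 ^ e :: real" and ?K = "2 ^ k * 2 ^ k :: real"
  let ?W = "walk_op ?N n trans_prob" and ?Q = "walk_op ?N n accept"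
  have "real n \<le> real (2 ^ e)" using size(2) unfolding of_nat_le_iff .
  then have nN: "real n \<le> ?N" by simp
  have N: "2 \<le> ?N" using e power_increasing[of 1 e "2::real"] by simp
  have \<delta>0: "0 \<le> \<delta>"
    by (rule order_trans[OF _ \<delta>]) (use lo(1) in simp)
  have \<eta>0: "0 \<le> \<eta>"
    by (rule order_trans[OF _ \<eta>]) (use lo(1) D_pos in simp)
  define f where "f x = sqrt (d i) * start (rhs I) x" for x
  define F where "F x = real_of_int (contrib i x) / ?K" for x
  have pointwise: "\<bar>(?Q ^^ t) F i - (?W ^^ t) f i\<bar> \<le> \<eta> + 2 * real T * \<delta> * sqrt (D / lo)" if "t < T" for t
  proof -
    have "\<bar>(?Q ^^ t) F i - (?W ^^ t) f i\<bar> \<le> \<eta> + 2 * real t * \<delta> * sqrt (D / lo)"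
    proof (rule walk_op_perturb[OF _ _ _ _ _ nN i])
      show "\<bar>accept x j - trans_prob x j\<bar> \<le> \<delta>" for x j using accept_close[of x j] \<delta> by linarith
      show "\<bar>F x - f x\<bar> \<le> \<eta>" if "x < n" for x
        unfolding F_def f_def using contrib_close[OF i that] \<eta> by linarith
      show "\<bar>f x\<bar> \<le> sqrt (D / lo)" if "x < n" for x unfolding f_def by (rule scaled_start_bound[OF i that])
    qed (use accept_bounds trans_prob_bounds in auto)
    also have "\<dots> \<le> \<eta> + 2 * real T * \<delta> * sqrt (D / lo)"
      using that \<delta>0 lo D_pos by (intro add_left_mono mult_right_mono) auto
    finally show ?thesis .
  qed
  have E: "measure_pmf.expectation (run_pmf i) real_of_int / (?K * ?N) = (\<Sum>t<T. (?Q ^^ t) F i) / ?N"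
  proof -
    have "(?Q ^^ t) (\<lambda>y. real_of_int (contrib i y)) i = ?K * (?Q ^^ t) F i" for t
      using walk_op_scale[where N = ?N and a = accept and t = t and c = ?K and h = F and x = i] by (simp add: F_def)
    then show ?thesis unfolding expectation_run by (simp add: sum_distrib_left[symmetric])
  qed
  have "\<bar>(\<Sum>t<T. (?W ^^ t) f i) / ?N - (\<Sum>t<T. (?Q ^^ t) F i) / ?N\<bar> \<le> real T * \<eta> + 2 * (real T)\<^sup>2 * \<delta> * sqrt (D / lo)"
  proof -
    have "\<bar>(\<Sum>t<T. (?Q ^^ t) F i) - (\<Sum>t<T. (?W ^^ t) f i)\<bar> \<le> (\<Sum>t<T. \<eta> + 2 * real T * \<delta> * sqrt (D / lo))"
      unfolding sum_subtractf[symmetric] by (rule order_trans[OF sum_abs], rule sum_mono) (use pointwise in auto)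
    also have "\<dots> = real T * \<eta> + 2 * (real T)\<^sup>2 * \<delta> * sqrt (D / lo)" by (simp add: power2_eq_square algebra_simps)
    finally have *: "\<bar>(\<Sum>t<T. (?Q ^^ t) F i) - (\<Sum>t<T. (?W ^^ t) f i)\<bar> \<le> real T * \<eta> + 2 * (real T)\<^sup>2 * \<delta> * sqrt (D / lo)" .
    have "\<bar>(\<Sum>t<T. (?W ^^ t) f i) / ?N - (\<Sum>t<T. (?Q ^^ t) F i) / ?N\<bar> = \<bar>(\<Sum>t<T. (?Q ^^ t) F i) - (\<Sum>t<T. (?W ^^ t) f i)\<bar> / ?N"
      by (simp add: diff_divide_distrib[symmetric] abs_divide abs_minus_commute)
    \<comment> \<open>The factor 1 / N only decreases the error and is dropped.\<close>
    also have "\<dots> \<le> \<bar>(\<Sum>t<T. (?Q ^^ t) F i) - (\<Sum>t<T. (?W ^^ t) f i)\<bar> / 1"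
      using N by (intro divide_left_mono) auto
    finally show ?thesis using * by simp
  qed
  moreover have "\<bar>(pseudo_inverse (laplacian (graph I)) *\<^sub>v rhs I) $ i - (\<Sum>t<T. (?W ^^ t) f i) / ?N\<bar>
      \<le> real n * ?N / ((lo / ((real n)\<^sup>2 * D))\<^sup>2 * real T)"
    using pseudo_inverse_series[OF b i N _ D_pos, of T] T unfolding f_def walk_op_scale by simp
  ultimately show ?thesis unfolding E by linarith
qed

end

section \<open>Initialisation of the parameters\<close>

text \<open>The exponent \<open>m\<close> depends on the constants c and c' alone, so the
  multiplications are unrolled into the text of the program.\<close>

definition power_prog :: "nat \<Rightarrow> nat \<Rightarrow> program" where
  "power_prog r m = block (Const r 1 # replicate m (Arith Times r r rBase))"

text \<open>\<open>e\<close> is increased until 2^e \<ge> n and then until the reading of \<epsilon>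
  at precision \<open>e\<close> reaches 1. For \<gamma> only the first precision \<open>g\<close>
  with a nonzero reading is kept: \<open>g\<close> takes about log (log (1 / \<gamma>)) bits,
  whereas 1 / \<gamma> would take log (1 / \<gamma>).\<close>

definition init_prog :: "nat \<Rightarrow> nat \<Rightarrow> nat \<Rightarrow> nat \<Rightarrow> program" where
  "init_prog q \<tau> \<rho> \<omega> = block [ReadSize rSize, Const rOne 1, Const rExp 0, Const rBase 1,
     Loop rBase rSize (block [Arith Plus rExp rExp rOne, Arith Plus rBase rBase rBase]),
     ReadEps rCount rExp,
     Loop rCount rOne (block [Arith Plus rExp rExp rOne, Arith Plus rBase rBase rBase, ReadEps rCount rExp]),
     Const rConf 0, ReadGam rCount rConf,
     Loop rCount rOne (block [Arith Plus rConf rConf rOne, ReadGam rCount rConf]),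
     Const rPrec (int q), Arith Times rPrec rPrec rExp,
     power_prog rScale q, power_prog rLen \<tau>, power_prog rRuns \<rho>, Arith Times rRuns rRuns rConf,
     Const rOut (int \<omega>), Arith Times rOut rOut rExp]"

lemma computes_replicate_Times:
  assumes "bounded_store B s" "s rBase = 2 ^ e" "s r = 2 ^ (e * j)" "r \<noteq> rBase" "2 ^ (e * (j + m)) \<le> B"
  shows "computes I B (block (replicate m (Arith Times r r rBase))) s out (return_pmf ())
    (\<lambda>_ s' out'. out' = out \<and> s' r = 2 ^ (e * (j + m)) \<and> (\<forall>p. p \<noteq> r \<longrightarrow> s' p = s p))"
  using assms
proof (induction m arbitrary: s j)
  case 0
  then show ?case by simp (rule computes_Skip; simp)
next
  case (Suc m)
  have "(2::int) ^ (e * Suc j) \<le> 2 ^ (e * (j + Suc m))" by (intro power_increasing) auto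
  from order_trans[OF this Suc.prems(5)] have b: "\<bar>(2::int) ^ (e * Suc j)\<bar> \<le> B" by simp
  have "computes I B (block (Arith Times r r rBase # replicate m (Arith Times r r rBase))) s out (return_pmf ())
    (\<lambda>_ s' out'. out' = out \<and> s' r = 2 ^ (e * (j + Suc m)) \<and> (\<forall>p. p \<noteq> r \<longrightarrow> s' p = s p))"
    apply (rule block_Arith[OF Suc.prems(1), of "2 ^ (e * Suc j)"])
    subgoal using Suc.prems by (simp add: power_add mult.commute)
    subgoal by (rule b)
    apply (rule computes_conseq[OF Suc.IH[of _ "Suc j"]], assumption)
    using Suc.prems by auto
  then show ?case by simp
qed

lemma computes_power:
  assumes "bounded_store B s" "s rBase = 2 ^ e" "r \<noteq> rBase" "2 ^ (e * m) \<le> B"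
  shows "computes I B (power_prog r m) s out (return_pmf ())
    (\<lambda>_ s' out'. out' = out \<and> s' r = 2 ^ (e * m) \<and> (\<forall>p. p \<noteq> r \<longrightarrow> s' p = s p))"
proof -
  have "1 \<le> B" using assms(4) by (smt (verit) one_le_power)
  then show ?thesis
    unfolding power_prog_def using assms
    by (intro block_Const computes_conseq[OF computes_replicate_Times[of B _ e r 0 m]]) auto
qed

context walk_machine
begin

lemma computes_init:
  assumes e0: "\<And>m. m < e0 \<Longrightarrow> 2 ^ m < n" "n \<le> 2 ^ e0"
    and e: "e0 \<le> e" "\<And>m. e0 \<le> m \<Longrightarrow> m < e \<Longrightarrow> 2 ^ m * eps I < 1" "1 \<le> 2 ^ e * eps I" "0 < eps I" "eps I < 1"
    and g: "\<And>m. m < g \<Longrightarrow> 2 ^ m * gam I < 1" "1 \<le> 2 ^ g * gam I" "0 < gam I"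
    and params: "k = q * e" "T = 2 ^ (e * \<tau>)" "R = 2 ^ (e * \<rho>) * g" "oe = \<omega> * e"
    and B: "int oe \<le> B" "int g \<le> B" "2 ^ (e * q) \<le> B" "2 ^ (e * \<rho>) \<le> B" "int q \<le> B" "int \<omega> \<le> B"
  shows "computes I B (init_prog q \<tau> \<rho> \<omega>) (\<lambda>_. 0) [] (return_pmf ()) (\<lambda>_ s' out'. out' = [] \<and> params s')"
proof -
  have B1: "1 \<le> B" using bounds by (smt (verit) one_le_power)
  have pow_le: "(2::int) ^ m \<le> B" if "m \<le> e" for m
  proof -
    have "(2::int) ^ m \<le> 2 ^ e" using that by (intro power_increasing) auto
    then show ?thesis using bounds by linarith
  qed
  have floor_eps: "\<bar>\<lfloor>2 ^ m * eps I\<rfloor>\<bar> \<le> B" if "m \<le> e" for m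
  proof -
    have "2 ^ m * eps I \<le> 2 ^ m" using e by simp
    then have "\<lfloor>2 ^ m * eps I\<rfloor> \<le> \<lfloor>(2::real) ^ m\<rfloor>" by (rule floor_mono)
    moreover have "\<lfloor>(2::real) ^ m\<rfloor> = 2 ^ m" by simp
    moreover have "0 \<le> \<lfloor>2 ^ m * eps I\<rfloor>" using e by simp
    ultimately have "0 \<le> \<lfloor>2 ^ m * eps I\<rfloor>" "\<lfloor>2 ^ m * eps I\<rfloor> \<le> 2 ^ m" by linarith+
    then show ?thesis using pow_le[OF that] by linarith
  qed
  \<comment> \<open>By minimality of \<open>g\<close> the scaled value stays below 2, so the
    register holds only 0 or 1.\<close>
  have floor_gam: "\<bar>\<lfloor>2 ^ m * gam I\<rfloor>\<bar> \<le> B" if "m \<le> g" for m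
  proof -
    have "2 ^ m * gam I < 2"
    proof (cases m)
      case 0
      then show ?thesis using g(1)[of 0] conf by simp
    next
      case (Suc j)
      then show ?thesis using g(1)[of j] that by simp
    qed
    then have "\<lfloor>2 ^ m * gam I\<rfloor> \<le> 1" by linarith
    moreover have "0 \<le> \<lfloor>2 ^ m * gam I\<rfloor>" using g(3) by simp
    ultimately show ?thesis using B1 by linarith
  qed
  define J1 where "J1 m s out \<longleftrightarrow> out = [] \<and> s rZero = 0 \<and> s rSize = int n \<and> s rOne = 1 \<and> s rExp = int m \<and> s rBase = 2 ^ m"
    for m and s :: store and out :: "real list"
  define J2 where "J2 m s out \<longleftrightarrow> J1 (e0 + m) s out \<and> s rCount = \<lfloor>2 ^ (e0 + m) * eps I\<rfloor>"
    for m and s :: store and out :: "real list"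
  define J3 where "J3 m s out \<longleftrightarrow> J1 e s out \<and> s rConf = int m \<and> s rCount = \<lfloor>2 ^ m * gam I\<rfloor>"
    for m and s :: store and out :: "real list"
  let ?b1 = "block [Arith Plus rExp rExp rOne, Arith Plus rBase rBase rBase]"
  let ?b2 = "block [Arith Plus rExp rExp rOne, Arith Plus rBase rBase rBase, ReadEps rCount rExp]"
  let ?b3 = "block [Arith Plus rConf rConf rOne, ReadGam rCount rConf]"
  have loop1: "computes I B (Loop rBase rSize ?b1) s out (return_pmf ()) (\<lambda>_. J1 e0)"
    if "bounded_store B s" "J1 0 s out" for s out
  proof (rule computes_Loop_det[where J = J1, OF _ _ that])
    fix m s out assume *: "m < e0" "bounded_store B s" "J1 m s out"
    have "int (2 ^ m) < int n" using e0(1)[OF *(1)] by (simp only: of_nat_less_iff)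
    then have "s rBase < s rSize" using * by (simp add: J1_def)
    moreover have "computes I B ?b1 s out (return_pmf ()) (\<lambda>_. J1 (Suc m))"
      apply (rule block_Arith[OF *(2), of "int (Suc m)"])
      subgoal using * by (simp add: J1_def)
      subgoal using * e bounds by simp
      apply (rule block_Arith[of _ _ "2 ^ Suc m"], assumption)
      subgoal using * by (simp add: J1_def)
      subgoal using pow_le[of "Suc m"] * e by simp
      apply (rule computes_return, assumption)
      using * by (simp add: J1_def)
    ultimately show "s rBase < s rSize \<and> computes I B ?b1 s out (return_pmf ()) (\<lambda>_. J1 (Suc m))" ..
  next
    fix s out assume "J1 e0 s out"
    moreover have "int n \<le> int (2 ^ e0)" using e0(2) by (simp only: of_nat_le_iff)
    ultimately show "\<not> s rBase < s rSize" by (simp add: J1_def)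
  qed
  have loop2: "computes I B (Loop rCount rOne ?b2) s out (return_pmf ()) (\<lambda>_. J2 (e - e0))"
    if "bounded_store B s" "J2 0 s out" for s out
  proof (rule computes_Loop_det[where J = J2, OF _ _ that])
    fix m s out assume *: "m < e - e0" "bounded_store B s" "J2 m s out"
    have "2 ^ (e0 + m) * eps I < 1" using e(2)[of "e0 + m"] * by simp
    then have "\<lfloor>2 ^ (e0 + m) * eps I\<rfloor> < 1" by linarith
    then have "s rCount < s rOne" using * by (simp add: J2_def J1_def)
    moreover have "computes I B ?b2 s out (return_pmf ()) (\<lambda>_. J2 (Suc m))"
      apply (rule block_Arith[OF *(2), of "int (e0 + Suc m)"])
      subgoal using * by (simp add: J2_def J1_def)
      subgoal using * bounds by simp
      apply (rule block_Arith[of _ _ "2 ^ (e0 + Suc m)"], assumption)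
      subgoal using * by (simp add: J2_def J1_def)
      subgoal using pow_le[of "e0 + Suc m"] * by simp
      apply (rule block_ReadEps[of _ _ "\<lfloor>2 ^ (e0 + Suc m) * eps I\<rfloor>"], assumption)
      subgoal using * by (simp add: J2_def J1_def fixed_point_def del: power_Suc of_nat_add of_nat_Suc)
      subgoal using floor_eps[of "e0 + Suc m"] * by simp
      apply (rule computes_return, assumption)
      using * by (simp add: J2_def J1_def)
    ultimately show "s rCount < s rOne \<and> computes I B ?b2 s out (return_pmf ()) (\<lambda>_. J2 (Suc m))" ..
  next
    fix s out assume "J2 (e - e0) s out"
    then have "s rCount = \<lfloor>2 ^ e * eps I\<rfloor>" "s rOne = 1" using e(1) by (auto simp: J2_def J1_def)
    moreover have "1 \<le> \<lfloor>2 ^ e * eps I\<rfloor>" using e(3) by linarith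
    ultimately show "\<not> s rCount < s rOne" by simp
  qed
  have loop3: "computes I B (Loop rCount rOne ?b3) s out (return_pmf ()) (\<lambda>_. J3 g)"
    if "bounded_store B s" "J3 0 s out" for s out
  proof (rule computes_Loop_det[where J = J3, OF _ _ that])
    fix m s out assume *: "m < g" "bounded_store B s" "J3 m s out"
    have "\<lfloor>2 ^ m * gam I\<rfloor> < 1" using g(1)[OF *(1)] by linarith
    then have "s rCount < s rOne" using * by (simp add: J3_def J1_def)
    moreover have "computes I B ?b3 s out (return_pmf ()) (\<lambda>_. J3 (Suc m))"
      apply (rule block_Arith[OF *(2), of "int (Suc m)"])
      subgoal using * by (simp add: J3_def J1_def)
      subgoal using * B by simp
      apply (rule block_ReadGam[of _ _ "\<lfloor>2 ^ (Suc m) * gam I\<rfloor>"], assumption)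
      subgoal using * by (simp add: J3_def J1_def fixed_point_def del: power_Suc of_nat_Suc)
      subgoal using floor_gam[of "Suc m"] * by simp
      apply (rule computes_return, assumption)
      using * by (simp add: J3_def J1_def)
    ultimately show "s rCount < s rOne \<and> computes I B ?b3 s out (return_pmf ()) (\<lambda>_. J3 (Suc m))" ..
  next
    fix s out assume "J3 g s out"
    then have "s rCount = \<lfloor>2 ^ g * gam I\<rfloor>" "s rOne = 1" by (auto simp: J3_def J1_def)
    moreover have "1 \<le> \<lfloor>2 ^ g * gam I\<rfloor>" using g(2) by linarith
    ultimately show "\<not> s rCount < s rOne" by simp
  qed
  have T: "2 ^ (e * \<tau>) \<le> B" using bounds params by simp
  have R: "2 ^ (e * \<rho>) * int g \<le> B" using bounds params by simp
  show ?thesis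
    unfolding init_prog_def
    apply (rule block_ReadSize[of _ _ "int n"])
    subgoal using B1 by (simp add: bounded_store_def)
    subgoal by (simp add: size)
    subgoal using bounds by simp
    apply (rule block_Const, assumption)
    subgoal using B1 by simp
    apply (rule block_Const, assumption)
    subgoal using B1 by simp
    apply (rule block_Const, assumption)
    subgoal using B1 by simp
    apply (rule block_det, rule loop1, assumption)
    subgoal by (simp add: J1_def)
    subgoal premises p for s1 out1
      apply (rule block_ReadEps[of _ _ "\<lfloor>2 ^ e0 * eps I\<rfloor>"])
      subgoal by (rule p)
      subgoal using p by (simp add: J1_def fixed_point_def)
      subgoal by (rule floor_eps[OF e(1)])
      apply (rule block_det, rule loop2, assumption)
      subgoal using p by (simp add: J2_def J1_def)
      subgoal premises p for s2 out2
        apply (rule block_Const[of B s2])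
        subgoal by (rule p)
        subgoal using B1 by simp
        apply (rule block_ReadGam[of _ _ "\<lfloor>2 ^ 0 * gam I\<rfloor>"], assumption)
        subgoal by (simp add: fixed_point_def)
        subgoal by (rule floor_gam) simp
        apply (rule block_det, rule loop3, assumption)
        subgoal using p e(1) by (simp add: J3_def J2_def J1_def)
        subgoal premises p for s3 out3
          apply (rule block_Const[of B s3])
          subgoal by (rule p)
          subgoal using B by simp
          apply (rule block_Arith[of _ _ "int k"], assumption)
          subgoal using p by (simp add: J3_def J1_def params)
          subgoal using bounds by simp
          apply (rule block_det, rule computes_power[where e = e], assumption)
          subgoal using p by (simp add: J3_def J1_def)
          subgoal by simp
          subgoal by (rule B)
          subgoal premises q for s4 out4
            apply (rule block_det, rule computes_power[where e = e])
            subgoal by (rule q)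
            subgoal using p q by (simp add: J3_def J1_def)
            subgoal by simp
            subgoal by (rule T)
            subgoal premises r for s5 out5
              apply (rule block_det, rule computes_power[where e = e])
              subgoal by (rule r)
              subgoal using p q r by (simp add: J3_def J1_def)
              subgoal by simp
              subgoal by (rule B)
              subgoal premises t for s6 out6
                apply (rule block_Arith[of _ _ "int R"])
                subgoal by (rule t)
                subgoal using p q r t by (simp add: J3_def J1_def params)
                subgoal using bounds by simp
                apply (rule block_Const, assumption)
                subgoal using B by simp
                apply (rule block_Arith[of _ _ "int oe"], assumption)
                subgoal using p q r t by (simp add: J3_def J1_def params)
                subgoal using B by simp
                apply (rule computes_return, assumption)
                using p q r t by (simp add: J3_def J1_def params_def) (simp add: params mult.commute)
              done
            done
          done
        done
      done
    done
qed

end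

section \<open>Choice of the parameters\<close>

text \<open>With \<open>N = 2 ^ e\<close> and edge weights in \<open>[1 / N ^ C, N ^ C]\<close>, these exponents of \<open>N\<close> give the
  length of the walks, the precision and the number of runs (up to the factor \<open>g\<close>).
  They make each of five error terms at most \<open>1 / N ^ 4\<close>.\<close>

definition len_exp :: "nat \<Rightarrow> nat" where "len_exp C = 4 * C + 12"
definition prec_exp :: "nat \<Rightarrow> nat" where "prec_exp C = 11 * C + 40"
definition runs_exp :: "nat \<Rightarrow> nat" where "runs_exp C = 10 * C + 37"
definition out_exp :: "nat \<Rightarrow> nat" where "out_exp C = 32 * C + 118"

lemmas exps = len_exp_def prec_exp_def runs_exp_def out_exp_def

lemma pseudo_inverse_dim:
  assumes A: "A \<in> carrier_mat n n" and sym: "\<And>i j. i < n \<Longrightarrow> j < n \<Longrightarrow> A $$ (i, j) = A $$ (j, i)"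
  shows "dim_row (pseudo_inverse A) = n"
proof -
  have "\<exists>P l u. orthonormal_eigenbasis A l u \<and>
     P = mat (dim_row A) (dim_row A)
           (\<lambda>(i, j). \<Sum>k | k < dim_row A \<and> l k \<noteq> 0. inverse (l k) * (u k $ i * u k $ j))"
    using ex_orthonormal_eigenbasis[OF A sym] by blast
  from someI_ex[OF this] show ?thesis using A unfolding pseudo_inverse_def by auto
qed

section \<open>Error budget in powers of N\<close>

text \<open>\<open>lo\<close> and \<open>D\<close> are the bounds for weights in [1 / N^C, N^C]: a
  degree is at most n * N^C \<le> N^(C+1).\<close>

locale laplacian_solver = laplacian_machine I B n e g k T R oe lo D
  for I B n e g k T R oe lo D +
  fixes C :: nat
  assumes e: "1 \<le> e" and n0: "1 \<le> n"
    and params_eq: "k = prec_exp C * e" "T = 2 ^ (e * len_exp C)" "R = 2 ^ (e * runs_exp C) * g" "oe = out_exp C * e"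
    and lo_def: "lo = 1 / (2 ^ e) ^ C" and D_def: "D = (2 ^ e) ^ (C + 1)"
begin

definition N :: real where "N = 2 ^ e"

abbreviation "sol i \<equiv> (pseudo_inverse (laplacian (graph I)) *\<^sub>v rhs I) $ i"

lemma lo_eq: "lo = 1 / N ^ C" and D_eq: "D = N ^ (C + 1)"
  by (simp_all add: lo_def D_def N_def)

lemma N_ge_2: "2 \<le> N"
  using e power_increasing[of 1 e "2::real"] by (simp add: N_def)

lemma N_pos: "0 < N"
  using N_ge_2 by simp

lemma N_mult: "2 * x \<le> N * x" if "0 \<le> x"
  using N_ge_2 that by (rule mult_right_mono)

lemma n_le_N: "real n \<le> N"
proof -
  have "real n \<le> real (2 ^ e)" using size(2) unfolding of_nat_le_iff .
  then show ?thesis by (simp add: N_def)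
qed

lemma N_pow: "i \<le> j \<Longrightarrow> N ^ i \<le> N ^ j"
  using N_ge_2 by (intro power_increasing) auto

lemma K_eq: "2 ^ k = N ^ prec_exp C"
  by (simp add: N_def params_eq power_mult[symmetric] mult.commute)

lemma T_eq: "real T = N ^ len_exp C"
  by (simp add: N_def params_eq power_mult)

lemma R_eq: "real R = N ^ runs_exp C * g"
  by (simp add: N_def params_eq power_mult)

lemma oe_eq: "2 ^ oe = N ^ out_exp C"
  by (simp add: N_def params_eq power_mult[symmetric] mult.commute)

lemma ratio_eq: "D / lo = N ^ (2 * C + 1)"
  unfolding lo_eq D_eq by (simp add: mult_2 power_add)

text \<open>The exponent 2 * C + 1 of the ratio is odd; rounding it up to 2 * C + 2 gives the square
  root an integral exponent.\<close>

lemma sqrt_ratio: "sqrt (D / lo) \<le> N ^ (C + 1)"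
proof -
  have "N ^ (2 * C + 1) \<le> N ^ (2 * (C + 1))" by (rule N_pow) simp
  also have "\<dots> = (N ^ (C + 1))\<^sup>2" by (simp only: power_mult[symmetric] mult.commute)
  finally show ?thesis unfolding ratio_eq using N_ge_2 by (intro real_le_lsqrt) auto
qed

lemma walk_error:
  "1 / 2 ^ k + sqrt (2 * n / (2 ^ k * lo) * (1 + D / lo)) + sqrt (D / lo) / 2 ^ k \<le> 1 / N ^ (len_exp C + 4)"
proof -
  \<comment> \<open>Each of the three terms is made at most 1 / N^m. The surplus 2 over the target
    exponent absorbs the factor 3, which is at most N^2; the target itself leaves 1 / N^4 after
    summing over T steps.\<close>
  define m where "m = len_exp C + 6"
  note N0 = N_pos
  have a: "1 / 2 ^ k \<le> 1 / N ^ m"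
    unfolding K_eq using N0 by (intro divide_left_mono N_pow) (auto simp: exps m_def)
  have "2 * n / (2 ^ k * lo) * (1 + D / lo) \<le> (N * N * N ^ C / N ^ prec_exp C) * (N * N ^ (2 * C + 1))"
  proof (rule mult_mono)
    have "2 * real n \<le> N * N" using N_ge_2 n_le_N N0 by (intro mult_mono) auto
    then have "2 * real n * N ^ C \<le> N * N * N ^ C" using N0 by (intro mult_right_mono) auto
    then show "2 * n / (2 ^ k * lo) \<le> N * N * N ^ C / N ^ prec_exp C"
      unfolding K_eq lo_eq using N0 by (simp add: divide_right_mono)
    have "1 + N ^ (2 * C + 1) \<le> 2 * N ^ (2 * C + 1)" using N_pow[of 0 "2 * C + 1"] by simp
    also have "\<dots> \<le> N * N ^ (2 * C + 1)" using N_ge_2 by (intro mult_right_mono) auto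
    finally show "1 + D / lo \<le> N * N ^ (2 * C + 1)" unfolding ratio_eq .
  qed (use lo(1) D_pos N0 in auto)
  also have "\<dots> = N ^ (3 * C + 4) / N ^ prec_exp C"
  proof -
    have "N * N * N ^ C * (N * N ^ (2 * C + 1)) = N ^ (1 + 1 + C + (1 + (2 * C + 1)))"
      by (simp only: power_add power_one_right)
    also have "1 + 1 + C + (1 + (2 * C + 1)) = 3 * C + 4" by simp
    finally show ?thesis by simp
  qed
  also have "\<dots> = (1 / N ^ m)\<^sup>2"
  proof -
    \<comment> \<open>Origin of \<open>prec_exp\<close>: the radicand is at most N^(3*C+4) /
      N^prec_exp and has to be the square of 1 / N^m, so the square root doubles the demand on
      precision.\<close>
    have "prec_exp C = (3 * C + 4) + m * 2" by (simp add: exps m_def)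
    then show ?thesis using N0 by (simp add: power_add power_mult power_divide)
  qed
  finally have b: "sqrt (2 * n / (2 ^ k * lo) * (1 + D / lo)) \<le> 1 / N ^ m"
    using N0 by (intro real_le_lsqrt) auto
  have "sqrt (D / lo) / 2 ^ k \<le> N ^ (C + 1) / N ^ prec_exp C"
    unfolding K_eq by (rule divide_right_mono[OF sqrt_ratio]) (use N_pos in simp)
  also have "\<dots> \<le> 1 / N ^ m"
  proof -
    have "prec_exp C = (C + 1) + m + (6 * C + 21)" by (simp add: exps m_def)
    then have "N ^ (C + 1) / N ^ prec_exp C = 1 / N ^ m * (1 / N ^ (6 * C + 21))"
      using N0 by (simp only: power_add) simp
    also have "\<dots> \<le> 1 / N ^ m * 1"
      using N_pow[of 0 "6 * C + 21"] N0 by (intro mult_left_mono) auto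
    finally show ?thesis by simp
  qed
  finally have c: "sqrt (D / lo) / 2 ^ k \<le> 1 / N ^ m" .
  have "3 * (1 / N ^ m) \<le> N\<^sup>2 * (1 / N ^ m)"
  proof (rule mult_right_mono)
    have "2 * 2 \<le> N * N" using N_ge_2 by (intro mult_mono) auto
    then show "3 \<le> N\<^sup>2" by (simp add: power2_eq_square)
  qed (use N0 in simp)
  also have "\<dots> = 1 / N ^ (len_exp C + 4)"
  proof -
    have "m = (len_exp C + 4) + 2" by (simp add: m_def)
    then have "N ^ m = N ^ (len_exp C + 4) * N\<^sup>2" by (simp only: power_add)
    then show ?thesis using N0 by simp
  qed
  finally show ?thesis using a b c by linarith
qed

lemma accept_error: "1 / 2 ^ k + (1 + n) / (2 ^ k * lo) \<le> N ^ (C + 3) / N ^ prec_exp C"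
proof -
  have "1 + real n \<le> N * N" using N_ge_2 n_le_N N_mult[of N] by linarith
  then have "(1 + n) / (2 ^ k * lo) \<le> N * N * N ^ C / N ^ prec_exp C"
    unfolding K_eq lo_eq using mult_right_mono[of "1 + real n" "N * N" "N ^ C"] N_pos by (simp add: divide_right_mono)
  also have "N * N * N ^ C = N ^ (C + 2)" by simp
  finally have "1 / 2 ^ k + (1 + n) / (2 ^ k * lo) \<le> (1 + N ^ (C + 2)) / N ^ prec_exp C"
    unfolding K_eq by (simp add: add_divide_distrib)
  also have "\<dots> \<le> N ^ (C + 3) / N ^ prec_exp C"
  proof (rule divide_right_mono)
    have "1 + N ^ (C + 2) \<le> 2 * N ^ (C + 2)" using N_pow[of 0 "C + 2"] by simp
    also have "\<dots> \<le> N * N ^ (C + 2)" using N_ge_2 by (intro mult_right_mono) auto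
    finally show "1 + N ^ (C + 2) \<le> N ^ (C + 3)" by (simp add: eval_nat_numeral)
  qed (use N_pos in simp)
  finally show ?thesis .
qed

text \<open>Truncation, rounded contributions and rounded transitions cost at most 1 / N^4
  each.\<close>

lemma total_bias:
  assumes i: "i < n"
  shows "\<bar>sol i - measure_pmf.expectation (run_pmf i) real_of_int / (2 ^ k * 2 ^ k * N)\<bar> \<le> 3 / N ^ 4"
proof -
  note N0 = N_pos
  have T1: "1 \<le> T" by (simp add: params_eq)
  have a: "real n * N / ((lo / ((real n)\<^sup>2 * D))\<^sup>2 * real T) \<le> 1 / N ^ 4"
  proof -
    have nn: "0 < real n" using n0 by simp
    have "(real n)\<^sup>2 * D \<le> N\<^sup>2 * D" using n_le_N D_pos by (intro mult_right_mono power_mono) auto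
    then have "lo / (N\<^sup>2 * D) \<le> lo / ((real n)\<^sup>2 * D)"
      using lo(1) D_pos nn N0 by (intro divide_left_mono mult_pos_pos) auto
    moreover have "lo / (N\<^sup>2 * D) = 1 / N ^ (2 * C + 3)"
    proof -
      have "2 * C + 3 = C + (2 + (C + 1))" by simp
      then have "N ^ (2 * C + 3) = N ^ C * (N\<^sup>2 * N ^ (C + 1))" by (simp only: power_add)
      then show ?thesis unfolding lo_eq D_eq by simp
    qed
    ultimately have "1 / N ^ (2 * C + 3) \<le> lo / ((real n)\<^sup>2 * D)" by simp
    then have "(1 / N ^ (2 * C + 3))\<^sup>2 \<le> (lo / ((real n)\<^sup>2 * D))\<^sup>2" using N0 by (intro power_mono) auto
    then have "real n * N / ((lo / ((real n)\<^sup>2 * D))\<^sup>2 * real T) \<le> N * N / ((1 / N ^ (2 * C + 3))\<^sup>2 * real T)"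
      using n_le_N N0 T1 by (intro frac_le mult_right_mono mult_pos_pos) auto
    also have "\<dots> = N * N * (N ^ (2 * C + 3))\<^sup>2 / N ^ len_exp C"
      unfolding T_eq by (simp add: power_divide)
    also have "N * N * (N ^ (2 * C + 3))\<^sup>2 = N ^ (1 + 1 + (2 * C + 3) * 2)"
      by (simp only: power_add power_mult power_one_right)
    \<comment> \<open>Origin of \<open>len_exp\<close>: the squared inverse spectral gap is at most
      N^(4*C+6), the prefactor n * N at most N^2, and 4 is the target exponent.\<close>
    also have "len_exp C = (1 + 1 + (2 * C + 3) * 2) + 4" by (simp add: exps)
    also have "N ^ (1 + 1 + (2 * C + 3) * 2) / N ^ ((1 + 1 + (2 * C + 3) * 2) + 4) = 1 / N ^ 4"
      using N0 by (simp only: power_add[of N "1 + 1 + (2 * C + 3) * 2" 4]) simp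
    finally show ?thesis .
  qed
  have b: "real T * (1 / N ^ (len_exp C + 4)) = 1 / N ^ 4"
    unfolding T_eq by (simp add: power_add)
  have c: "2 * (real T)\<^sup>2 * (N ^ (C + 3) / N ^ prec_exp C) * sqrt (D / lo) \<le> 1 / N ^ 4"
  proof -
    have "2 * (real T)\<^sup>2 * (N ^ (C + 3) / N ^ prec_exp C) * sqrt (D / lo) \<le>
       N * (real T)\<^sup>2 * (N ^ (C + 3) / N ^ prec_exp C) * N ^ (C + 1)"
      using N_ge_2 sqrt_ratio lo D_pos by (intro mult_mono) auto
    also have "\<dots> = N * (N ^ len_exp C)\<^sup>2 * N ^ (C + 3) * N ^ (C + 1) / N ^ prec_exp C"
      unfolding T_eq by simp
    also have "N * (N ^ len_exp C)\<^sup>2 * N ^ (C + 3) * N ^ (C + 1) = N ^ (1 + len_exp C * 2 + (C + 3) + (C + 1))"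
      by (simp only: power_add power_mult power_one_right)
    also have "N ^ (1 + len_exp C * 2 + (C + 3) + (C + 1)) / N ^ prec_exp C \<le> 1 / N ^ 4"
    proof -
      define X where "X = 1 + len_exp C * 2 + (C + 3) + (C + 1)"
      have "N ^ X * N ^ 4 \<le> N ^ prec_exp C"
        unfolding power_add[symmetric] by (rule N_pow) (simp add: exps X_def)
      then have "N ^ X / N ^ prec_exp C \<le> N ^ X / (N ^ X * N ^ 4)"
        using N0 by (intro divide_left_mono) auto
      then show ?thesis using N0 unfolding X_def[symmetric] by simp
    qed
    finally show ?thesis .
  qed
  show ?thesis
    using bias[OF i T1 e walk_error accept_error, folded N_def] a b c by simp
qed


text \<open>The exact contribution is at most sqrt (D / lo) \<le> N^(C+1) before scaling. One more
  factor N covers the rounding error, which is at most 1.\<close>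

definition value_bound :: int where
  "value_bound = 2 ^ k * 2 ^ k * 2 ^ (e * (C + 2))"

lemma value_bound_eq: "real_of_int value_bound = 2 ^ k * 2 ^ k * N ^ (C + 2)"
  by (simp only: value_bound_def N_def power_mult of_int_mult of_int_power of_int_numeral)

lemma contrib_bound:
  assumes "i < n" "x < n"
  shows "\<bar>contrib i x\<bar> \<le> value_bound"
proof -
  have "\<bar>contrib i x / (2 ^ k * 2 ^ k) - sqrt (d i) * start (rhs I) x\<bar> \<le> 1 / N ^ (len_exp C + 4)"
    using contrib_close[OF assms] walk_error by linarith
  also have "\<dots> \<le> 1" using N_pow[of 0 "len_exp C + 4"] N_pos by simp
  finally have "\<bar>contrib i x / (2 ^ k * 2 ^ k)\<bar> \<le> N ^ (C + 1) + 1"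
    using scaled_start_bound[OF assms] sqrt_ratio by linarith
  also have "\<dots> \<le> 2 * N ^ (C + 1)" using N_pow[of 0 "C + 1"] by simp
  also have "\<dots> \<le> N * N ^ (C + 1)" by (rule N_mult) (use N_pos in simp)
  also have "\<dots> = N ^ (C + 2)" by simp
  finally have "\<bar>real_of_int (contrib i x)\<bar> \<le> real_of_int value_bound"
    unfolding value_bound_eq by (simp add: abs_divide divide_le_eq mult.commute)
  then show ?thesis by linarith
qed

text \<open>After dividing by the number of runs and by the scale, the tolerance is 1 / N^4. The
  failure probability \<gamma> / n is what a union bound over the n vertices allows.\<close>

lemma acc_concentration:
  assumes i: "i < n" and \<gamma>: "1 \<le> 2 ^ g * \<gamma>"
  shows "measure_pmf.prob (acc_pmf i)
     {a. \<bar>real_of_int a - R * measure_pmf.expectation (run_pmf i) real_of_int\<bar> \<ge> R * (2 ^ k * 2 ^ k * N / N ^ 4)}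
    \<le> \<gamma> / n"
proof -
  define M where "M = real T * real_of_int value_bound"
  define \<Delta> where "\<Delta> = 2 ^ k * 2 ^ k * N / N ^ 4"
  have T0: "0 < real T" by (simp add: params_eq)
  have M: "0 < M" unfolding M_def value_bound_eq using T0 N_pos by simp
  have \<Delta>: "0 < \<Delta>" unfolding \<Delta>_def using N_pos by simp
  have R0: "0 < R" using conf by (simp add: params_eq)
  have supp: "\<bar>real_of_int v\<bar> \<le> M" if "v \<in> set_pmf (run_pmf i)" for v
  proof -
    have "\<bar>v\<bar> \<le> int T * value_bound" using set_run_pmf[OF contrib_bound[OF i] i that] .
    then have "real_of_int \<bar>v\<bar> \<le> real_of_int (int T * value_bound)" by (simp only: of_int_le_iff)
    then show ?thesis by (simp add: M_def)
  qed
  have exponent: "real R * \<Delta>\<^sup>2 / (2 * M\<^sup>2) = g * N ^ 3 / 2"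
  proof -
    \<comment> \<open>Origin of \<open>runs_exp\<close>: M^2 / \<Delta>^2 is N to the power 2 *
      len_exp C + 2 * (C + 2) + 6, and the remaining 3 leaves g * N^3 / 2 in Hoeffding's
      exponent.\<close>
    have "runs_exp C = 2 * len_exp C + 2 * (C + 2) + 3 + 6" by (simp add: exps)
    then have r: "N ^ runs_exp C = (N ^ len_exp C)\<^sup>2 * (N ^ (C + 2))\<^sup>2 * N ^ 3 * N ^ 6"
      by (simp only: power_add power_mult mult.commute[of 2])
    have "M = N ^ len_exp C * (2 ^ k * 2 ^ k) * N ^ (C + 2)" by (simp add: M_def value_bound_eq T_eq)
    then have M2: "M\<^sup>2 = (N ^ len_exp C)\<^sup>2 * (2 ^ k * 2 ^ k)\<^sup>2 * (N ^ (C + 2))\<^sup>2" by (simp only: power_mult_distrib)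
    have "N / N ^ 4 = 1 / N ^ 3" using N_pos by (simp add: eval_nat_numeral)
    then have "\<Delta> = (2 ^ k * 2 ^ k) / N ^ 3" unfolding \<Delta>_def by (metis times_divide_eq_right mult.right_neutral)
    moreover have "(N ^ 3)\<^sup>2 = N ^ 6" by (simp flip: power_mult)
    ultimately have D2: "\<Delta>\<^sup>2 = (2 ^ k * 2 ^ k)\<^sup>2 / N ^ 6" by (simp only: power_divide)
    define a b c' where "a = (N ^ len_exp C)\<^sup>2" and "b = (N ^ (C + 2))\<^sup>2" and "c' = (2 ^ k * 2 ^ k :: real)\<^sup>2"
    have "0 < a" "0 < b" "0 < c'" using N_pos by (simp_all add: a_def b_def c'_def)
    then show ?thesis
      unfolding R_eq r M2 D2 a_def[symmetric] b_def[symmetric] c'_def[symmetric] using N_pos by (simp add: field_simps)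
  qed
  have "real g * (N + 2) \<le> g * N ^ 3 / 2"
  proof -
    have "2 * 2 \<le> N * N" using N_ge_2 by (intro mult_mono) auto
    then have "4 * N \<le> N * N * N" using N_pos by (intro mult_right_mono) auto
    then have "N + 2 \<le> N ^ 3 / 2" using N_ge_2 unfolding power3_eq_cube by linarith
    then have "real g * (N + 2) \<le> real g * (N ^ 3 / 2)" by (intro mult_left_mono) auto
    then show ?thesis by simp
  qed
  then have "2 * exp (- (real R * \<Delta>\<^sup>2 / (2 * M\<^sup>2))) \<le> 2 * exp (- (real g * (N + 2)))"
    unfolding exponent by simp
  also have "\<dots> \<le> \<gamma> / n"
  proof -
    have g1: "1 \<le> real g" using conf by simp
    \<comment> \<open>The exponent is split so that exp (- g) \<le> 1 / 2^g \<le> \<gamma> pays for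
      the confidence, and 2 * exp (- (N + 1)) \<le> 1 / n for the two tails and the number of
      vertices.\<close>
    have "real g * (N + 2) \<ge> real g + (N + 1)"
      using mult_right_mono[OF g1, of "N + 1"] N_pos by (simp add: algebra_simps)
    then have "2 * exp (- (real g * (N + 2))) \<le> 2 * exp (- real g + - (N + 1))" by simp
    also have "\<dots> = exp (- real g) * (2 * exp (- (N + 1)))" unfolding exp_add by simp
    also have "\<dots> \<le> \<gamma> * (1 / n)"
    proof (rule mult_mono)
      have "(2::real) ^ g \<le> exp 1 ^ g" using exp_ge_add_one_self[of 1] by (intro power_mono) auto
      also have "\<dots> = exp (real g)" by (simp add: exp_of_nat_mult[symmetric])
      finally have "exp (- real g) \<le> 1 / 2 ^ g" by (simp add: exp_minus inverse_eq_divide frac_le)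
      also have "\<dots> \<le> \<gamma>" using \<gamma> by (simp add: divide_le_eq mult.commute)
      finally show "exp (- real g) \<le> \<gamma>" .
      then show "0 \<le> \<gamma>" by (rule order_trans[rotated]) simp
      have "2 \<le> exp (1 :: real)" "N \<le> exp N"
        using exp_ge_add_one_self[of 1] exp_ge_add_one_self[of N] by linarith+
      then have "2 * N \<le> exp 1 * exp N" using N_pos by (intro mult_mono) auto
      then have "2 * real n \<le> exp (N + 1)" using n_le_N by (simp add: exp_add mult.commute)
      then show "2 * exp (- (N + 1)) \<le> 1 / n"
        unfolding exp_minus inverse_eq_divide using n0 by (simp add: divide_le_eq le_divide_eq mult.commute)
    qed auto
    finally show ?thesis by simp
  qed
  finally have "2 * exp (- (real R * \<Delta>\<^sup>2 / (2 * M\<^sup>2))) \<le> \<gamma> / n" .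
  with iter_sum_concentration[where p = "run_pmf i", OF supp M \<Delta> R0] show ?thesis
    unfolding acc_pmf_def \<Delta>_def by linarith
qed

text \<open>Five errors of size 1 / N^4: sampling, the final integer division, and three from the
  bias. Since N \<ge> 2, their sum is at most 1 / N, hence at most \<epsilon>.\<close>

lemma output_close:
  assumes i: "i < n" and \<epsilon>: "1 \<le> N * \<epsilon>"
    and a: "\<bar>real_of_int a - R * measure_pmf.expectation (run_pmf i) real_of_int\<bar> < R * (2 ^ k * 2 ^ k * N / N ^ 4)"
  shows "\<bar>of_int (a div int g) / 2 ^ oe - sol i\<bar> \<le> \<epsilon>"
proof -
  let ?E = "measure_pmf.expectation (run_pmf i) real_of_int"
  have R0: "0 < real R" using conf by (simp add: params_eq)
  define S where "S = 2 ^ k * 2 ^ k * N"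
  have S: "0 < S" using N_pos by (simp add: S_def)
  have oe: "real g * 2 ^ oe = real R * S"
  proof -
    \<comment> \<open>Origin of \<open>out_exp\<close>: it combines the power of two in the number
      of runs, the scale 2^k * 2^k of the contributions, and the factor 1 / N of the series.\<close>
    have "out_exp C = runs_exp C + (prec_exp C + prec_exp C + 1)" by (simp add: exps)
    then show ?thesis unfolding oe_eq R_eq S_def K_eq by (simp only: power_add power_one_right) simp
  qed
  have g: "0 < real g" using conf by simp
  have "\<bar>real_of_int a - R * ?E\<bar> / (real R * S) \<le> (R * (S / N ^ 4)) / (real R * S)"
    using a R0 S by (intro divide_right_mono) (auto simp: S_def)
  also have "\<dots> = 1 / N ^ 4" using R0 S by simp
  also have "\<bar>real_of_int a - R * ?E\<bar> / (real R * S) = \<bar>(real_of_int a - R * ?E) / (real R * S)\<bar>"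
    using R0 S by (simp add: abs_divide)
  also have "(real_of_int a - R * ?E) / (real R * S) = real_of_int a / (real g * 2 ^ oe) - ?E / S"
    using R0 S by (simp add: diff_divide_distrib oe)
  finally have 1: "\<bar>real_of_int a / (real g * 2 ^ oe) - ?E / S\<bar> \<le> 1 / N ^ 4" .
  have "\<bar>real_of_int (a div int g) - real_of_int a / g\<bar> \<le> 1"
  proof -
    have "a div int g = \<lfloor>real_of_int a / real_of_int (int g)\<rfloor>" by (rule floor_divide_of_int_eq[symmetric])
    then show ?thesis by simp linarith
  qed
  then have "\<bar>real_of_int (a div int g) - real_of_int a / g\<bar> / 2 ^ oe \<le> 1 / 2 ^ oe" by (intro divide_right_mono) auto
  also have "\<dots> \<le> 1 / N ^ 4" unfolding oe_eq using N_pos by (intro divide_left_mono N_pow) (auto simp: exps)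
  also have "\<bar>real_of_int (a div int g) - real_of_int a / g\<bar> / 2 ^ oe = \<bar>(real_of_int (a div int g) - real_of_int a / g) / 2 ^ oe\<bar>"
    by (simp add: abs_divide)
  also have "(real_of_int (a div int g) - real_of_int a / g) / 2 ^ oe = of_int (a div int g) / 2 ^ oe - real_of_int a / (real g * 2 ^ oe)"
    by (simp add: diff_divide_distrib)
  finally have 2: "\<bar>of_int (a div int g) / 2 ^ oe - real_of_int a / (real g * 2 ^ oe)\<bar> \<le> 1 / N ^ 4" .
  have 3: "\<bar>sol i - ?E / S\<bar> \<le> 3 * (1 / N ^ 4)" using total_bias[OF i] by (simp add: S_def)
  have "\<bar>of_int (a div int g) / 2 ^ oe - sol i\<bar> \<le> 5 * (1 / N ^ 4)"
  proof -
    have "\<bar>q - s\<bar> \<le> 5 * t" if "\<bar>q - p\<bar> \<le> t" "\<bar>p - r\<bar> \<le> t" "\<bar>s - r\<bar> \<le> 3 * t" for p q r s t :: real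
      using that by linarith
    from this[OF 2 1 3] show ?thesis .
  qed
  also have "\<dots> \<le> 1 / N"
  proof -
    have "2 * 2 * 2 \<le> N * N * N" using N_ge_2 by (intro mult_mono) auto
    then have "5 * N \<le> N * N * N * N" using N_pos by (intro mult_right_mono) auto
    then show ?thesis using N_pos by (simp add: divide_le_eq le_divide_eq eval_nat_numeral mult_ac)
  qed
  also have "\<dots> \<le> \<epsilon>" using \<epsilon> N_pos by (simp add: divide_le_eq mult.commute)
  finally show ?thesis .
qed

lemma output_correct:
  assumes \<gamma>: "1 \<le> 2 ^ g * \<gamma>" "0 < \<gamma>" and \<epsilon>: "1 \<le> N * \<epsilon>"
  shows "measure_pmf.prob out_pmf
     {xs. vec_additive_approx \<epsilon> (vec_of_list xs) (pseudo_inverse (laplacian (graph I)) *\<^sub>v rhs I)} \<ge> 1 - \<gamma>"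
proof -
  define J where "J m xs \<longleftrightarrow> length xs = m \<and> (\<forall>i<m. \<bar>xs ! i - sol i\<bar> \<le> \<epsilon>)" for m and xs :: "real list"
  have "measure_pmf.prob out_pmf {xs. J n xs} \<ge> 1 - n * (\<gamma> / n)"
    unfolding out_pmf_def
  proof (rule prob_iter_ge[where J = J])
    fix m xs assume *: "m < n" "J m xs"
    let ?g = "\<lambda>a. xs @ [of_int (a div int g) / 2 ^ oe]"
    let ?bad = "{a. \<bar>real_of_int a - R * measure_pmf.expectation (run_pmf m) real_of_int\<bar> \<ge> R * (2 ^ k * 2 ^ k * N / N ^ 4)}"
    have [simp]: "length xs = m" using * by (simp add: J_def)
    have "1 - \<gamma> / n \<le> 1 - measure_pmf.prob (acc_pmf m) ?bad" using acc_concentration[OF *(1) \<gamma>(1)] by simp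
    also have "\<dots> = measure_pmf.prob (acc_pmf m) (- ?bad)"
      using measure_pmf.prob_compl[of ?bad "acc_pmf m"] by (simp add: Compl_eq_Diff_UNIV)
    also have "\<dots> \<le> measure_pmf.prob (acc_pmf m) (?g -` {ys. J (Suc m) ys})"
    proof (rule measure_pmf.finite_measure_mono)
      show "- ?bad \<subseteq> ?g -` {ys. J (Suc m) ys}"
        using * output_close[OF *(1) \<epsilon>] by (auto simp: J_def nth_append less_Suc_eq not_le)
    qed simp
    also have "\<dots> = measure_pmf.prob (map_pmf ?g (acc_pmf m)) {ys. J (Suc m) ys}" by simp
    finally show "measure_pmf.prob (bind_pmf (acc_pmf (length xs)) (\<lambda>a. return_pmf (?g a))) {ys. J (Suc m) ys} \<ge> 1 - \<gamma> / n"
      by (simp add: map_pmf_def)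
  qed (use \<gamma> in \<open>auto simp: J_def\<close>)
  also have "n * (\<gamma> / n) = \<gamma>" using n0 by simp
  finally have "1 - \<gamma> \<le> measure_pmf.prob out_pmf {xs. J n xs}" .
  also have "\<dots> \<le> measure_pmf.prob out_pmf
     {xs. vec_additive_approx \<epsilon> (vec_of_list xs) (pseudo_inverse (laplacian (graph I)) *\<^sub>v rhs I)}"
  proof (rule measure_pmf.finite_measure_mono)
    have dim: "dim_row (pseudo_inverse (laplacian (graph I))) = n"
      by (rule pseudo_inverse_dim[OF laplacian_carrier laplacian_sym])
    show "{xs. J n xs} \<subseteq> {xs. vec_additive_approx \<epsilon> (vec_of_list xs) (pseudo_inverse (laplacian (graph I)) *\<^sub>v rhs I)}"
      by (auto simp: vec_additive_approx_def dim J_def vec_of_list_index simp del: index_mult_mat_vec)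
  qed simp
  finally show ?thesis .
qed

end

section \<open>Space and correctness\<close>

lemma run_eq_steps: "run P I t = steps I t (P, \<lambda>_. 0, [])"
  by (simp add: run_def steps_def)

text \<open>The coupling pairs each value with an output equal to it, so \<open>X\<close> is exactly
  the distribution of the output tape.\<close>

lemma computes_outputs_with_prob:
  assumes c: "computes I B P (\<lambda>_. 0) [] X (\<lambda>x s' out'. out' = x)"
    and p: "measure_pmf.prob X {xs. Q (vec_of_list xs)} \<ge> p"
  shows "outputs_with_prob P I p Q"
proof -
  from c obtain D where D: "halts I B (P, \<lambda>_. 0, []) D"
    "rel_pmf (\<lambda>x (_, s', out'). bounded_store B s' \<and> out' = x) X D" by (auto simp: computes_def)
  have "rel_pmf (\<lambda>x y. x = snd (snd y)) X D" by (rule pmf.rel_mono_strong[OF D(2)]) auto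
  then have "rel_pmf (=) X (map_pmf (\<lambda>y. snd (snd y)) D)" by (simp add: pmf.rel_map)
  then have X: "X = map_pmf (\<lambda>y. snd (snd y)) D" by (simp add: pmf.rel_eq)
  obtain T where T: "steps I T (P, \<lambda>_. 0, []) = D" using halts_steps[OF D(1)] by blast
  have eq: "(\<lambda>y. snd (snd y)) -` {xs. Q (vec_of_list xs)} = {(c, s, out). Q (vec_of_list out)}" by auto
  have "measure_pmf.prob D {(c, s, out). Q (vec_of_list out)} \<ge> p"
    using p unfolding X measure_map_pmf eq .
  moreover have "\<forall>(c, s, out) \<in> set_pmf D. c = Skip" using halts_steps[OF D(1)] by blast
  ultimately show ?thesis unfolding outputs_with_prob_def run_eq_steps using T by blast
qed

lemma computes_uses_space:
  fixes b :: real
  assumes c: "computes I B P (\<lambda>_. 0) [] X Q"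
    and b: "real (card (regs P) * (1 + floorlog 2 (nat B))) \<le> b"
  shows "uses_space P I b"
  unfolding uses_space_def run_eq_steps
proof (intro allI ballI, clarify)
  fix t c' s out assume *: "(c', s, out) \<in> set_pmf (steps I t (P, \<lambda>_. 0, []))"
  from c obtain D where "halts I B (P, \<lambda>_. 0, []) D" by (auto simp: computes_def)
  from halts_steps[OF this] * have s: "bounded_store B s" by blast
  have "space P s \<le> (\<Sum>r\<in>regs P. 1 + floorlog 2 (nat B))"
    unfolding space_def by (intro sum_mono add_left_mono floorlog_mono nat_mono) (use s in \<open>auto simp: bounded_store_def\<close>)
  also have "\<dots> = card (regs P) * (1 + floorlog 2 (nat B))" by simp
  finally have "real (space P s) \<le> real (card (regs P) * (1 + floorlog 2 (nat B)))" by (simp only: of_nat_le_iff)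
  then show "real (space P s) \<le> b" using b by linarith
qed

lemma least_power_bounds:
  fixes x :: real and m0 :: nat
  assumes "0 < x"
  defines "m \<equiv> LEAST m. m0 \<le> m \<and> 1 \<le> 2 ^ m * x"
  shows "m0 \<le> m" "1 \<le> 2 ^ m * x" "\<And>j. m0 \<le> j \<Longrightarrow> j < m \<Longrightarrow> 2 ^ j * x < 1"
proof -
  obtain j where "1 / x < 2 ^ j" using real_arch_pow[of 2 "1 / x"] by auto
  also have "(2::real) ^ j \<le> 2 ^ (m0 + j)" by (intro power_increasing) auto
  finally have "m0 \<le> m0 + j \<and> 1 \<le> 2 ^ (m0 + j) * x" using assms(1) by (simp add: divide_less_eq)
  from LeastI[of "\<lambda>m. m0 \<le> m \<and> 1 \<le> 2 ^ m * x", OF this] show "m0 \<le> m" "1 \<le> 2 ^ m * x"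
    by (simp_all add: m_def)
  show "2 ^ j * x < 1" if "m0 \<le> j" "j < m" for j
    using not_less_Least[of j "\<lambda>m. m0 \<le> m \<and> 1 \<le> 2 ^ m * x"] that by (auto simp: m_def)
qed

section \<open>Assembly of the solver and the final space bound\<close>

definition solver_prog :: "nat \<Rightarrow> program" where
  "solver_prog C = Seq (init_prog (prec_exp C) (len_exp C) (runs_exp C) (out_exp C))
     (block [Const rVertex 0, Loop rVertex rSize vertex_prog])"

text \<open>The largest exponent to be covered is 37 * C + 131, from the sum over all steps and runs
  of one vertex; it is rounded up.\<close>

definition bound_exp :: "nat \<Rightarrow> nat" where "bound_exp C = 40 * C + 140"

lemma solver_instance:
  fixes G :: wgraph and b :: "real vec" and \<epsilon> \<gamma> :: real and C :: nat
  defines "n \<equiv> nverts G"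
  assumes G: "weighted_graph G"
    and w: "\<And>i j. (i, j) \<in> edges G \<Longrightarrow> 1 / real n ^ C \<le> wt G i j \<and> wt G i j \<le> real n ^ C"
    and b: "b \<in> eigen_image (laplacian G)" "b \<bullet> b = 1"
    and \<epsilon>: "0 < \<epsilon>" "\<epsilon> < 1" and \<gamma>: "0 < \<gamma>" "\<gamma> < 1"
  defines "I \<equiv> \<lparr>graph = G, rhs = b, eps = \<epsilon>, gam = \<gamma>\<rparr>"
  obtains B :: int and e g :: nat and X :: "real list pmf" where
    "computes I B (solver_prog C) (\<lambda>_. 0) [] X (\<lambda>x s' out'. out' = x)"
    "measure_pmf.prob X {xs. vec_additive_approx \<epsilon> (vec_of_list xs) (pseudo_inverse (laplacian G) *\<^sub>v b)} \<ge> 1 - \<gamma>"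
    "B = int g * 2 ^ (e * bound_exp C)" "1 \<le> g" "2 ^ e \<le> 2 * (real n / \<epsilon>)" "real g \<le> 1 + log 2 (1 / \<gamma>)" "1 \<le> n"
proof -
  have L: "laplacian G \<in> carrier_mat n n" by (simp add: laplacian_def n_def)
  have bc: "b \<in> carrier_vec n" using eigen_image_carrier[OF L b(1)] .
  have n1: "1 \<le> n" using bc b(2) by (cases n) (auto simp: scalar_prod_def)
  have n2: "2 \<le> n"
  proof (rule ccontr)
    assume "\<not> 2 \<le> n"
    then have n: "n = 1" using n1 by simp
    text \<open>On a single vertex the Laplacian is zero, so its image contains no unit vector.\<close>
    have "laplacian G = 0\<^sub>m 1 1"
      using n by (intro eq_matI) (auto simp: laplacian_def n_def degree_def)
    then have "unit_vec 1 0 \<bullet> b = 0"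
      by (intro eigen_image_orthogonal[where A = "laplacian G" and n = 1]) (use b in auto)
    moreover have "b \<in> carrier_vec 1" using bc n by simp
    ultimately show False using b(2) by (simp add: scalar_prod_def)
  qed
  define e0 where "e0 = (LEAST m. n \<le> 2 ^ m)"
  have e0: "n \<le> 2 ^ e0" "\<And>m. m < e0 \<Longrightarrow> 2 ^ m < n"
  proof -
    have "n \<le> 2 ^ n" by (simp add: less_imp_le)
    then show "n \<le> 2 ^ e0" unfolding e0_def by (rule LeastI)
    show "2 ^ m < n" if "m < e0" for m
      using not_less_Least[of m "\<lambda>m. n \<le> 2 ^ m"] that by (simp add: e0_def)
  qed
  define e where "e = (LEAST m. e0 \<le> m \<and> 1 \<le> 2 ^ m * \<epsilon>)"
  note e = least_power_bounds[OF \<epsilon>(1), of e0, folded e_def]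
  define g where "g = (LEAST m. 0 \<le> m \<and> 1 \<le> 2 ^ m * \<gamma>)"
  note g = least_power_bounds[OF \<gamma>(1), of 0, folded g_def]
  have e0_1: "1 \<le> e0" using e0(1) n2 by (cases e0) auto
  then have e1: "1 \<le> e" using e(1) by simp
  have g1: "1 \<le> g" using g(2) \<gamma>(2) by (cases g) auto
  define k where "k = prec_exp C * e"
  define T where "T = (2::nat) ^ (e * len_exp C)"
  define R where "R = 2 ^ (e * runs_exp C) * g"
  define oe where "oe = out_exp C * e"
  define N :: real where "N = 2 ^ e"
  have nN: "n \<le> 2 ^ e" by (rule order_trans[OF e0(1) power_increasing[OF e(1) one_le_numeral]])
  then have "int n \<le> int (2 ^ e)" by (simp only: of_nat_le_iff)
  then have nN_int: "int n \<le> 2 ^ e" by simp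
  have "real n \<le> real (2 ^ e)" using nN by (simp only: of_nat_le_iff)
  then have nN': "real n \<le> N" by (simp add: N_def)
  have N2: "2 \<le> N" using nN' n2 by simp
  define B where "B = int g * 2 ^ (e * bound_exp C)"
  have pow_gB: "int g * 2 ^ (e * m) \<le> B" if "m \<le> bound_exp C" for m
    unfolding B_def using that by (intro mult_left_mono power_increasing) auto
  have pow_B: "2 ^ (e * m) \<le> B" if "m \<le> bound_exp C" for m
  proof -
    have "1 * (2::int) ^ (e * m) \<le> int g * 2 ^ (e * m)" using g1 by (intro mult_right_mono) auto
    then show ?thesis using pow_gB[OF that] by linarith
  qed
  have le_pow: "int m \<le> 2 ^ m" for m
  proof -
    have "int m \<le> int (2 ^ m)" using less_exp[of m] by (simp only: of_nat_le_iff less_imp_le)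
    then show ?thesis by simp
  qed
  have eB: "(2::int) ^ e \<le> B" using pow_B[of 1] by (simp add: bound_exp_def)
  have KK: "(2::int) ^ k * 2 ^ k = 2 ^ (e * (2 * prec_exp C))"
  proof -
    have "e * (2 * prec_exp C) = k + k" by (simp add: k_def algebra_simps)
    then show ?thesis by (simp only: power_add)
  qed
  have KB: "(2::int) ^ k \<le> B" using pow_B[of "prec_exp C"] by (simp add: k_def exps bound_exp_def mult.commute)
  interpret machine: walk_machine I B n e g k T R oe
  proof
    show "nverts (graph I) = n" by (simp add: I_def n_def)
    show "n \<le> 2 ^ e" by fact
    show "0 \<le> wt (graph I) i j" for i j
      using G unfolding weighted_graph_def I_def by (simp, metis less_imp_le order_refl)
    show "wt (graph I) i j = 0" if "n \<le> j" for i j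
      using G that unfolding weighted_graph_def I_def n_def by (simp, metis SigmaD2 leD lessThan_iff subsetD)
    show "int n \<le> B" using nN_int eB by linarith
    show "int e \<le> B" using le_pow[of e] eB by linarith
    show "int k \<le> B" using le_pow[of k] KB by linarith
    show "(2::int) ^ k * 2 ^ k \<le> B" unfolding KK by (rule pow_B) (simp add: exps bound_exp_def)
    show "int T \<le> B" using pow_B[of "len_exp C"] by (simp add: T_def exps bound_exp_def)
    show "int R \<le> B" using pow_gB[of "runs_exp C"] by (simp add: R_def exps bound_exp_def mult.commute)
  qed fact+
  have N_C: "1 / N ^ C \<le> wt G i j \<and> wt G i j \<le> N ^ C" if "(i, j) \<in> edges G" for i j
  proof -
    have "real n ^ C \<le> N ^ C" using nN' by (intro power_mono) auto
    moreover from this have "1 / N ^ C \<le> 1 / real n ^ C" using n1 N2 by (intro divide_left_mono) auto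
    ultimately show ?thesis using w[OF that] by linarith
  qed
  have w_le: "wt G i j \<le> N ^ C" for i j
    using N_C[of i j] G N2 unfolding weighted_graph_def by (cases "(i, j) \<in> edges G") auto
  interpret solver: laplacian_solver I B n e g k T R oe "1 / N ^ C" "N ^ (C + 1)" C
  proof
    show "weighted_graph (graph I)" "nverts (graph I) = n" using G by (simp_all add: I_def n_def)
    show "0 < 1 / N ^ C" using N2 by simp
    show "1 / N ^ C \<le> wt (graph I) i j" if "(i, j) \<in> edges (graph I)" for i j
      using N_C[of i j] that by (simp add: I_def)
    show "degree (graph I) i \<le> N ^ (C + 1)" if "i < n" for i
    proof -
      have "degree (graph I) i \<le> (\<Sum>j<n. N ^ C)"
        unfolding degree_def by (simp only: I_def problem.select_convs n_def[symmetric]) (intro sum_mono w_le)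
      also have "\<dots> \<le> N * N ^ C" using nN' N2 by (simp add: mult_right_mono)
      finally show ?thesis by simp
    qed
    show "rhs I \<in> eigen_image (laplacian (graph I))" "rhs I \<bullet> rhs I = 1" using b by (simp_all add: I_def)
    show "0 < N ^ (C + 1)" using N2 by simp
    show "2 * real n \<le> 2 ^ k * (1 / N ^ C)"
    proof -
      have "2 * real n \<le> N * N" using nN' N2 by (intro mult_mono) auto
      also have "\<dots> \<le> N ^ (prec_exp C - C)"
        using N2 power_increasing[of 2 "prec_exp C - C" N] by (simp add: power2_eq_square exps)
      also have "\<dots> = N ^ prec_exp C / N ^ C" using N2 by (intro power_diff) (auto simp: exps)
      finally show ?thesis by (simp add: k_def N_def power_mult[symmetric] mult.commute)
    qed
  qed (use e1 n1 in \<open>simp_all add: k_def T_def R_def oe_def N_def\<close>)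
  interpret bounded: bounded_walk_machine I B n e g k T R oe solver.value_bound
  proof
    show "4 * (2 ^ k * 2 ^ k * machine.deg_int x) + 4 \<le> B" if "x < n" for x
    proof -
      have "machine.wt_int x j \<le> 2 ^ k * 2 ^ (e * C)" for j
      proof -
        have "2 ^ k * wt (graph I) x j \<le> 2 ^ k * N ^ C"
          using w_le[of x j] by (intro mult_left_mono) (simp_all add: I_def)
        from order_trans[OF of_int_floor_le this]
        have "real_of_int (machine.wt_int x j) \<le> 2 ^ k * N ^ C" unfolding machine.wt_int_def .
        also have "\<dots> = real_of_int (2 ^ k * 2 ^ (e * C))" by (simp add: N_def power_mult)
        finally have "real_of_int (machine.wt_int x j) \<le> real_of_int (2 ^ k * 2 ^ (e * C))" .
        then show ?thesis by (simp only: of_int_le_iff)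
      qed
      then have "machine.deg_int x \<le> (\<Sum>j<n. 2 ^ k * 2 ^ (e * C))"
        unfolding machine.deg_int_def by (intro sum_mono)
      also have "\<dots> = int n * (2 ^ k * 2 ^ (e * C))" by simp
      also have "\<dots> \<le> 2 ^ e * (2 ^ k * 2 ^ (e * C))"
        by (rule mult_right_mono[OF nN_int]) simp
      finally have "2 ^ k * 2 ^ k * machine.deg_int x \<le> 2 ^ k * 2 ^ k * (2 ^ e * (2 ^ k * 2 ^ (e * C)))"
        by (intro mult_left_mono) auto
      also have "\<dots> = 2 ^ (e * (3 * prec_exp C + C + 1))"
      proof -
        have "e * (3 * prec_exp C + C + 1) = k + k + (e + (k + e * C))" by (simp add: k_def algebra_simps)
        then show ?thesis by (simp only: power_add)
      qed
      finally have d: "2 ^ k * 2 ^ k * machine.deg_int x \<le> 2 ^ (e * (3 * prec_exp C + C + 1))" .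
      have "(1::int) \<le> 2 ^ (e * (3 * prec_exp C + C + 1))" by simp
      then have "4 * (2 ^ k * 2 ^ k * machine.deg_int x) + 4 \<le> 8 * 2 ^ (e * (3 * prec_exp C + C + 1))"
        using d by linarith
      \<comment> \<open>The constant 8 is absorbed by three more factors N, since e \<ge> 1.\<close>
      also have "\<dots> = 2 ^ (3 + e * (3 * prec_exp C + C + 1))" by (simp add: power_add)
      also have "\<dots> \<le> 2 ^ (e * (3 * prec_exp C + C + 4))"
        using e1 by (intro power_increasing) (auto simp: algebra_simps)
      also have "\<dots> \<le> B" by (rule pow_B) (simp add: exps bound_exp_def)
      finally show ?thesis .
    qed
    show "\<bar>machine.contrib i x\<bar> \<le> solver.value_bound" if "i < n" "x < n" for i x
      using solver.contrib_bound[OF that] .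
    show "\<bar>fixed_point (rhs_entry I (int x)) (int k)\<bar> \<le> B" for x
      using solver.fixed_rhs_bound[of x] KB by linarith
    show "int R * (int T * solver.value_bound) \<le> B"
    proof -
      have "int R * (int T * solver.value_bound) = int g * 2 ^ (e * (runs_exp C + len_exp C + 2 * prec_exp C + (C + 2)))"
      proof -
        have "e * (runs_exp C + len_exp C + 2 * prec_exp C + (C + 2)) =
            e * runs_exp C + (e * len_exp C + (e * (2 * prec_exp C) + e * (C + 2)))"
          by (simp add: algebra_simps)
        then show ?thesis
          by (simp only: power_add R_def T_def solver.value_bound_def KK of_nat_mult of_nat_power of_nat_numeral mult_ac)
      qed
      also have "\<dots> \<le> B" by (rule pow_gB) (simp add: exps bound_exp_def)
      finally show ?thesis .
    qed
  qed (use g1 in \<open>auto simp: R_def T_def\<close>)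
  have gB: "int g \<le> B" using pow_gB[of 0] by simp
  have "int (out_exp C) * int e \<le> 2 ^ (out_exp C) * 2 ^ e" by (intro mult_mono le_pow) auto
  also have "\<dots> \<le> 2 ^ (e * out_exp C) * (2::int) ^ e" using e1 by (intro mult_right_mono power_increasing) auto
  also have "\<dots> = 2 ^ (e * (out_exp C + 1))" by (simp add: power_add distrib_left)
  also have "\<dots> \<le> B" by (rule pow_B) (simp add: exps bound_exp_def)
  finally have oeB: "int oe \<le> B" by (simp add: oe_def)
  have exp_B: "int m \<le> B" if "m \<le> bound_exp C" for m
  proof -
    have "int m \<le> 2 ^ m" by (rule le_pow)
    also have "\<dots> \<le> (2::int) ^ (e * m)" using e1 by (intro power_increasing) auto
    finally show ?thesis using pow_B[OF that] by linarith
  qed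
  have init: "computes I B (init_prog (prec_exp C) (len_exp C) (runs_exp C) (out_exp C)) (\<lambda>_. 0) [] (return_pmf ())
      (\<lambda>_ s' out'. out' = [] \<and> machine.params s')"
  proof (rule machine.computes_init[OF e0(2,1) e(1)])
    show "2 ^ m * eps I < 1" if "e0 \<le> m" "m < e" for m using e(3)[OF that] by (simp add: I_def)
    show "1 \<le> 2 ^ e * eps I" "0 < eps I" "eps I < 1" using e(2) \<epsilon> by (simp_all add: I_def)
    show "2 ^ m * gam I < 1" if "m < g" for m using g(3)[of m] that by (simp add: I_def)
    show "1 \<le> 2 ^ g * gam I" "0 < gam I" using g(2) \<gamma> by (simp_all add: I_def)
    show "2 ^ (e * prec_exp C) \<le> B" "2 ^ (e * runs_exp C) \<le> B"
      by (simp_all add: pow_B exps bound_exp_def)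
    show "int (prec_exp C) \<le> B" "int (out_exp C) \<le> B"
      by (rule exp_B, simp add: exps bound_exp_def)+
  qed (rule k_def T_def R_def oe_def oeB gB | assumption)+
  have prog: "computes I B (solver_prog C) (\<lambda>_. 0) [] machine.out_pmf (\<lambda>x s' out'. out' = x)"
    unfolding solver_prog_def
  proof (rule computes_Seq_det[OF init])
    fix s' and out' :: "real list"
    assume "bounded_store B s'" "out' = [] \<and> machine.params s'"
    then show "computes I B (block [Const rVertex 0, Loop rVertex rSize vertex_prog]) s' out' machine.out_pmf (\<lambda>x s' out'. out' = x)"
      using bounded.computes_all_vertices by blast
  qed
  have correct: "measure_pmf.prob machine.out_pmf
       {xs. vec_additive_approx \<epsilon> (vec_of_list xs) (pseudo_inverse (laplacian G) *\<^sub>v b)} \<ge> 1 - \<gamma>"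
    using solver.output_correct[of \<gamma> \<epsilon>] g(2) e(2) \<gamma> by (simp add: solver.N_def I_def)
  \<comment> \<open>Minimality: with one exponent less, either 2^e fails to reach n or it fails to
    reach 1 / \<epsilon>. The same argument bounds \<open>g\<close> below.\<close>
  have e_bound: "2 ^ e \<le> 2 * (real n / \<epsilon>)"
  proof (cases "e = e0")
    case True
    obtain j where j: "e0 = Suc j" using e0_1 by (cases e0) auto
    have "real (2 ^ j) < real n" using e0(2)[of j] j by (simp only: of_nat_less_iff)
    then have "2 ^ e \<le> 2 * real n" using True j by simp
    also have "\<dots> \<le> 2 * (real n / \<epsilon>)" using \<epsilon> by (simp add: le_divide_eq mult_left_le)
    finally show ?thesis .
  next
    case False
    then obtain j where j: "e = Suc j" "e0 \<le> j" using e(1) by (cases e) auto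
    then have "2 ^ j * \<epsilon> < 1" using e(3)[of j] by simp
    then have "2 ^ e * \<epsilon> \<le> 2 * real n" using j n1 by simp
    then show ?thesis using \<epsilon> by (simp add: le_divide_eq)
  qed
  have g_bound: "real g \<le> 1 + log 2 (1 / \<gamma>)"
  proof -
    obtain j where j: "g = Suc j" using g1 by (cases g) auto
    have "2 ^ j * \<gamma> < 1" using g(3)[of j] j by simp
    then have "2 ^ j \<le> 1 / \<gamma>" using \<gamma> by (simp add: le_divide_eq)
    then have "log 2 (2 ^ j) \<le> log 2 (1 / \<gamma>)" by (subst log_le_cancel_iff) (use \<gamma> in auto)
    then show ?thesis by (simp add: j log_nat_power)
  qed
  show thesis
    using that[OF prog correct] e_bound g_bound g1 n1 by (simp add: B_def)
qed

text \<open>log B = log g + e * m, where e is about log (n / \<epsilon>) and log g about log (log (1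
  / \<gamma>)); the two parts of \<open>B\<close> give the two parts of the space bound.\<close>

lemma log_bound:
  assumes B: "B = int g * 2 ^ (e * m)" and g: "1 \<le> g" "real g \<le> 1 + log 2 (1 / \<gamma>)" and n: "1 \<le> n"
    and \<epsilon>: "0 < \<epsilon>" "\<epsilon> < 1" and e: "2 ^ e \<le> 2 * (real n / \<epsilon>)"
  shows "1 + floorlog 2 (nat B) \<le> (3 + real m) * (1 + log 2 (real n / \<epsilon>) + max 0 (log 2 (log 2 (1 / \<gamma>))))"
proof -
  define x where "x = log 2 (real n / \<epsilon>)"
  define y where "y = max 0 (log 2 (log 2 (1 / \<gamma>)))"
  have "1 \<le> real n / \<epsilon>" using n \<epsilon> by (simp add: le_divide_eq)
  then have x: "0 \<le> x" by (simp add: x_def)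
  have "log 2 (2 ^ e) \<le> log 2 (2 * (real n / \<epsilon>))" using e n \<epsilon> by (subst log_le_cancel_iff) auto
  also have "\<dots> = 1 + x" unfolding x_def using n \<epsilon> by (subst log_mult) auto
  finally have e': "real e \<le> 1 + x" by (simp add: log_nat_power)
  have g': "log 2 (real g) \<le> 1 + y"
  \<comment> \<open>For \<gamma> above 1/2 the double logarithm is negative and the maximum with 0
    takes over; then g < 2, and the constant 1 suffices.\<close>
  proof (cases "1 \<le> log 2 (1 / \<gamma>)")
    case True
    have "log 2 (real g) \<le> log 2 (2 * log 2 (1 / \<gamma>))" using g True by (subst log_le_cancel_iff) auto
    also have "\<dots> = 1 + log 2 (log 2 (1 / \<gamma>))" using True by (subst log_mult) auto
    finally show ?thesis by (simp add: y_def)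
  next
    case False
    then have "log 2 (real g) \<le> log 2 2" using g by (subst log_le_cancel_iff) auto
    then show ?thesis by (simp add: y_def)
  qed
  have "0 < B" using g by (simp add: B)
  then have B1: "1 \<le> nat B" by linarith
  have "real (nat B) = real g * 2 ^ (e * m)" by (simp add: B nat_mult_distrib nat_power_eq)
  then have logB: "log 2 (real (nat B)) = log 2 (real g) + real (e * m)"
    using g by (simp add: log_mult log_nat_power)
  have "real (floorlog 2 (nat B)) \<le> log 2 (real (nat B)) + 1"
    using B1 unfolding floorlog_def by simp
  then have "1 + real (floorlog 2 (nat B)) \<le> 3 + y + real e * real m"
    using logB g' by simp
  also have "\<dots> \<le> 3 + y + (1 + x) * real m" using e' by (intro add_left_mono mult_right_mono) auto
  also have "\<dots> \<le> (3 + real m) * (1 + x + y)"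
  proof -
    have "0 \<le> y" by (simp add: y_def)
    then have "0 \<le> real m * y" "0 \<le> x" using x by auto
    then show ?thesis using \<open>0 \<le> y\<close> by (simp add: algebra_simps)
  qed
  finally show ?thesis by (simp add: x_def y_def)
qed

theorem theorem1:
  fixes c c' :: real
  assumes "c > 0" and "c' > 0"
  shows "\<exists>(P :: program) (K :: real).
    \<forall>(G :: wgraph) (b :: real vec) (\<epsilon> :: real) (\<gamma> :: real).
      weighted_graph G \<and>
      (\<forall>(i, j) \<in> edges G. real (nverts G) powr (- c) \<le> wt G i j \<and> wt G i j \<le> real (nverts G) powr c') \<and>
      b \<in> eigen_image (laplacian G) \<and> b \<bullet> b = 1 \<and>
      0 < \<epsilon> \<and> \<epsilon> < 1 \<and> 0 < \<gamma> \<and> \<gamma> < 1 \<longrightarrow>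
      (let I = \<lparr>graph = G, rhs = b, eps = \<epsilon>, gam = \<gamma>\<rparr> in
        outputs_with_prob P I (1 - \<gamma>)
          (\<lambda>x. vec_additive_approx \<epsilon> x (pseudo_inverse (laplacian G) *\<^sub>v b)) \<and>
        uses_space P I
          (K * (1 + log 2 (real (nverts G) / \<epsilon>) + max 0 (log 2 (log 2 (1 / \<gamma>))))))"
proof -
  \<comment> \<open>A natural exponent dominating both \<open>c\<close> and \<open>c'\<close> turns
    the real powers of n \<ge> 1 into natural ones and fixes the program.\<close>
  define C where "C = nat \<lceil>max c c'\<rceil>"
  have C: "c \<le> real C" "c' \<le> real C" unfolding C_def by linarith+
  define P where "P = solver_prog C"
  \<comment> \<open>The number of registers times the constant of \<open>log_bound\<close> for a
    single register.\<close>
  define K where "K = real (card (regs P)) * (3 + real (bound_exp C))"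
  show ?thesis
  proof (intro exI[of _ P] exI[of _ K] allI impI, elim conjE)
    fix G :: wgraph and b :: "real vec" and \<epsilon> \<gamma> :: real
    assume G: "weighted_graph G"
      and w: "\<forall>(i, j) \<in> edges G. real (nverts G) powr (- c) \<le> wt G i j \<and> wt G i j \<le> real (nverts G) powr c'"
      and b: "b \<in> eigen_image (laplacian G)" "b \<bullet> b = 1"
      and \<epsilon>: "0 < \<epsilon>" "\<epsilon> < 1" and \<gamma>: "0 < \<gamma>" "\<gamma> < 1"
    let ?I = "\<lparr>graph = G, rhs = b, eps = \<epsilon>, gam = \<gamma>\<rparr>"
    let ?n = "nverts G"
    have w': "1 / real ?n ^ C \<le> wt G i j \<and> wt G i j \<le> real ?n ^ C" if ij: "(i, j) \<in> edges G" for i j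
    proof -
      have "i < ?n" using G ij unfolding weighted_graph_def by auto
      then have n: "1 \<le> real ?n" by simp
      have "real ?n powr (- real C) \<le> real ?n powr (- c)" "real ?n powr c' \<le> real ?n powr real C"
        using C n by (auto intro: powr_mono)
      moreover have "real ?n powr (- real C) = 1 / real ?n ^ C" "real ?n powr real C = real ?n ^ C"
        using n by (simp_all add: powr_minus_divide powr_realpow)
      ultimately show ?thesis using w ij by fastforce
    qed
    obtain B e g X where c: "computes ?I B P (\<lambda>_. 0) [] X (\<lambda>x s' out'. out' = x)"
      and p: "measure_pmf.prob X {xs. vec_additive_approx \<epsilon> (vec_of_list xs) (pseudo_inverse (laplacian G) *\<^sub>v b)} \<ge> 1 - \<gamma>"
      and B: "B = int g * 2 ^ (e * bound_exp C)" "1 \<le> g" "2 ^ e \<le> 2 * (real ?n / \<epsilon>)" "real g \<le> 1 + log 2 (1 / \<gamma>)" "1 \<le> ?n"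
      unfolding P_def by (rule solver_instance[OF G w' b \<epsilon> \<gamma>])
    have "real (card (regs P)) * real (1 + floorlog 2 (nat B)) \<le>
        real (card (regs P)) * ((3 + real (bound_exp C)) * (1 + log 2 (real ?n / \<epsilon>) + max 0 (log 2 (log 2 (1 / \<gamma>)))))"
      using log_bound[OF B(1,2,4,5) \<epsilon> B(3)] by (intro mult_left_mono) auto
    then have "real (card (regs P) * (1 + floorlog 2 (nat B))) \<le>
        K * (1 + log 2 (real ?n / \<epsilon>) + max 0 (log 2 (log 2 (1 / \<gamma>))))"
      by (simp only: K_def mult.assoc of_nat_mult)
    then have "uses_space P ?I (K * (1 + log 2 (real ?n / \<epsilon>) + max 0 (log 2 (log 2 (1 / \<gamma>)))))"
      by (rule computes_uses_space[OF c])
    moreover have "outputs_with_prob P ?I (1 - \<gamma>)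
          (\<lambda>x. vec_additive_approx \<epsilon> x (pseudo_inverse (laplacian G) *\<^sub>v b))"
      by (rule computes_outputs_with_prob[OF c p])
    ultimately show "let I = ?I in outputs_with_prob P I (1 - \<gamma>)
          (\<lambda>x. vec_additive_approx \<epsilon> x (pseudo_inverse (laplacian G) *\<^sub>v b)) \<and>
        uses_space P I
          (K * (1 + log 2 (real (nverts G) / \<epsilon>) + max 0 (log 2 (log 2 (1 / \<gamma>)))))"
      by (simp add: Let_def)
  qed
qed

end
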